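(* Let $\mathbb{E}$ be any rearrangement invariant Banach function space over $(\mathbb{R}_+,dt)$ with Boyd indices $p_{\mathbb{E}},q_{\mathbb{E}}\in(1,\infty)$. Then the following statements hold. (a) For every weight $w\in\bigcup_{q<p_{\mathbb{E}}}M_q$ the operator $P$ is bounded on $\mathbb{E}_w$, that is, $\bigcup_{q<p_{\mathbb{E}}}M_q\subseteq M_{\mathbb{E}}$. (b) For every weight $w\in\bigcup_{q<p_{\mathbb{E}}}M^q$ the operator $Q$ is bounded on $\mathbb{E}_w$, that is, $\bigcup_{q<p_{\mathbb{E}}}M^q\subseteq M^{\mathbb{E}}$. (c) For every weight $w\in\bigcup_{q<p_{\mathbb{E}}}(M_q\cap M^q)$ the Calderón operator $P+Q$ is bounded on $\mathbb{E}_w$, that is, $\bigcup_{q<p_{\mathbb{E}}}(M_q\cap M^q)\subseteq C_{\mathbb{E}}$. Here the unions are over $q\in[1,p_{\mathbb{E}})$.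
   Context: $\mathbb{R}_+=[0,\infty)$; $L^1_{loc}$ denotes functions locally integrable on $\mathbb{R}_+$; $\mathcal{M}$ denotes the complex measurable functions on $\mathbb{R}_+$. Rearrangement invariant Banach function spaces over $(\mathbb{R}_+,dt)$ are understood in the sense of Bennett–Sharpley (given by a rearrangement invariant Banach function norm $\|\cdot\|_{\mathbb{E}}$, with Fatou property). Operators: $Pf(t)=\frac1t\int_0^tf(s)\,ds$ (Hardy operator, maximal domain $L^1_{loc}$), $Qf(t)=\int_t^\infty f(s)\,\frac{ds}{s}$ (maximal domain: measurable $f$ with $f\chi_{(\tau,\infty)}\in L^1(t^{-1}dt)$ for every $\tau>0$). Boyd indices: with dilations $D_tf(s)=f(s/t)$ and $h_{\mathbb{E}}(t)=\|D_t\|_{\mathcal{L}(\mathbb{E})}$, $p_{\mathbb{E}}=\lim_{t\to\infty}\frac{\log t}{\log h_{\mathbb{E}}(t)}$ and $q_{\mathbb{E}}=\lim_{t\to0+}\frac{\log t}{\log h_{\mathbb{E}}(t)}$. One has $1\le p_{\mathbb{E}}\le q_{\mathbb{E}}\le\infty$; for $\mathbb{E}=L^p$ both equal $p$. Weights: a weight is a measurable function $w:(0,\infty)\to(0,\infty)$, always assumed locally integrable on $(0,\infty)$. Write $w(B)=\int_Bw\,dt$. For measurable $f$, $w_f(\lambda)=w(\{|f|>\lambda\})$ and $f^*_w(t)=\inf\{\lambda>0:w_f(\lambda)\le t\}$. $\mathbb{E}_w=\{f\in\mathcal{M}:\|f\|_{\mathbb{E}_w}:=\|f^*_w\|_{\mathbb{E}}<\infty\}$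 (for $\mathbb{E}=L^p$ this is $L^p(\mathbb{R}_+,w\,dt)$). Classes of weights: $M_{\mathbb{E}}$ (resp. $M^{\mathbb{E}}$) is the class of weights $w$ such that $\mathbb{E}_w\subseteq L^1_{loc}$ and $P$ is bounded on $\mathbb{E}_w$ (resp. $\mathbb{E}_w$ is contained in the maximal domain of $Q$ and $Q$ is bounded on $\mathbb{E}_w$). $C_{\mathbb{E}}=M_{\mathbb{E}}\cap M^{\mathbb{E}}$. For $q\in[1,\infty)$, $M_q=M_{L^q}$ and $M^q=M^{L^q}$. *)

theory Defs
  imports "HOL-Analysis.Analysis"
begin

section \<open>Rearrangement invariant Banach function norms (Bennett--Sharpley)\<close>

locale banach_function_norm =
  fixes M :: "'a measure" and \<rho> :: "('a \<Rightarrow> ennreal) \<Rightarrow> ennreal"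
  assumes eq_zero_iff: "f \<in> borel_measurable M \<Longrightarrow> \<rho> f = 0 \<longleftrightarrow> (AE x in M. f x = 0)"
    and scale: "f \<in> borel_measurable M \<Longrightarrow> 0 \<le> a \<Longrightarrow>
      \<rho> (\<lambda>x. ennreal a * f x) = ennreal a * \<rho> f"
    and triangle: "f \<in> borel_measurable M \<Longrightarrow> g \<in> borel_measurable M \<Longrightarrow>
      \<rho> (\<lambda>x. f x + g x) \<le> \<rho> f + \<rho> g"
    and lattice: "f \<in> borel_measurable M \<Longrightarrow> g \<in> borel_measurable M \<Longrightarrow>
      (AE x in M. g x \<le> f x) \<Longrightarrow> \<rho> g \<le> \<rho> f"
    and fatou: "(\<And>n::nat. F n \<in> borel_measurable M) \<Longrightarrow> f \<in> borel_measurable M \<Longrightarrow>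
      (AE x in M. incseq (\<lambda>n. F n x) \<and> (\<lambda>n. F n x) \<longlonglongrightarrow> f x) \<Longrightarrow>
      (\<lambda>n. \<rho> (F n)) \<longlonglongrightarrow> \<rho> f"
    and finite_indicator: "A \<in> sets M \<Longrightarrow> emeasure M A < \<infinity> \<Longrightarrow> \<rho> (indicator A) < \<infinity>"
    and local_L1: "A \<in> sets M \<Longrightarrow> emeasure M A < \<infinity> \<Longrightarrow>
      \<exists>C::real. C > 0 \<and> (\<forall>f \<in> borel_measurable M. (\<integral>\<^sup>+x\<in>A. f x \<partial>M) \<le> ennreal C * \<rho> f)"

definition equimeasurable :: "'a measure \<Rightarrow> ('a \<Rightarrow> ennreal) \<Rightarrow> ('a \<Rightarrow> ennreal) \<Rightarrow> bool" where
  "equimeasurable M f g \<longleftrightarrow>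
     (\<forall>r::real. r \<ge> 0 \<longrightarrow>
        emeasure M {x \<in> space M. f x > ennreal r} = emeasure M {x \<in> space M. g x > ennreal r})"

locale ri_banach_function_norm = banach_function_norm +
  assumes rearrangement_invariant:
    "f \<in> borel_measurable M \<Longrightarrow> g \<in> borel_measurable M \<Longrightarrow>
     (AE x in M. f x < \<infinity>) \<Longrightarrow> (AE x in M. g x < \<infinity>) \<Longrightarrow>
     equimeasurable M f g \<Longrightarrow> \<rho> f = \<rho> g"

text \<open>Functions on \<open>[0,\<infinity>)\<close> are total functions on the reals whose values at negative arguments are
  irrelevant. A space \<open>E\<close> over \<open>([0,\<infinity>), dt)\<close> is represented by its function norm \<open>\<rho>\<close>.\<close>

abbreviation half_line :: "real measure" where
  "half_line \<equiv> lebesgue_on {0..}"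

type_synonym fnorm = "(real \<Rightarrow> ennreal) \<Rightarrow> ennreal"

definition space_norm :: "fnorm \<Rightarrow> (real \<Rightarrow> complex) \<Rightarrow> ennreal" where
  "space_norm \<rho> f = \<rho> (\<lambda>t. ennreal (norm (f t)))"

definition fun_space :: "fnorm \<Rightarrow> (real \<Rightarrow> complex) set" where
  "fun_space \<rho> = {f \<in> borel_measurable half_line. space_norm \<rho> f < \<infinity>}"

text \<open>The function norm of \<open>L\<^sup>p([0,\<infinity>), dt)\<close>, for \<open>1 \<le> p < \<infinity>\<close>.\<close>

definition ennreal_powr :: "ennreal \<Rightarrow> real \<Rightarrow> ennreal" where
  "ennreal_powr x p = (if x = \<infinity> then \<infinity> else ennreal (enn2real x powr p))"

definition Lp_fnorm :: "real \<Rightarrow> fnorm" where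
  "Lp_fnorm p f = ennreal_powr (\<integral>\<^sup>+t. ennreal_powr (f t) p \<partial>half_line) (1 / p)"


section \<open>Boyd indices\<close>

definition dilation :: "real \<Rightarrow> (real \<Rightarrow> complex) \<Rightarrow> real \<Rightarrow> complex" where
  "dilation t f = (\<lambda>s. f (s / t))"

definition dilation_norm :: "fnorm \<Rightarrow> real \<Rightarrow> real" where
  "dilation_norm \<rho> t =
     enn2real (SUP f \<in> {f \<in> fun_space \<rho>. space_norm \<rho> f \<le> 1}. space_norm \<rho> (dilation t f))"

text \<open>The quotient is \<open>\<infinity>\<close> when its denominator vanishes, so that an index is \<open>\<infinity>\<close>
  when the dilation norm is \<open>1\<close> throughout the relevant range, as for \<open>L\<^sup>\<infinity>\<close>.\<close>

definition boyd_quotient :: "fnorm \<Rightarrow> real \<Rightarrow> ereal" where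
  "boyd_quotient \<rho> t =
     (if dilation_norm \<rho> t = 1 then \<infinity> else ereal (ln t / ln (dilation_norm \<rho> t)))"

definition lower_boyd_index :: "fnorm \<Rightarrow> ereal" where
  "lower_boyd_index \<rho> = Lim at_top (boyd_quotient \<rho>)"

definition upper_boyd_index :: "fnorm \<Rightarrow> ereal" where
  "upper_boyd_index \<rho> = Lim (at_right 0) (boyd_quotient \<rho>)"


section \<open>Weighted spaces\<close>

text \<open>Weights live on \<open>(0,\<infinity>)\<close>; in particular they need not be integrable near \<open>0\<close>.\<close>

definition weight :: "(real \<Rightarrow> real) \<Rightarrow> bool" where
  "weight w \<longleftrightarrow> w \<in> borel_measurable (lebesgue_on {0<..}) \<and> (\<forall>t>0. w t > 0) \<and>
     (\<forall>K. compact K \<and> K \<subseteq> {0<..} \<longrightarrow> w absolutely_integrable_on K)"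

definition weight_of :: "(real \<Rightarrow> real) \<Rightarrow> real set \<Rightarrow> ennreal" where
  "weight_of w B = (\<integral>\<^sup>+t\<in>B. ennreal (w t) \<partial>half_line)"

definition weighted_distr :: "(real \<Rightarrow> real) \<Rightarrow> (real \<Rightarrow> complex) \<Rightarrow> real \<Rightarrow> ennreal" where
  "weighted_distr w f r = weight_of w {t \<in> {0..}. norm (f t) > r}"

definition weighted_rearr :: "(real \<Rightarrow> real) \<Rightarrow> (real \<Rightarrow> complex) \<Rightarrow> real \<Rightarrow> ennreal" where
  "weighted_rearr w f t = (INF r \<in> {r. r > 0 \<and> weighted_distr w f r \<le> ennreal t}. ennreal r)"

definition weighted_norm :: "fnorm \<Rightarrow> (real \<Rightarrow> real) \<Rightarrow> (real \<Rightarrow> complex) \<Rightarrow> ennreal" where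
  "weighted_norm \<rho> w f = \<rho> (weighted_rearr w f)"

definition weighted_space :: "fnorm \<Rightarrow> (real \<Rightarrow> real) \<Rightarrow> (real \<Rightarrow> complex) set" where
  "weighted_space \<rho> w = {f \<in> borel_measurable half_line. weighted_norm \<rho> w f < \<infinity>}"


section \<open>Hardy operators and classes of weights\<close>

definition hardy_P :: "(real \<Rightarrow> complex) \<Rightarrow> real \<Rightarrow> complex" where
  "hardy_P f t = (1 / t) *\<^sub>R (LINT s:{0..t}|lebesgue. f s)"

definition hardy_Q :: "(real \<Rightarrow> complex) \<Rightarrow> real \<Rightarrow> complex" where
  "hardy_Q f t = (LINT s:{t<..}|lebesgue. (1 / s) *\<^sub>R f s)"

definition calderon :: "(real \<Rightarrow> complex) \<Rightarrow> real \<Rightarrow> complex" where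
  "calderon f t = hardy_P f t + hardy_Q f t"

definition dom_P :: "(real \<Rightarrow> complex) set" where
  "dom_P = {f \<in> borel_measurable half_line.
     \<forall>K. compact K \<and> K \<subseteq> {0..} \<longrightarrow> f absolutely_integrable_on K}"

definition dom_Q :: "(real \<Rightarrow> complex) set" where
  "dom_Q = {f \<in> borel_measurable half_line.
     \<forall>\<tau>>0. (\<lambda>s. (1 / s) *\<^sub>R f s) absolutely_integrable_on {\<tau><..}}"

text \<open>Boundedness on \<open>E\<^sub>w\<close> of an operator with domain \<open>D\<close>, including that \<open>E\<^sub>w\<close> lies in \<open>D\<close>.\<close>

definition bounded_on_weighted ::
  "fnorm \<Rightarrow> (real \<Rightarrow> real) \<Rightarrow> (real \<Rightarrow> complex) set \<Rightarrow>
   ((real \<Rightarrow> complex) \<Rightarrow> real \<Rightarrow> complex) \<Rightarrow> bool" where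
  "bounded_on_weighted \<rho> w D T \<longleftrightarrow>
     weighted_space \<rho> w \<subseteq> D \<and>
     (\<exists>C::real. \<forall>f \<in> weighted_space \<rho> w. T f \<in> weighted_space \<rho> w \<and>
        weighted_norm \<rho> w (T f) \<le> ennreal C * weighted_norm \<rho> w f)"

definition P_weights :: "fnorm \<Rightarrow> (real \<Rightarrow> real) set" where
  "P_weights \<rho> = {w. weight w \<and> bounded_on_weighted \<rho> w dom_P hardy_P}"

definition Q_weights :: "fnorm \<Rightarrow> (real \<Rightarrow> real) set" where
  "Q_weights \<rho> = {w. weight w \<and> bounded_on_weighted \<rho> w dom_Q hardy_Q}"

definition C_weights :: "fnorm \<Rightarrow> (real \<Rightarrow> real) set" where
  "C_weights \<rho> = P_weights \<rho> \<inter> Q_weights \<rho>"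

definition Mq_lower :: "real \<Rightarrow> (real \<Rightarrow> real) set" where
  "Mq_lower q = P_weights (Lp_fnorm q)"

definition Mq_upper :: "real \<Rightarrow> (real \<Rightarrow> real) set" where
  "Mq_upper q = Q_weights (Lp_fnorm q)"

end

theory Submission
  imports Defs
begin

text \<open>
  Everything is done on the level of distribution functions. If \<open>T\<close> is \<open>P\<close> or \<open>Q\<close> and is bounded
  on \<open>L\<^sup>q(w)\<close>, the weak type estimate applied to the part of \<open>F\<close> above the level \<open>r\<close> bounds
  \<open>w{T(F 1\<^bsub>F>r\<^esub>) > r}\<close> by \<open>\<Sum>\<^sub>k K R\<^bsup>qk\<^esup> w{F > R\<^sup>k r}\<close>. The part of \<open>F\<close> below \<open>r\<close> is harmless for \<open>P\<close>, which
  does not increase the sup norm. For \<open>Q\<close> it is cut into dyadic layers: since \<open>Q\<close> of a nonnegative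
  function is nonincreasing, iterating the weak type estimate on level sets gives
  \<open>w{Q 1\<^sub>E > n\<sigma>} \<le> \<delta>\<^sup>n w(E)\<close> with \<open>\<delta>\<close> as small as desired.

  An estimate \<open>m(r) \<le> \<Sum>\<^sub>k b\<^sub>k \<mu>(a\<^sub>k r)\<close> between distribution functions gives
  \<open>m\<^sup>*(t) \<le> \<Sum>\<^sub>k a\<^sub>k\<^sup>-\<^sup>1 \<mu>\<^sup>*(\<theta>\<^sub>k t / b\<^sub>k)\<close> whenever \<open>\<Sum>\<^sub>k \<theta>\<^sub>k \<le> 1\<close>, hence a norm inequality with constant
  \<open>\<Sum>\<^sub>k a\<^sub>k\<^sup>-\<^sup>1 h(b\<^sub>k / \<theta>\<^sub>k)\<close>, where \<open>h\<close> is the dilation norm. These series converge because \<open>q\<close> is below the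
  lower Boyd index (large dilations) and because the upper Boyd index is finite (small dilations).
\<close>

section \<open>Decreasing rearrangements of distribution functions\<close>

text \<open>The hypothesis supplies one endpoint only, and \<open>Q\<close> has no bound at
  infinity: the constant function 1 is not even in its domain. Interpolating between two endpoint
  spaces is therefore impossible for \<open>Q\<close>; the exponential decay of level sets replaces
  the missing endpoint. The series that dominate a distribution function are not themselves given as
  distribution functions, hence the rearrangement of an arbitrary \<open>m\<close>. The order of
  choices matters. The growth exponent of the dilation norm at infinity fixes the ratio R, the weak
  type constant K depends on R, and so the series must converge for every K at once. For
  \<open>Q\<close> the decay exponent of the dilation norm at 0 fixes \<delta>, and only then is the
  step height \<sigma> chosen. That E_w lies in the domain of the operator is a consequence of the
  estimates and not a preliminary: they are proved for extended-valued counterparts, and finiteness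
  of these outside a set of weight 0 yields the integrability.\<close>

definition decr_rearr :: "(real \<Rightarrow> ennreal) \<Rightarrow> real \<Rightarrow> ennreal" where
  "decr_rearr m t = (INF r \<in> {r. 0 < r \<and> m r \<le> ennreal t}. ennreal r)"

lemma weighted_rearr_eq: "weighted_rearr w f = decr_rearr (weighted_distr w f)"
  by (simp add: fun_eq_iff weighted_rearr_def decr_rearr_def)

lemma decr_rearr_antimono: "s \<le> t \<Longrightarrow> decr_rearr m t \<le> decr_rearr m s"
  unfolding decr_rearr_def
  by (intro INF_superset_mono) (auto intro: order_trans[OF _ ennreal_leI])

lemma decr_rearr_mono:
  assumes "\<And>r. 0 < r \<Longrightarrow> m r \<le> m' r"
  shows "decr_rearr m t \<le> decr_rearr m' t"
  unfolding decr_rearr_def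
  by (intro INF_superset_mono) (auto intro: order_trans[OF assms])

lemma decr_rearr_le: "0 < r \<Longrightarrow> m r \<le> ennreal t \<Longrightarrow> decr_rearr m t \<le> ennreal r"
  unfolding decr_rearr_def by (intro INF_lower) auto

lemma decr_rearr_lessD:
  assumes "antimono m" "decr_rearr m t < ennreal r"
  shows "m r \<le> ennreal t"
proof -
  obtain r' where r': "0 < r'" "m r' \<le> ennreal t" "ennreal r' < ennreal r"
    using assms(2) unfolding decr_rearr_def INF_less_iff by blast
  then have "r' \<le> r"
    by (simp add: ennreal_less_iff)
  with r' show ?thesis
    using antimonoD[OF assms(1), of r' r] by (meson order_trans)
qed

lemma decr_rearr_ge:
  assumes "antimono m" "ennreal t < m r"
  shows "ennreal r \<le> decr_rearr m t"
  using decr_rearr_lessD[OF assms(1), of t r] assms(2) by (meson leD leI)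

text \<open>Level sets of nonincreasing functions are down-closed. This is the source of
  measurability for \<open>decr_rearr m\<close> and, later, for the level sets of
  \<open>hardy_Q_nn F\<close>.\<close>

lemma down_closed_borel:
  fixes S :: "real set"
  assumes "\<And>x y. x \<in> S \<Longrightarrow> y \<le> x \<Longrightarrow> y \<in> S"
  shows "S \<in> sets borel"
proof -
  have "is_interval S"
    using assms unfolding is_interval_1 by blast
  then show ?thesis
    by (rule real_interval_borel_measurable)
qed

lemma borel_measurable_decr_rearr [measurable]: "decr_rearr m \<in> borel_measurable borel"
  by (intro borel_measurableI_greater)
     (auto intro!: down_closed_borel intro: less_le_trans decr_rearr_antimono)

text \<open>Right continuity, in the form \<open>rc\<close>, makes \<open>m\<close> and its
  rearrangement generalized inverses of each other; in its absence only the one-sided estimates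
  above remain.\<close>

lemma decr_rearr_less_iff:
  assumes m: "antimono m" and rc: "\<And>r t. t < m r \<Longrightarrow> \<exists>r'>r. t < m r'" and "0 \<le> r"
  shows "ennreal r < decr_rearr m t \<longleftrightarrow> ennreal t < m r"
proof
  assume "ennreal t < m r"
  then obtain r' where "r < r'" "ennreal t < m r'"
    using rc by blast
  then show "ennreal r < decr_rearr m t"
    using decr_rearr_ge[OF m, of t r'] \<open>0 \<le> r\<close> by (meson ennreal_lessI le_less_trans less_le_trans)
next
  assume *: "ennreal r < decr_rearr m t"
  show "ennreal t < m r"
  proof (rule ccontr)
    assume "\<not> ennreal t < m r"
    then have "m r' \<le> ennreal t" if "r < r'" for r'
      using antimonoD[OF m, of r r'] that by auto
    then have "decr_rearr m t \<le> ennreal r'" if "r < r'" for r'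
      using that \<open>0 \<le> r\<close> by (intro decr_rearr_le) auto
    moreover obtain r' where "ennreal r < ennreal r'" "ennreal r' < decr_rearr m t"
      using dense[OF *] by (metis ennreal_cases order_less_imp_not_less top.not_eq_extremum)
    ultimately show False
      using \<open>0 \<le> r\<close> by (metis ennreal_less_iff leD)
  qed
qed


section \<open>Rearrangement invariant norms and dilations\<close>

definition distr_fun :: "(real \<Rightarrow> ennreal) \<Rightarrow> real \<Rightarrow> ennreal" where
  "distr_fun F r = emeasure half_line {x \<in> {0..}. ennreal r < F x}"

lemma equimeasurable_half_line:
  "equimeasurable half_line F G \<longleftrightarrow> (\<forall>r\<ge>0. distr_fun F r = distr_fun G r)"
  by (simp add: equimeasurable_def distr_fun_def)

lemma sets_half_line_level:
  assumes "F \<in> borel_measurable half_line"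
  shows "{x \<in> {0..}. (c::ennreal) < F x} \<in> sets half_line"
    and "{x \<in> {0..}. (c::ennreal) < F x} \<in> sets lebesgue"
proof -
  have "{x \<in> space half_line. c < F x} \<in> sets half_line"
    using assms by measurable
  then show *: "{x \<in> {0..}. c < F x} \<in> sets half_line"
    by simp
  then show "{x \<in> {0..}. c < F x} \<in> sets lebesgue"
    by (subst (asm) sets_restrict_space_iff) auto
qed

lemma distr_fun_mono:
  assumes "F \<in> borel_measurable half_line" "\<And>x. 0 \<le> x \<Longrightarrow> ennreal r < G x \<Longrightarrow> ennreal s < F x"
  shows "distr_fun G r \<le> distr_fun F s"
  unfolding distr_fun_def using assms by (intro emeasure_mono sets_half_line_level) auto

lemma distr_fun_antimono:
  assumes "F \<in> borel_measurable half_line"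
  shows "antimono (distr_fun F)"
  using assms by (intro antimonoI distr_fun_mono) (auto intro: le_less_trans[OF ennreal_leI])

text \<open>Continuity of the measure from below: the level sets at \<open>r + 1 / Suc n\<close>
  increase to the level set at \<open>r\<close>.\<close>

lemma distr_fun_right_continuous:
  assumes [measurable]: "F \<in> borel_measurable half_line" and "t < distr_fun F r"
  shows "\<exists>r'>r. t < distr_fun F r'"
proof -
  define A where "A n = {x \<in> {0..}. ennreal (r + 1 / Suc n) < F x}" for n :: nat
  have "incseq A"
  proof (rule monoI)
    fix m n :: nat assume "m \<le> n"
    then have "ennreal (r + 1 / Suc n) \<le> ennreal (r + 1 / Suc m)"
      by (intro ennreal_leI add_mono divide_left_mono) auto
    then show "A m \<subseteq> A n"
      unfolding A_def by auto
  qed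
  moreover have "range A \<subseteq> sets half_line"
    unfolding A_def using sets_half_line_level(1)[OF assms(1)] by auto
  moreover have "(\<Union>n. A n) = {x \<in> {0..}. ennreal r < F x}"
  proof (intro equalityI subsetI)
    fix x assume "x \<in> {x \<in> {0..}. ennreal r < F x}"
    then have x: "x \<in> {0..}" "ennreal r < F x" by auto
    have "(\<lambda>n. ennreal (r + 1 / Suc n)) \<longlonglongrightarrow> ennreal (r + 0)"
      by (intro tendsto_intros tendsto_ennrealI LIMSEQ_Suc lim_1_over_n)
    then have "eventually (\<lambda>n. ennreal (r + 1 / Suc n) < F x) sequentially"
      using x by (intro order_tendstoD) auto
    then obtain n where "ennreal (r + 1 / Suc n) < F x"
      by (auto simp: eventually_sequentially)
    then show "x \<in> (\<Union>n. A n)"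
      using x by (auto simp: A_def)
  next
    fix x assume "x \<in> (\<Union>n. A n)"
    then show "x \<in> {x \<in> {0..}. ennreal r < F x}"
      unfolding A_def by (auto elim!: le_less_trans[rotated] intro!: ennreal_leI)
  qed
  ultimately have "distr_fun F r = (SUP n. emeasure half_line (A n))"
    using SUP_emeasure_incseq by (metis distr_fun_def)
  then obtain n where "t < emeasure half_line (A n)"
    using assms(2) by (auto simp: less_SUP_iff)
  then show ?thesis
    unfolding A_def distr_fun_def by (intro exI[of _ "r + 1 / Suc n"]) auto
qed

lemma emeasure_half_line:
  "A \<in> sets lebesgue \<Longrightarrow> A \<subseteq> {0..} \<Longrightarrow> emeasure half_line A = emeasure lebesgue A"
  by (subst emeasure_restrict_space) auto

lemma emeasure_initial_segment:
  "emeasure half_line {t \<in> {0..}. ennreal t < x} = x"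
proof (cases x)
  case (real r)
  then have "{t \<in> {0..}. ennreal t < x} = {0..<r}"
    by (auto simp: ennreal_less_iff)
  then show ?thesis
    using real by (subst emeasure_half_line) auto
next
  case top
  then have "{t \<in> {0..}. ennreal t < x} = {0..}"
    by auto
  moreover have "emeasure half_line {0..} = \<infinity>"
  proof -
    have "ennreal (real n) \<le> emeasure half_line {0..}" for n
    proof -
      have "emeasure half_line {0..real n} \<le> emeasure half_line {0..}"
        by (intro emeasure_mono) (auto simp: sets_restrict_space)
      then show ?thesis by (subst (asm) emeasure_half_line) auto
    qed
    then have n: "ennreal (real n) \<le> emeasure half_line {0..}" for n .
    show ?thesis
    proof (cases "emeasure half_line {0..}")
      case (real c)
      obtain n where "c < real n"
        using reals_Archimedean2 by blast
      then show ?thesis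
        using n[of n] real by auto
    qed simp
  qed
  ultimately show ?thesis
    using top by simp
qed

text \<open>The level set of the rearrangement at \<open>r\<close> is an interval starting at 0
  whose length, possibly infinite, is \<open>distr_fun F r\<close>.\<close>

lemma distr_fun_decr_rearr:
  assumes F: "F \<in> borel_measurable half_line" and "0 \<le> r"
  shows "distr_fun (decr_rearr (distr_fun F)) r = distr_fun F r"
proof -
  have "{x \<in> {0..}. ennreal r < decr_rearr (distr_fun F) x} = {x \<in> {0..}. ennreal x < distr_fun F r}"
    using decr_rearr_less_iff[OF distr_fun_antimono[OF F] distr_fun_right_continuous[OF F] \<open>0 \<le> r\<close>]
    by auto
  then show ?thesis
    unfolding distr_fun_def[of "decr_rearr _"] by (simp only: emeasure_initial_segment)
qed

lemma borel_measurable_half_lineI: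
  "f \<in> borel_measurable borel \<Longrightarrow> f \<in> borel_measurable half_line"
  by (intro measurable_restrict_space1 measurable_completion) simp

lemma measurable_divide_half_line:
  fixes a :: real
  assumes "0 < a"
  shows "(\<lambda>s. s / a) \<in> half_line \<rightarrow>\<^sub>M half_line"
proof -
  have "(\<lambda>s. s / a) \<in> lebesgue \<rightarrow>\<^sub>M lebesgue"
  proof -
    have "(\<lambda>s. s / a) = (*\<^sub>R) (1 / a)"
      by auto
    then show ?thesis
      by (simp only: lebesgue_measurable_scaling)
  qed
  then show ?thesis
    using assms by (intro measurable_restrict_space3) auto
qed

lemma distr_fun_dilation:
  assumes F: "F \<in> borel_measurable half_line" and "0 < a"
  shows "distr_fun (\<lambda>s. F (s / a)) r = ennreal a * distr_fun F r"
proof -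
  let ?A = "{x \<in> {0..}. ennreal r < F x}"
  have eq: "{x \<in> {0..}. ennreal r < F (x / a)} = (\<lambda>x. a *\<^sub>R x + 0) ` ?A"
  proof (intro equalityI subsetI)
    fix x assume "x \<in> {x \<in> {0..}. ennreal r < F (x / a)}"
    then show "x \<in> (\<lambda>x. a *\<^sub>R x + 0) ` ?A"
      using \<open>0 < a\<close> by (intro image_eqI[where x = "x / a"]) auto
  qed (use \<open>0 < a\<close> in auto)
  have "(\<lambda>s. F (s / a)) \<in> borel_measurable half_line"
    using measurable_compose[OF measurable_divide_half_line[OF \<open>0 < a\<close>] F] .
  then have "distr_fun (\<lambda>s. F (s / a)) r = emeasure lebesgue ((\<lambda>x. a *\<^sub>R x + 0) ` ?A)"
    unfolding distr_fun_def eq[symmetric]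
    by (intro emeasure_half_line sets_half_line_level) auto
  also have "\<dots> = ennreal a * emeasure lebesgue ?A"
    using \<open>0 < a\<close> by (subst emeasure_lebesgue_affine) auto
  also have "emeasure lebesgue ?A = distr_fun F r"
    unfolding distr_fun_def using F
    by (intro emeasure_half_line[symmetric] sets_half_line_level) auto
  finally show ?thesis .
qed

text \<open>Serves to place a second copy of a function beside the first one in
  \<open>norm_dilation_2\<close>.\<close>

lemma distr_fun_translate:
  assumes F: "F \<in> borel_measurable half_line" and "0 \<le> a"
  shows "(\<lambda>s. if a \<le> s then F (s - a) else 0) \<in> borel_measurable half_line" (is ?th1)
    and "distr_fun (\<lambda>s. if a \<le> s then F (s - a) else 0) r = distr_fun F r" (is ?th2)
proof -
  let ?A = "{x \<in> {0..}. ennreal r < F x}"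
  have eq: "{x \<in> {0..}. c < (if a \<le> x then F (x - a) else 0)} = (\<lambda>x. 1 *\<^sub>R x + a) ` {x \<in> {0..}. c < F x}" for c
    using \<open>0 \<le> a\<close> by (auto simp: image_iff intro!: exI[of _ "_ - a"] split: if_splits)
  have "(\<lambda>x. 1 *\<^sub>R x + a) ` {x \<in> {0..}. c < F x} \<in> sets lebesgue" for c
    using lebesgue_sets_translation[OF sets_half_line_level(2)[OF F], of a c] by (simp add: add.commute)
  then show ?th1
    unfolding eq[symmetric]
    by (intro borel_measurableI_greater) (auto simp: sets_restrict_space_iff)
  then have "distr_fun (\<lambda>s. if a \<le> s then F (s - a) else 0) r = emeasure lebesgue ((\<lambda>x. 1 *\<^sub>R x + a) ` ?A)"
    unfolding distr_fun_def eq[symmetric]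
    by (intro emeasure_half_line sets_half_line_level) auto
  also have "\<dots> = emeasure lebesgue ?A"
    by (subst emeasure_lebesgue_affine) auto
  also have "emeasure lebesgue ?A = distr_fun F r"
    unfolding distr_fun_def using F
    by (intro emeasure_half_line[symmetric] sets_half_line_level) auto
  finally show ?th2 .
qed

locale half_line_ri_norm = ri_banach_function_norm half_line \<rho>
  for \<rho> :: "(real \<Rightarrow> ennreal) \<Rightarrow> ennreal"
begin

section \<open>Comparison of norms through distribution functions\<close>

lemma norm_cong_AE:
  assumes "F \<in> borel_measurable half_line" "G \<in> borel_measurable half_line"
    and "AE x in half_line. F x = G x"
  shows "\<rho> F = \<rho> G"
  using assms by (intro antisym lattice) auto

text \<open>The axiom \<open>rearrangement_invariant\<close> speaks only of functions finite almost
  everywhere. Truncation gives access to it, and the Fatou property removes the truncation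
  again.\<close>

lemma norm_truncate_tendsto:
  assumes [measurable]: "F \<in> borel_measurable half_line"
  shows "(\<lambda>n. \<rho> (\<lambda>x. min (F x) (of_nat n))) \<longlonglongrightarrow> \<rho> F"
proof (rule fatou)
  have "incseq (\<lambda>n. min (F x) (of_nat n))" for x
    by (auto intro!: incseq_SucI simp: min.coboundedI2)
  moreover have "(\<lambda>n. min (F x) (of_nat n)) \<longlonglongrightarrow> F x" for x
    using tendsto_min[OF tendsto_const[of "F x"] of_nat_tendsto_top_ennreal] by (simp add: min_def)
  ultimately show "AE x in half_line. incseq (\<lambda>n. min (F x) (of_nat n)) \<and> (\<lambda>n. min (F x) (of_nat n)) \<longlonglongrightarrow> F x"
    by simp
qed measurable

lemma norm_decr_rearr:
  assumes F: "F \<in> borel_measurable half_line" and bound: "\<And>x. F x \<le> of_nat n"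
  shows "\<rho> (decr_rearr (distr_fun F)) = \<rho> F"
proof (rule rearrangement_invariant)
  show "AE x in half_line. F x < \<infinity>"
    by (intro AE_I2 le_less_trans[OF bound]) (simp add: ennreal_of_nat_eq_real_of_nat)
  \<comment> \<open>The level is \<open>Suc n\<close> because only positive levels enter
    \<open>decr_rearr\<close>, and \<open>n\<close> may be 0.\<close>
  have "distr_fun F (Suc n) = 0"
  proof -
    have "{x \<in> {0..}. ennreal (real (Suc n)) < F x} = {}"
      using bound by (auto simp: not_less ennreal_of_nat_eq_real_of_nat
          intro!: order_trans[OF bound] ennreal_leI)
    then show ?thesis
      unfolding distr_fun_def by (simp only: emeasure_empty)
  qed
  then have *: "decr_rearr (distr_fun F) t \<le> ennreal (Suc n)" for t
    by (intro decr_rearr_le) auto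
  show "AE x in half_line. decr_rearr (distr_fun F) x < \<infinity>"
    by (intro AE_I2 le_less_trans[OF *]) simp
  show "equimeasurable half_line (decr_rearr (distr_fun F)) F"
    unfolding equimeasurable_half_line using distr_fun_decr_rearr[OF F] by simp
qed (use F in \<open>auto intro: borel_measurable_half_lineI\<close>)

text \<open>After truncation both functions may be replaced by their rearrangements, and these are
  ordered pointwise because the distribution functions are. Every later norm estimate for dilations
  rests on this.\<close>

lemma norm_mono_distr:
  assumes F[measurable]: "F \<in> borel_measurable half_line" and G[measurable]: "G \<in> borel_measurable half_line"
    and le: "\<And>r. 0 \<le> r \<Longrightarrow> distr_fun G r \<le> distr_fun F r"
  shows "\<rho> G \<le> \<rho> F"
proof -
  have "\<rho> (\<lambda>x. min (G x) (of_nat n)) \<le> \<rho> (\<lambda>x. min (F x) (of_nat n))" for n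
  proof -
    let ?G = "\<lambda>x. min (G x) (of_nat n)" and ?F = "\<lambda>x. min (F x) (of_nat n)"
    have trunc: "distr_fun (\<lambda>x. min (H x) (of_nat n)) r = (if r < real n then distr_fun H r else 0)"
      if "0 \<le> r" for H and r :: real
    proof -
      have "{x \<in> {0..}. ennreal r < min (H x) (of_nat n)} = (if r < real n then {x \<in> {0..}. ennreal r < H x} else {})"
        using that by (auto simp: ennreal_of_nat_eq_real_of_nat ennreal_less_iff)
      then show ?thesis
        unfolding distr_fun_def by simp
    qed
    have "\<rho> ?G = \<rho> (decr_rearr (distr_fun ?G))"
      by (intro norm_decr_rearr[symmetric, where n = n]) auto
    also have "\<dots> \<le> \<rho> (decr_rearr (distr_fun ?F))"
      using le by (intro lattice AE_I2 decr_rearr_mono borel_measurable_half_lineI) (auto simp: trunc)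
    also have "\<dots> = \<rho> ?F"
      by (intro norm_decr_rearr[where n = n]) auto
    finally show ?thesis .
  qed
  then show ?thesis
    using LIMSEQ_le[OF norm_truncate_tendsto[OF G] norm_truncate_tendsto[OF F]] by blast
qed

section \<open>Dilations and their operator norm\<close>

lemma measurable_dilation:
  assumes "F \<in> borel_measurable half_line" "0 < a"
  shows "(\<lambda>s. F (s / a)) \<in> borel_measurable half_line"
  using measurable_compose[OF measurable_divide_half_line[OF assms(2)] assms(1)] .

lemma norm_dilation_le_1:
  assumes F: "F \<in> borel_measurable half_line" and "0 < a" "a \<le> 1"
  shows "\<rho> (\<lambda>s. F (s / a)) \<le> \<rho> F"
proof (rule norm_mono_distr)
  show "distr_fun (\<lambda>s. F (s / a)) r \<le> distr_fun F r" for r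
    using assms mult_right_mono[of "ennreal a" 1 "distr_fun F r"] by (simp add: distr_fun_dilation)
qed (use assms measurable_dilation in auto)

text \<open>Stretching by 2 doubles the distribution function, and so does adding a disjoint copy;
  the triangle inequality bounds the latter. A disjoint copy needs room, so \<open>F\<close> is
  first cut off at \<open>N\<close> and the copy is shifted by \<open>N\<close>.\<close>

lemma norm_dilation_2:
  assumes F[measurable]: "F \<in> borel_measurable half_line"
  shows "\<rho> (\<lambda>s. F (s / 2)) \<le> 2 * \<rho> F"
proof -
  define FN where "FN N x = (if x < real N then F x else 0)" for N :: nat and x
  have FN[measurable]: "FN N \<in> borel_measurable half_line" for N
    unfolding FN_def
  proof (rule measurable_If)
    have "(\<lambda>x. x :: real) \<in> borel_measurable half_line"
      by (intro borel_measurable_half_lineI) simp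
    then show "{x \<in> space half_line. x < real N} \<in> sets half_line"
      by measurable
  qed auto
  have FN_le: "\<rho> (FN N) \<le> \<rho> F" for N
    by (intro lattice) (auto simp: FN_def)
  have "\<rho> (\<lambda>s. FN N (s / 2)) \<le> 2 * \<rho> F" for N
  proof -
    define G where "G s = (if real N \<le> s then FN N (s - real N) else 0)" for s
    have G[measurable]: "G \<in> borel_measurable half_line" and dG: "distr_fun G r = distr_fun (FN N) r" for r
      using distr_fun_translate[OF FN[of N], of "real N"] by (auto simp: G_def[abs_def])
    have "distr_fun (\<lambda>s. FN N s + G s) r = distr_fun (\<lambda>s. FN N (s / 2)) r" for r :: real
    proof -
      have "distr_fun (\<lambda>s. FN N s + G s) r =
        emeasure half_line ({x \<in> {0..}. ennreal r < FN N x} \<union> {x \<in> {0..}. ennreal r < G x})"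
        unfolding distr_fun_def by (intro arg_cong[where f = "emeasure half_line"])
          (auto simp: FN_def G_def split: if_splits)
      also have "\<dots> = distr_fun (FN N) r + distr_fun G r"
        unfolding distr_fun_def
        by (intro plus_emeasure[symmetric] sets_half_line_level FN G) (auto simp: FN_def G_def split: if_splits)
      also have "\<dots> = 2 * distr_fun (FN N) r"
        by (simp add: dG mult_2)
      also have "\<dots> = distr_fun (\<lambda>s. FN N (s / 2)) r"
        by (simp add: distr_fun_dilation)
      finally show ?thesis .
    qed
    then have "\<rho> (\<lambda>s. FN N (s / 2)) \<le> \<rho> (\<lambda>s. FN N s + G s)"
      by (intro norm_mono_distr measurable_dilation) auto
    also have "\<dots> \<le> \<rho> (FN N) + \<rho> G"
      by (intro triangle) auto
    also have "\<rho> G \<le> \<rho> (FN N)"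
      by (intro norm_mono_distr) (auto simp: dG)
    also have "\<rho> (FN N) + \<rho> (FN N) \<le> 2 * \<rho> F"
      using FN_le[of N] by (simp add: mult_2 add_mono)
    finally show ?thesis by (simp add: add_left_mono)
  qed
  moreover have "(\<lambda>N. \<rho> (\<lambda>s. FN N (s / 2))) \<longlonglongrightarrow> \<rho> (\<lambda>s. F (s / 2))"
  proof (rule fatou)
    have "incseq (\<lambda>N. FN N (x / 2))" for x
      by (auto intro!: incseq_SucI simp: FN_def)
    moreover have "(\<lambda>N. FN N (x / 2)) \<longlonglongrightarrow> F (x / 2)" for x
    proof (rule tendsto_eventually)
      obtain N where "x / 2 < real N" using reals_Archimedean2 by blast
      then show "\<forall>\<^sub>F N in sequentially. FN N (x / 2) = F (x / 2)"
        unfolding eventually_sequentially by (intro exI[of _ N]) (auto simp: FN_def)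
    qed
    ultimately show "AE x in half_line. incseq (\<lambda>n. FN n (x / 2)) \<and> (\<lambda>n. FN n (x / 2)) \<longlonglongrightarrow> F (x / 2)"
      by simp
  qed (auto intro: measurable_dilation)
  ultimately show ?thesis
    by (intro LIMSEQ_le_const2) auto
qed

lemma norm_dilation_power_2:
  assumes F: "F \<in> borel_measurable half_line"
  shows "\<rho> (\<lambda>s. F (s / 2 ^ n)) \<le> 2 ^ n * \<rho> F"
proof (induction n)
  case (Suc n)
  have "\<rho> (\<lambda>s. F (s / 2 ^ Suc n)) \<le> 2 * \<rho> (\<lambda>s. F (s / 2 ^ n))"
    using norm_dilation_2[OF measurable_dilation[OF F, of "2 ^ n"]] by (simp add: field_simps)
  also have "\<dots> \<le> 2 * (2 ^ n * \<rho> F)"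
    by (intro mult_left_mono Suc) auto
  finally show ?case by (simp add: mult.assoc)
qed simp

text \<open>Finiteness of the operator norm justifies the \<open>enn2real\<close> in
  \<open>dilation_norm\<close>, which would send an infinite supremum to 0.\<close>

lemma norm_dilation_bounded:
  assumes "0 < a"
  shows "\<exists>c::real. \<forall>F \<in> borel_measurable half_line. \<rho> (\<lambda>s. F (s / a)) \<le> ennreal c * \<rho> F"
proof -
  obtain n where n: "a < 2 ^ n" using real_arch_pow[of 2 a] by auto
  have "\<rho> (\<lambda>s. F (s / a)) \<le> ennreal (2 ^ n) * \<rho> F" if F: "F \<in> borel_measurable half_line" for F
  proof -
    have "\<rho> (\<lambda>s. F (s / a)) = \<rho> (\<lambda>s. (\<lambda>s. F (s / 2 ^ n)) (s / (a / 2 ^ n)))"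
      by simp
    also have "\<dots> \<le> \<rho> (\<lambda>s. F (s / 2 ^ n))"
      using n \<open>0 < a\<close> by (intro norm_dilation_le_1 measurable_dilation F) auto
    also have "\<dots> \<le> 2 ^ n * \<rho> F"
      by (rule norm_dilation_power_2[OF F])
    finally show ?thesis by (metis ennreal_numeral ennreal_power zero_le_numeral)
  qed
  then show ?thesis by blast
qed

text \<open>By \<open>local_L1\<close> the integral over each \<open>{0..n}\<close> is finite, so
  the infinite values occupy a null set in each of these intervals.\<close>

lemma finite_AE_of_norm_finite:
  assumes F[measurable]: "F \<in> borel_measurable half_line" and "\<rho> F < \<infinity>"
  shows "AE x in half_line. F x < \<infinity>"
proof -
  have "AE x in half_line. x \<in> {0..real n} \<longrightarrow> F x < \<infinity>" for n
  proof -
    have A: "{0..real n} \<in> sets half_line"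
      by (simp add: sets_restrict_space_iff)
    moreover have "emeasure half_line {0..real n} < \<infinity>"
      by (subst emeasure_half_line) auto
    ultimately obtain C :: real where "(\<integral>\<^sup>+x\<in>{0..real n}. F x \<partial>half_line) \<le> ennreal C * \<rho> F"
      using local_L1 F by blast
    then have "(\<integral>\<^sup>+x\<in>{0..real n}. F x \<partial>half_line) \<noteq> \<infinity>"
      using \<open>\<rho> F < \<infinity>\<close> by (auto simp: ennreal_mult_eq_top_iff top_unique)
    then have "AE x in half_line. F x * indicator {0..real n} x \<noteq> \<infinity>"
      using A by (intro nn_integral_PInf_AE) auto
    then show ?thesis
      by eventually_elim (auto simp: less_top)
  qed
  then have "AE x in half_line. \<forall>n. x \<in> {0..real n} \<longrightarrow> F x < \<infinity>"
    unfolding AE_all_countable by blast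
  moreover have "AE x in half_line. x \<in> {0..}"
    by (rule AE_I2) simp
  ultimately show ?thesis
    by eventually_elim (metis atLeastAtMost_iff atLeast_iff real_arch_simple)
qed

lemma dilation_norm_SUP:
  assumes "0 < a"
  shows "ennreal (dilation_norm \<rho> a) =
    (SUP f \<in> {f \<in> fun_space \<rho>. space_norm \<rho> f \<le> 1}. space_norm \<rho> (dilation a f))"
proof -
  obtain c :: real where c: "\<And>F. F \<in> borel_measurable half_line \<Longrightarrow> \<rho> (\<lambda>s. F (s / a)) \<le> ennreal c * \<rho> F"
    using norm_dilation_bounded[OF assms] by blast
  have "(SUP f \<in> {f \<in> fun_space \<rho>. space_norm \<rho> f \<le> 1}. space_norm \<rho> (dilation a f)) \<le> ennreal c"
  proof (rule SUP_least)
    fix f assume "f \<in> {f \<in> fun_space \<rho>. space_norm \<rho> f \<le> 1}"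
    then have f: "f \<in> borel_measurable half_line" "space_norm \<rho> f \<le> 1"
      by (auto simp: fun_space_def)
    then have "space_norm \<rho> (dilation a f) \<le> ennreal c * space_norm \<rho> f"
      unfolding space_norm_def dilation_def by (intro c[of "\<lambda>t. ennreal (norm (f t))"]) auto
    also have "\<dots> \<le> ennreal c"
      using mult_left_mono[OF f(2), of "ennreal c"] by simp
    finally show "space_norm \<rho> (dilation a f) \<le> ennreal c" .
  qed
  then show ?thesis
    unfolding dilation_norm_def by (intro ennreal_enn2real) (auto intro: le_less_trans)
qed

text \<open>The supremum in \<open>dilation_norm\<close> runs over complex functions in the unit
  ball, whereas \<open>F\<close> is extended-valued. Dividing by the norm and applying
  \<open>enn2real\<close> changes \<open>F\<close> on a null set only, by
  \<open>finite_AE_of_norm_finite\<close>; the same is needed for the dilated function.\<close>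

lemma norm_dilation_le:
  assumes F[measurable]: "F \<in> borel_measurable half_line" and "0 < a" and fin: "\<rho> F < \<infinity>"
  shows "\<rho> (\<lambda>s. F (s / a)) \<le> ennreal (dilation_norm \<rho> a) * \<rho> F"
proof -
  note D[measurable] = measurable_dilation[OF F \<open>0 < a\<close>]
  obtain c :: real where c: "\<rho> (\<lambda>s. F (s / a)) \<le> ennreal c * \<rho> F"
    using norm_dilation_bounded[OF \<open>0 < a\<close>] F by blast
  then have D_fin: "\<rho> (\<lambda>s. F (s / a)) < \<infinity>"
    using fin by (auto simp: ennreal_mult_less_top intro: le_less_trans)
  show ?thesis
  proof (cases "\<rho> F = 0")
    case True
    then show ?thesis using c by simp
  next
    case False
    then obtain r where r: "\<rho> F = ennreal r" "0 < r"
      using fin by (cases "\<rho> F") auto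
    define f where "f s = complex_of_real (enn2real (F s) / r)" for s
    have norm_f: "ennreal (norm (f s)) = ennreal (1 / r) * F s" if "F s < \<infinity>" for s
      using that r(2) unfolding f_def
      by (cases "F s") (auto simp: norm_divide ennreal_mult[symmetric])
    have f[measurable]: "f \<in> borel_measurable half_line"
      unfolding f_def by measurable
    note Df[measurable] = measurable_compose[OF measurable_divide_half_line[OF \<open>0 < a\<close>] f]
    have "space_norm \<rho> f = \<rho> (\<lambda>s. ennreal (1 / r) * F s)"
      unfolding space_norm_def using finite_AE_of_norm_finite[OF F fin]
      by (intro norm_cong_AE) (auto simp: norm_f)
    also have "\<dots> = ennreal (1 / r) * \<rho> F"
      using r by (intro scale) auto
    also have "\<dots> = 1"
      using r by (simp add: ennreal_mult[symmetric])
    finally have "f \<in> {f \<in> fun_space \<rho>. space_norm \<rho> f \<le> 1}"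
      by (simp add: fun_space_def)
    then have "space_norm \<rho> (dilation a f) \<le> ennreal (dilation_norm \<rho> a)"
      unfolding dilation_norm_SUP[OF \<open>0 < a\<close>] by (rule SUP_upper)
    moreover have "space_norm \<rho> (dilation a f) = \<rho> (\<lambda>s. ennreal (1 / r) * F (s / a))"
      unfolding space_norm_def dilation_def using finite_AE_of_norm_finite[OF D D_fin]
      by (intro norm_cong_AE) (auto simp: norm_f)
    moreover have "\<dots> = ennreal (1 / r) * \<rho> (\<lambda>s. F (s / a))"
      using r by (intro scale) auto
    ultimately have "ennreal r * (ennreal (1 / r) * \<rho> (\<lambda>s. F (s / a))) \<le> ennreal r * ennreal (dilation_norm \<rho> a)"
      by (intro mult_left_mono) auto
    moreover have "ennreal r * (ennreal (1 / r) * \<rho> (\<lambda>s. F (s / a))) = \<rho> (\<lambda>s. F (s / a))"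
      using r(2) by (simp add: mult.assoc[symmetric] ennreal_mult[symmetric])
    ultimately show ?thesis
      by (simp add: r mult.commute)
  qed
qed

lemma dilation_norm_le_1: "0 < a \<Longrightarrow> a \<le> 1 \<Longrightarrow> dilation_norm \<rho> a \<le> 1"
proof -
  assume a: "0 < a" "a \<le> 1"
  have "ennreal (dilation_norm \<rho> a) \<le> 1"
    unfolding dilation_norm_SUP[OF a(1)]
  proof (rule SUP_least)
    fix f assume "f \<in> {f \<in> fun_space \<rho>. space_norm \<rho> f \<le> 1}"
    then have f: "f \<in> borel_measurable half_line" "space_norm \<rho> f \<le> 1"
      by (auto simp: fun_space_def)
    then have "space_norm \<rho> (dilation a f) \<le> space_norm \<rho> f"
      unfolding space_norm_def dilation_def using a
      by (intro norm_dilation_le_1[of "\<lambda>t. ennreal (norm (f t))"]) auto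
    then show "space_norm \<rho> (dilation a f) \<le> 1"
      using f(2) by simp
  qed
  then show ?thesis by simp
qed

lemma norm_unit_interval: "0 < \<rho> (indicator {0..1})" "\<rho> (indicator {0..1}) < \<infinity>"
proof -
  have A: "{0..1::real} \<in> sets half_line"
    by (simp add: sets_restrict_space_iff)
  have m: "emeasure half_line {0..1} = 1"
    by (subst emeasure_half_line) auto
  show "\<rho> (indicator {0..1}) < \<infinity>"
    by (rule finite_indicator[OF A]) (simp add: m)
  have "\<not> (AE x in half_line. indicator {0..1} x = (0::ennreal))"
  proof
    assume "AE x in half_line. indicator {0..1} x = (0::ennreal)"
    then have "(\<integral>\<^sup>+x. indicator {0..1} x \<partial>half_line) = (\<integral>\<^sup>+x. 0 \<partial>half_line)"
      by (intro nn_integral_cong_AE) auto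
    then show False
      using A m by simp
  qed
  then show "0 < \<rho> (indicator {0..1})"
    using eq_zero_iff[of "indicator {0..1}"] A by (auto simp: zero_less_iff_neq_zero)
qed

text \<open>The indicator of \<open>{0..1}\<close> is the test function: stretching it makes it
  larger.\<close>

lemma dilation_norm_ge_1:
  assumes "1 \<le> a"
  shows "1 \<le> dilation_norm \<rho> a"
proof -
  have A: "{0..1::real} \<in> sets half_line"
    by (simp add: sets_restrict_space_iff)
  then have [measurable]: "(indicator {0..1} :: real \<Rightarrow> ennreal) \<in> borel_measurable half_line"
    by auto
  obtain e where e: "\<rho> (indicator {0..1}) = ennreal e" "0 < e"
    using norm_unit_interval by (cases "\<rho> (indicator {0..1})") auto
  have "\<rho> (indicator {0..1}) \<le> \<rho> (\<lambda>s. indicator {0..1} (s / a))"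
    using assms by (intro lattice measurable_dilation AE_I2)
      (auto simp: divide_simps split: split_indicator)
  also have "\<dots> \<le> ennreal (dilation_norm \<rho> a) * \<rho> (indicator {0..1})"
    using assms norm_unit_interval by (intro norm_dilation_le) auto
  finally have "ennreal e \<le> ennreal (dilation_norm \<rho> a * e)"
    using e by (simp add: ennreal_mult'')
  then show ?thesis
    using e(2) by (auto simp: ennreal_le_iff2 mult_le_cancel_right1)
qed

lemma dilation_norm_nonneg: "0 \<le> dilation_norm \<rho> a"
  by (simp add: dilation_norm_def)

lemma dilation_norm_mult:
  assumes "0 < a" "0 < b"
  shows "dilation_norm \<rho> (a * b) \<le> dilation_norm \<rho> a * dilation_norm \<rho> b"
proof -
  have "ennreal (dilation_norm \<rho> (a * b)) \<le> ennreal (dilation_norm \<rho> a * dilation_norm \<rho> b)"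
    unfolding dilation_norm_SUP[OF mult_pos_pos[OF assms]]
  proof (rule SUP_least)
    fix f assume f: "f \<in> {f \<in> fun_space \<rho>. space_norm \<rho> f \<le> 1}"
    define F where "F = (\<lambda>t. ennreal (norm (f t)))"
    have F[measurable]: "F \<in> borel_measurable half_line" and "\<rho> F \<le> 1"
      using f by (auto simp: fun_space_def space_norm_def F_def)
    then have fin: "\<rho> F < \<infinity>" by (auto intro: le_less_trans)
    note b = norm_dilation_le[OF F \<open>0 < b\<close> fin]
    have "\<rho> (\<lambda>s. F (s / (a * b))) = \<rho> (\<lambda>s. (\<lambda>s. F (s / b)) (s / a))"
      by (simp add: mult.commute)
    also have "\<dots> \<le> ennreal (dilation_norm \<rho> a) * \<rho> (\<lambda>s. F (s / b))"
      using fin by (intro norm_dilation_le measurable_dilation F assms le_less_trans[OF b])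
        (simp add: ennreal_mult_less_top)
    also have "\<dots> \<le> ennreal (dilation_norm \<rho> a) * (ennreal (dilation_norm \<rho> b) * 1)"
      using \<open>\<rho> F \<le> 1\<close> by (intro mult_left_mono order_trans[OF b]) auto
    finally show "space_norm \<rho> (dilation (a * b) f) \<le> ennreal (dilation_norm \<rho> a * dilation_norm \<rho> b)"
      by (simp add: space_norm_def dilation_def F_def ennreal_mult dilation_norm_nonneg)
  qed
  then show ?thesis
    by (simp add: dilation_norm_nonneg)
qed

lemma dilation_norm_pos:
  assumes "0 < a"
  shows "0 < dilation_norm \<rho> a"
proof -
  have "1 \<le> dilation_norm \<rho> a * dilation_norm \<rho> (1 / a)"
    using dilation_norm_mult[of a "1 / a"] dilation_norm_ge_1[of 1] assms by simp
  then show ?thesis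
    using dilation_norm_nonneg[of a] by (cases "dilation_norm \<rho> a = 0") auto
qed

text \<open>Dilation by \<open>a\<close> is dilation by \<open>b\<close> composed with the
  contractive dilation by \<open>a / b\<close>.\<close>

lemma dilation_norm_mono:
  assumes "0 < a" "a \<le> b"
  shows "dilation_norm \<rho> a \<le> dilation_norm \<rho> b"
proof -
  have "dilation_norm \<rho> a \<le> dilation_norm \<rho> b * dilation_norm \<rho> (a / b)"
    using dilation_norm_mult[of b "a / b"] assms by simp
  also have "\<dots> \<le> dilation_norm \<rho> b"
    using assms dilation_norm_le_1[of "a / b"] dilation_norm_nonneg[of b] by (intro mult_left_le) auto
  finally show ?thesis .
qed

lemma dilation_norm_power:
  assumes "0 < a"
  shows "dilation_norm \<rho> (a ^ n) \<le> dilation_norm \<rho> a ^ n"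
proof (induction n)
  case 0
  show ?case using dilation_norm_le_1[of 1] by simp
next
  case (Suc n)
  have "dilation_norm \<rho> (a ^ Suc n) \<le> dilation_norm \<rho> a * dilation_norm \<rho> (a ^ n)"
    using dilation_norm_mult[of a "a ^ n"] assms by simp
  also have "\<dots> \<le> dilation_norm \<rho> a * dilation_norm \<rho> a ^ n"
    by (intro mult_left_mono Suc dilation_norm_nonneg)
  finally show ?case by simp
qed

section \<open>Power bounds for the dilation norm and the Boyd indices\<close>

lemma powr_exponent_swap: "0 < x \<Longrightarrow> 0 < t \<Longrightarrow> x powr (ln t / y) = t powr (ln x / (y::real))"
  by (simp add: powr_def mult.commute)

text \<open>Fekete's argument: \<open>t\<close> is at most \<open>a ^ Suc n\<close> with
  \<open>n\<close> the integer part of \<open>ln t / ln a\<close>, and submultiplicativity leaves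
  one surplus factor \<open>dilation_norm \<rho> a\<close>.\<close>

lemma dilation_norm_le_powr_ge_1:
  assumes "1 < a" "1 \<le> t"
  shows "dilation_norm \<rho> t \<le> dilation_norm \<rho> a * t powr (ln (dilation_norm \<rho> a) / ln a)"
proof -
  define n where "n = nat \<lfloor>ln t / ln a\<rfloor>"
  have n: "real n \<le> ln t / ln a" "ln t / ln a \<le> real (Suc n)"
    using assms by (auto simp: n_def) linarith+
  have "t \<le> a ^ Suc n"
  proof -
    have "ln t \<le> ln (a ^ Suc n)"
      using n(2) assms by (simp add: divide_simps ln_realpow del: power_Suc)
    then show ?thesis
      using assms by (subst (asm) ln_le_cancel_iff) auto
  qed
  then have "dilation_norm \<rho> t \<le> dilation_norm \<rho> (a ^ Suc n)"
    using assms by (intro dilation_norm_mono) auto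
  also have "\<dots> \<le> dilation_norm \<rho> a * dilation_norm \<rho> a ^ n"
    using dilation_norm_power[of a "Suc n"] assms by simp
  also have "dilation_norm \<rho> a ^ n = dilation_norm \<rho> a powr real n"
    using assms by (simp add: powr_realpow dilation_norm_pos)
  also have "\<dots> \<le> dilation_norm \<rho> a powr (ln t / ln a)"
    using assms n by (intro powr_mono dilation_norm_ge_1) auto
  also have "\<dots> = t powr (ln (dilation_norm \<rho> a) / ln a)"
    using assms by (intro powr_exponent_swap dilation_norm_pos) auto
  finally show ?thesis
    using dilation_norm_nonneg by (simp add: mult_left_mono)
qed

text \<open>Now the norm at \<open>a\<close> is at most 1, so rounding the exponent down costs the
  reciprocal of that norm.\<close>

lemma dilation_norm_le_powr_le_1:
  assumes "0 < a" "a < 1" "0 < t" "t \<le> 1"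
  shows "dilation_norm \<rho> t \<le> 1 / dilation_norm \<rho> a * t powr (ln (dilation_norm \<rho> a) / ln a)"
proof -
  define n where "n = nat \<lfloor>ln t / ln a\<rfloor>"
  have "0 \<le> ln t / ln a"
    using assms by (simp add: zero_le_divide_iff)
  then have n: "real n \<le> ln t / ln a" "ln t / ln a - 1 \<le> real n"
    unfolding n_def by linarith+
  have "t \<le> a ^ n"
  proof -
    have "ln t \<le> ln (a ^ n)"
      using n(1) assms by (simp add: le_divide_eq ln_realpow)
    then show ?thesis
      using assms by (subst (asm) ln_le_cancel_iff) auto
  qed
  then have "dilation_norm \<rho> t \<le> dilation_norm \<rho> (a ^ n)"
    using assms by (intro dilation_norm_mono) auto
  also have "\<dots> \<le> dilation_norm \<rho> a ^ n"
    using dilation_norm_power[of a n] assms by simp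
  also have "dilation_norm \<rho> a ^ n = dilation_norm \<rho> a powr real n"
    using assms by (simp add: powr_realpow dilation_norm_pos)
  also have "\<dots> \<le> dilation_norm \<rho> a powr (ln t / ln a - 1)"
    using assms n by (intro powr_mono' dilation_norm_le_1 dilation_norm_nonneg) auto
  also have "\<dots> = 1 / dilation_norm \<rho> a * dilation_norm \<rho> a powr (ln t / ln a)"
    using assms by (simp add: powr_diff dilation_norm_pos less_imp_le)
  also have "dilation_norm \<rho> a powr (ln t / ln a) = t powr (ln (dilation_norm \<rho> a) / ln a)"
    using assms by (intro powr_exponent_swap dilation_norm_pos) auto
  finally show ?thesis .
qed

text \<open>\<open>Lim\<close> carries information only once convergence is known. One half is
  immediate, as every quotient is below the supremum; for the other half, the power bound at an
  \<open>a\<close> with nearly optimal quotient keeps all quotients at large \<open>t\<close> almost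
  as large.\<close>

lemma boyd_quotient_tendsto_at_top:
  "(boyd_quotient \<rho> \<longlongrightarrow> (SUP a\<in>{1<..}. boyd_quotient \<rho> a)) at_top"
proof (rule order_tendstoI)
  fix x assume "x < (SUP a\<in>{1<..}. boyd_quotient \<rho> a)"
  then obtain a where a: "1 < a" "x < boyd_quotient \<rho> a"
    by (auto simp: less_SUP_iff)
  define c \<beta> where "c = ln (dilation_norm \<rho> a)" and "\<beta> = c / ln a"
  have h1: "1 \<le> dilation_norm \<rho> a"
    using a by (intro dilation_norm_ge_1) auto
  have "0 \<le> c"
    using h1 by (simp add: c_def)
  have ln_le: "ln (dilation_norm \<rho> t) \<le> c + \<beta> * ln t" if "1 < t" for t
  proof -
    have "ln (dilation_norm \<rho> t) \<le> ln (dilation_norm \<rho> a * t powr \<beta>)"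
      using dilation_norm_le_powr_ge_1[OF a(1), of t] that h1
      by (simp add: \<beta>_def c_def dilation_norm_pos)
    also have "\<dots> = c + \<beta> * ln t"
      using that h1 by (simp add: c_def ln_mult ln_powr)
    finally show ?thesis .
  qed
  show "\<forall>\<^sub>F t in at_top. x < boyd_quotient \<rho> t"
  proof (cases "c = 0")
    case True
    \<comment> \<open>The norm is 1 at \<open>a\<close>, so by the power bound it is 1 on all of
      \<open>{1<..}\<close> and the quotient takes its conventional value infinity.\<close>
    have "x < boyd_quotient \<rho> t" if "1 < t" for t
    proof -
      have "dilation_norm \<rho> t = 1"
        using ln_le[OF that] dilation_norm_ge_1[of t] that True by (simp add: \<beta>_def)
      then show ?thesis
        using a(2) by (auto simp: boyd_quotient_def less_top[symmetric])
    qed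
    then show ?thesis
      by (intro eventually_mono[OF eventually_gt_at_top[of 1]])
  next
    case False
    then have c: "0 < c" and \<beta>: "0 < \<beta>" and h_ne: "dilation_norm \<rho> a \<noteq> 1"
      using \<open>0 \<le> c\<close> a by (auto simp: \<beta>_def c_def)
    obtain y where y: "x < ereal y" "y * \<beta> < 1" "0 < y"
    proof -
      have "max x 0 < ereal (1 / \<beta>)"
        using a(2) h_ne \<beta> divide_pos_pos[OF ln_gt_zero[OF a(1)] c] by (simp add: boyd_quotient_def \<beta>_def c_def)
      then obtain y where "max x 0 < ereal y" "ereal y < ereal (1 / \<beta>)"
        using ereal_dense3 ereal_dense2 by blast
      then show thesis
        using \<beta> by (intro that[of y]) (auto simp: field_simps)
    qed
    have "filterlim ln at_top (at_top :: real filter)"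
      by (rule ln_at_top)
    \<comment> \<open>The threshold comes from solving
      \<open>y * (c + \<beta> * ln t) < ln t\<close> for \<open>ln t\<close>.\<close>
    then have "\<forall>\<^sub>F t in at_top. y * c / (1 - y * \<beta>) < ln t"
      by (simp add: filterlim_at_top_dense)
    then show ?thesis
      using eventually_gt_at_top[of 1]
    proof eventually_elim
      case (elim t)
      show "x < boyd_quotient \<rho> t"
      proof (cases "dilation_norm \<rho> t = 1")
        case True
        then show ?thesis
          using y(1) by (auto simp: boyd_quotient_def intro: less_trans)
      next
        case False
        then have pos: "0 < ln (dilation_norm \<rho> t)"
          using dilation_norm_ge_1[of t] elim by simp
        have "y * ln (dilation_norm \<rho> t) \<le> y * (c + \<beta> * ln t)"
          using y ln_le elim by (intro mult_left_mono) auto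
        also have "\<dots> < ln t"
          using elim y by (simp add: field_simps)
        finally have "y < ln t / ln (dilation_norm \<rho> t)"
          using pos by (simp add: field_simps)
        then show ?thesis
          using y(1) False by (auto simp: boyd_quotient_def intro: less_trans)
      qed
    qed
  qed
next
  fix x assume "(SUP a\<in>{1<..}. boyd_quotient \<rho> a) < x"
  then have "boyd_quotient \<rho> t < x" if "1 < t" for t
    using SUP_upper[of t "{1<..}" "boyd_quotient \<rho>"] that by auto
  then show "\<forall>\<^sub>F t in at_top. boyd_quotient \<rho> t < x"
    by (intro eventually_mono[OF eventually_gt_at_top[of "1::real"]])
qed

lemma boyd_quotient_tendsto_at_0:
  "(boyd_quotient \<rho> \<longlongrightarrow> (INF a\<in>{0<..<1}. boyd_quotient \<rho> a)) (at_right 0)"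
proof (rule order_tendstoI)
  fix x assume "(INF a\<in>{0<..<1}. boyd_quotient \<rho> a) < x"
  then obtain a where a: "0 < a" "a < 1" "boyd_quotient \<rho> a < x"
    by (auto simp: INF_less_iff)
  have h: "0 < dilation_norm \<rho> a" "dilation_norm \<rho> a < 1"
    using a dilation_norm_pos[of a] dilation_norm_le_1[of a]
    by (auto simp: boyd_quotient_def less_le)
  define c \<beta> where "c = - ln (dilation_norm \<rho> a)" and "\<beta> = ln (dilation_norm \<rho> a) / ln a"
  have c: "0 < c" and \<beta>: "0 < \<beta>"
    using h a by (auto simp: c_def \<beta>_def zero_less_divide_iff)
  have ln_le: "ln (dilation_norm \<rho> t) \<le> c + \<beta> * ln t" if "0 < t" "t < 1" for t
  proof -
    have "ln (dilation_norm \<rho> t) \<le> ln (1 / dilation_norm \<rho> a * t powr \<beta>)"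
      using dilation_norm_le_powr_le_1[OF a(1,2), of t] that h
      by (simp add: \<beta>_def c_def dilation_norm_pos)
    also have "\<dots> = c + \<beta> * ln t"
      using that h by (simp add: c_def ln_mult ln_div ln_powr)
    finally show ?thesis .
  qed
  obtain y where y: "ereal y < x" "1 < y * \<beta>" "0 < y"
  proof -
    have "ereal (1 / \<beta>) < x"
      using a(3) h by (simp add: boyd_quotient_def \<beta>_def)
    then obtain y where "ereal (1 / \<beta>) < ereal y" "ereal y < x"
      using ereal_dense2 by blast
    moreover from this have "0 < y"
      using \<beta> by (auto intro: less_trans[of 0 "1 / \<beta>"])
    ultimately show thesis
      using \<beta> by (intro that[of y]) (auto simp: field_simps)
  qed
  have "filterlim ln at_bot (at_right (0::real))"
    by (rule ln_at_0)
  \<comment> \<open>The first bound makes \<open>c + \<beta> * ln t\<close> negative, hence also the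
    logarithm of the norm, so that dividing by it reverses inequalities; the second again solves
    \<open>y * (c + \<beta> * ln t) < ln t\<close>.\<close>
  then have "\<forall>\<^sub>F t in at_right 0. ln t < min (- (c / \<beta>)) (- (y * c / (y * \<beta> - 1)))"
    unfolding filterlim_at_bot_dense by blast
  moreover have "\<forall>\<^sub>F t in at_right 0. t \<in> {0<..<1::real}"
    by (rule eventually_at_right_real) simp
  ultimately show "\<forall>\<^sub>F t in at_right 0. boyd_quotient \<rho> t < x"
  proof eventually_elim
    case (elim t)
    have le: "ln (dilation_norm \<rho> t) \<le> c + \<beta> * ln t"
      using elim ln_le by simp
    also have "\<dots> < 0"
      using elim \<beta> by (simp add: field_simps)
    finally have neg: "ln (dilation_norm \<rho> t) < 0" .
    have "y * ln (dilation_norm \<rho> t) \<le> y * (c + \<beta> * ln t)"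
      using y le by (intro mult_left_mono) auto
    also have "\<dots> < ln t"
      using elim y by (simp add: field_simps)
    finally have "ln t / ln (dilation_norm \<rho> t) < y"
      using neg by (simp add: field_simps)
    then have "ereal (ln t / ln (dilation_norm \<rho> t)) < x"
      using y(1) less_trans[of _ "ereal y" x] by simp
    then show ?case
      using neg by (auto simp: boyd_quotient_def)
  qed
next
  fix x assume "x < (INF a\<in>{0<..<1}. boyd_quotient \<rho> a)"
  then have "x < boyd_quotient \<rho> t" if "t \<in> {0<..<1}" for t
    using INF_lower[of t "{0<..<1}" "boyd_quotient \<rho>"] that by auto
  moreover have "\<forall>\<^sub>F t in at_right 0. t \<in> {0<..<1::real}"
    by (rule eventually_at_right_real) simp
  ultimately show "\<forall>\<^sub>F t in at_right 0. x < boyd_quotient \<rho> t"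
    by (auto elim!: eventually_mono)
qed

text \<open>As the index is a supremum, some \<open>a\<close> has a quotient above \<open>q\<close>.
  The exponent \<open>\<beta>\<close> is the reciprocal of that quotient, and 0 if the quotient is
  infinite.\<close>

lemma dilation_norm_lower_index:
  assumes q: "0 < q" "ereal q < lower_boyd_index \<rho>"
  obtains L \<beta> where "0 < L" "0 \<le> \<beta>" "\<beta> * q < 1" "\<And>t. 1 \<le> t \<Longrightarrow> dilation_norm \<rho> t \<le> L * t powr \<beta>"
proof -
  have "lower_boyd_index \<rho> = (SUP a\<in>{1<..}. boyd_quotient \<rho> a)"
    unfolding lower_boyd_index_def by (intro tendsto_Lim boyd_quotient_tendsto_at_top) simp
  then obtain a where a: "1 < a" "ereal q < boyd_quotient \<rho> a"
    using q by (auto simp: less_SUP_iff)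
  have h: "1 \<le> dilation_norm \<rho> a"
    using a by (intro dilation_norm_ge_1) auto
  have "ln (dilation_norm \<rho> a) * q < ln a"
    using a h by (cases "dilation_norm \<rho> a = 1") (auto simp: boyd_quotient_def field_simps)
  then show thesis
    using a h dilation_norm_le_powr_ge_1[OF a(1)]
    by (intro that[of "dilation_norm \<rho> a" "ln (dilation_norm \<rho> a) / ln a"]) (auto simp: field_simps)
qed

text \<open>A finite infimum provides some \<open>a < 1\<close> whose dilation norm differs from 1
  and is therefore below 1; its powers give the decay at 0.\<close>

lemma dilation_norm_upper_index:
  assumes "upper_boyd_index \<rho> < \<infinity>"
  obtains L \<gamma> where "0 < L" "0 < \<gamma>" "\<And>t. 0 < t \<Longrightarrow> t \<le> 1 \<Longrightarrow> dilation_norm \<rho> t \<le> L * t powr \<gamma>"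
proof -
  have "upper_boyd_index \<rho> = (INF a\<in>{0<..<1}. boyd_quotient \<rho> a)"
    unfolding upper_boyd_index_def by (intro tendsto_Lim boyd_quotient_tendsto_at_0) simp
  then obtain a where a: "0 < a" "a < 1" "boyd_quotient \<rho> a < \<infinity>"
    using assms by (auto simp only: INF_less_iff greaterThanLessThan_iff)
  have h: "0 < dilation_norm \<rho> a" "dilation_norm \<rho> a < 1"
    using a dilation_norm_pos[of a] dilation_norm_le_1[of a]
    by (auto simp: boyd_quotient_def less_le)
  then show thesis
    using a dilation_norm_le_powr_le_1[OF a(1,2)]
    by (intro that[of "1 / dilation_norm \<rho> a" "ln (dilation_norm \<rho> a) / ln a"])
      (auto simp: zero_less_divide_iff)
qed

end


section \<open>From distribution function inequalities to norm inequalities\<close>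

text \<open>The number \<open>t\<close> is a budget shared out in portions
  \<open>\<theta> k * t\<close>: a level \<open>r\<close> above the right-hand side forces the k-th
  term on the left below its portion. Writing the argument as \<open>t / (b k / \<theta> k)\<close>
  displays it as a dilation by \<open>b k / \<theta> k\<close>.\<close>

lemma decr_rearr_suminf:
  fixes a b \<theta> :: "nat \<Rightarrow> real"
  assumes \<mu>: "antimono \<mu>" and a: "\<And>k. 0 < a k" and b: "\<And>k. 0 < b k" and \<theta>: "\<And>k. 0 \<le> \<theta> k"
    and sum_\<theta>: "(\<Sum>k. ennreal (\<theta> k)) \<le> 1" and "0 \<le> t"
  shows "decr_rearr (\<lambda>r. \<Sum>k. ennreal (b k) * \<mu> (a k * r)) t
    \<le> (\<Sum>k. ennreal (1 / a k) * decr_rearr \<mu> (t / (b k / \<theta> k)))" (is "decr_rearr ?m t \<le> ?V")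
proof (rule dense_ge)
  fix v assume v: "?V < v"
  show "decr_rearr ?m t \<le> v"
  proof (cases v)
    case (real r)
    with v have "0 < r"
      by (cases "r = 0") auto
    have "ennreal (b k) * \<mu> (a k * r) \<le> ennreal (\<theta> k) * ennreal t" for k
    proof -
      have "ennreal (1 / a k) * decr_rearr \<mu> (t / (b k / \<theta> k)) \<le> ?V"
        using sum_le_suminf[of "\<lambda>k. ennreal (1 / a k) * decr_rearr \<mu> (t / (b k / \<theta> k))" "{k}"] by simp
      also have "\<dots> < ennreal r"
        using v real by simp
      finally have "ennreal (a k) * (ennreal (1 / a k) * decr_rearr \<mu> (t / (b k / \<theta> k))) < ennreal (a k) * ennreal r"
        using a[of k] by (intro ennreal_mult_strict_left_mono) auto
      then have "decr_rearr \<mu> (t / (b k / \<theta> k)) < ennreal (a k * r)"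
        using a[of k] \<open>0 < r\<close> by (simp add: mult.assoc[symmetric] ennreal_mult[symmetric])
      then have "\<mu> (a k * r) \<le> ennreal (t / (b k / \<theta> k))"
        by (rule decr_rearr_lessD[OF \<mu>])
      then have "ennreal (b k) * \<mu> (a k * r) \<le> ennreal (b k) * ennreal (t / (b k / \<theta> k))"
        by (intro mult_left_mono) auto
      also have "\<dots> = ennreal (\<theta> k) * ennreal t"
        using b[of k] \<theta>[of k] \<open>0 \<le> t\<close> by (simp add: ennreal_mult[symmetric] mult.commute)
      finally show ?thesis .
    qed
    then have "?m r \<le> (\<Sum>k. ennreal (\<theta> k) * ennreal t)"
      by (intro suminf_le) auto
    also have "\<dots> = (\<Sum>k. ennreal (\<theta> k)) * ennreal t"
      by simp
    also have "\<dots> \<le> 1 * ennreal t"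
      using sum_\<theta> by (intro mult_right_mono) auto
    finally show ?thesis
      using real \<open>0 < r\<close> by (intro order_trans[OF decr_rearr_le[of r]]) auto
  qed simp
qed

lemma decr_rearr_add:
  assumes m1: "antimono m1" and m2: "antimono m2" and "0 < c" "0 \<le> t"
    and le: "\<And>r. 0 < r \<Longrightarrow> m (c * r) \<le> m1 r + m2 r"
  shows "decr_rearr m t \<le> ennreal c * (decr_rearr m1 (t / 2) + decr_rearr m2 (t / 2))"
proof (rule dense_ge)
  fix v assume v: "ennreal c * (decr_rearr m1 (t / 2) + decr_rearr m2 (t / 2)) < v"
  show "decr_rearr m t \<le> v"
  proof (cases v)
    case (real r)
    with v have "0 < r"
      by (cases "r = 0") auto
    have "ennreal (1 / c) * (ennreal c * (decr_rearr m1 (t / 2) + decr_rearr m2 (t / 2))) < ennreal (1 / c) * ennreal r"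
      using v real \<open>0 < c\<close> by (intro ennreal_mult_strict_left_mono) auto
    then have "decr_rearr m1 (t / 2) + decr_rearr m2 (t / 2) < ennreal (r / c)"
      using \<open>0 < c\<close> \<open>0 < r\<close> by (simp add: mult.assoc[symmetric] ennreal_mult[symmetric])
    then have "decr_rearr m1 (t / 2) < ennreal (r / c)" "decr_rearr m2 (t / 2) < ennreal (r / c)"
      by (auto intro: le_less_trans[rotated])
    then have "m1 (r / c) + m2 (r / c) \<le> ennreal (t / 2) + ennreal (t / 2)"
      by (intro add_mono decr_rearr_lessD m1 m2)
    also have "\<dots> = ennreal t"
      using \<open>0 \<le> t\<close> by (simp add: ennreal_plus[symmetric] del: ennreal_plus)
    finally have "m r \<le> ennreal t"
      using le[of "r / c"] \<open>0 < r\<close> \<open>0 < c\<close> by simp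
    then show ?thesis
      using real \<open>0 < r\<close> by (intro order_trans[OF decr_rearr_le[of r]]) auto
  qed simp
qed

lemma power_powr_swap: "0 \<le> x \<Longrightarrow> (x ^ n) powr a = (x powr a) ^ n" for x a :: real
  by (induction n) (auto simp: powr_mult)

context half_line_ri_norm
begin

section \<open>Norms of series of dilated rearrangements\<close>

lemma norm_sum_le:
  assumes "finite I" "\<And>k. k \<in> I \<Longrightarrow> F k \<in> borel_measurable half_line"
  shows "\<rho> (\<lambda>x. \<Sum>k\<in>I. F k x) \<le> (\<Sum>k\<in>I. \<rho> (F k))"
  using assms
proof (induction I rule: finite_induct)
  case empty
  then show ?case using eq_zero_iff[of "\<lambda>_. 0"] by simp
next
  case (insert i I)
  then have "\<rho> (\<lambda>x. F i x + (\<Sum>k\<in>I. F k x)) \<le> \<rho> (F i) + \<rho> (\<lambda>x. \<Sum>k\<in>I. F k x)"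
    by (intro triangle) auto
  also have "\<dots> \<le> \<rho> (F i) + (\<Sum>k\<in>I. \<rho> (F k))"
    using insert by (intro add_left_mono) auto
  finally show ?case using insert by simp
qed

lemma norm_suminf_le:
  assumes F[measurable]: "\<And>k::nat. F k \<in> borel_measurable half_line"
  shows "\<rho> (\<lambda>x. \<Sum>k. F k x) \<le> (\<Sum>k. \<rho> (F k))"
proof (rule LIMSEQ_le_const2)
  show "(\<lambda>n. \<rho> (\<lambda>x. \<Sum>k<n. F k x)) \<longlonglongrightarrow> \<rho> (\<lambda>x. \<Sum>k. F k x)"
    by (intro fatou AE_I2 conjI incseq_SucI summable_LIMSEQ) auto
  show "\<exists>N. \<forall>n\<ge>N. \<rho> (\<lambda>x. \<Sum>k<n. F k x) \<le> (\<Sum>k. \<rho> (F k))"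
    using norm_sum_le[of "{..<_}" F] sum_le_suminf[of "\<lambda>k. \<rho> (F k)" "{..<_}"]
    by (auto intro: order_trans)
qed

lemma measurable_decr_rearr_dilation [measurable]:
  "(\<lambda>t. decr_rearr m (t / a)) \<in> borel_measurable half_line"
  by (intro borel_measurable_half_lineI) simp

lemma norm_decr_rearr_suminf:
  fixes a b \<theta> :: "nat \<Rightarrow> real"
  assumes \<mu>: "antimono \<mu>" and a: "\<And>k. 0 < a k" and b: "\<And>k. 0 < b k" and \<theta>: "\<And>k. 0 < \<theta> k"
    and sum_\<theta>: "(\<Sum>k. ennreal (\<theta> k)) \<le> 1" and fin: "\<rho> (decr_rearr \<mu>) < \<infinity>"
  shows "\<rho> (decr_rearr (\<lambda>r. \<Sum>k. ennreal (b k) * \<mu> (a k * r)))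
    \<le> (\<Sum>k. ennreal (1 / a k * dilation_norm \<rho> (b k / \<theta> k))) * \<rho> (decr_rearr \<mu>)"
proof -
  have "\<rho> (decr_rearr (\<lambda>r. \<Sum>k. ennreal (b k) * \<mu> (a k * r)))
      \<le> \<rho> (\<lambda>t. \<Sum>k. ennreal (1 / a k) * decr_rearr \<mu> (t / (b k / \<theta> k)))"
    using assms by (intro lattice AE_I2 decr_rearr_suminf) (auto intro: borel_measurable_half_lineI less_imp_le)
  also have "\<dots> \<le> (\<Sum>k. \<rho> (\<lambda>t. ennreal (1 / a k) * decr_rearr \<mu> (t / (b k / \<theta> k))))"
    by (intro norm_suminf_le) measurable
  also have "\<dots> \<le> (\<Sum>k. ennreal (1 / a k * dilation_norm \<rho> (b k / \<theta> k)) * \<rho> (decr_rearr \<mu>))"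
  proof (intro suminf_le)
    fix k
    have "\<rho> (\<lambda>t. ennreal (1 / a k) * decr_rearr \<mu> (t / (b k / \<theta> k))) =
        ennreal (1 / a k) * \<rho> (\<lambda>t. decr_rearr \<mu> (t / (b k / \<theta> k)))"
      using a[of k] by (intro scale measurable_decr_rearr_dilation) auto
    also have "\<dots> \<le> ennreal (1 / a k) * (ennreal (dilation_norm \<rho> (b k / \<theta> k)) * \<rho> (decr_rearr \<mu>))"
      using b[of k] \<theta>[of k] fin
      by (intro mult_left_mono norm_dilation_le) (auto intro: borel_measurable_half_lineI)
    finally show "\<rho> (\<lambda>t. ennreal (1 / a k) * decr_rearr \<mu> (t / (b k / \<theta> k)))
        \<le> ennreal (1 / a k * dilation_norm \<rho> (b k / \<theta> k)) * \<rho> (decr_rearr \<mu>)"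
      using a[of k] by (subst ennreal_mult) (auto simp: mult.assoc dilation_norm_nonneg)
  qed auto
  finally show ?thesis by simp
qed

text \<open>Each summand receives half of \<open>t\<close>, and the resulting dilation by 2 doubles
  norms at most; hence the constant \<open>2 * c\<close>.\<close>

lemma norm_decr_rearr_add:
  assumes "antimono m1" "antimono m2" "0 < c"
    and "\<And>r. 0 < r \<Longrightarrow> m (c * r) \<le> m1 r + m2 r"
  shows "\<rho> (decr_rearr m) \<le> ennreal (2 * c) * (\<rho> (decr_rearr m1) + \<rho> (decr_rearr m2))"
proof -
  have "\<rho> (decr_rearr m) \<le> \<rho> (\<lambda>t. ennreal c * (decr_rearr m1 (t / 2) + decr_rearr m2 (t / 2)))"
    using assms by (intro lattice AE_I2 decr_rearr_add) (auto intro: borel_measurable_half_lineI)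
  also have "\<dots> = ennreal c * \<rho> (\<lambda>t. decr_rearr m1 (t / 2) + decr_rearr m2 (t / 2))"
    using \<open>0 < c\<close> by (intro scale) auto
  also have "\<dots> \<le> ennreal c * (\<rho> (\<lambda>t. decr_rearr m1 (t / 2)) + \<rho> (\<lambda>t. decr_rearr m2 (t / 2)))"
    by (intro mult_left_mono triangle) auto
  also have "\<dots> \<le> ennreal c * (2 * \<rho> (decr_rearr m1) + 2 * \<rho> (decr_rearr m2))"
    by (intro mult_left_mono add_mono norm_dilation_2) (auto intro: borel_measurable_half_lineI)
  also have "\<dots> = ennreal (2 * c) * (\<rho> (decr_rearr m1) + \<rho> (decr_rearr m2))"
    using \<open>0 < c\<close> by (simp add: ennreal_mult algebra_simps)
  finally show ?thesis .
qed

lemma sum_half_powers: "(\<Sum>k. ennreal ((1 / 2) ^ Suc k)) = 1"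
  using power_half_series by (subst suminf_ennreal_eq) auto

text \<open>With portions \<open>(1 / 2) ^ Suc k\<close> the k-th coefficient is at most a multiple
  of \<open>x ^ k\<close> for \<open>x = (2 * R powr q) powr \<beta> / R\<close>. The exponent of
  \<open>R\<close> in \<open>x\<close> is \<open>\<beta> * q - 1\<close>, which is negative since
  \<open>q\<close> is below the index, so a large \<open>R\<close> makes the series
  converge.\<close>

lemma norm_decr_rearr_geometric_up:
  assumes q: "0 < q" "ereal q < lower_boyd_index \<rho>"
  obtains R where "1 < R"
    "\<And>K. 1 \<le> K \<Longrightarrow> \<exists>C::real. \<forall>\<mu>. antimono \<mu> \<longrightarrow> \<rho> (decr_rearr \<mu>) < \<infinity> \<longrightarrow>
      \<rho> (decr_rearr (\<lambda>r. \<Sum>k. ennreal (K * (R powr q) ^ k) * \<mu> (R ^ k * r))) \<le> ennreal C * \<rho> (decr_rearr \<mu>)"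
proof -
  obtain L \<beta> where L: "0 < L" "0 \<le> \<beta>" "\<beta> * q < 1"
    and h: "\<And>t. 1 \<le> t \<Longrightarrow> dilation_norm \<rho> t \<le> L * t powr \<beta>"
    using dilation_norm_lower_index[OF q] by blast
  \<comment> \<open>The exponent is chosen to give \<open>x = 1 / 2\<close>.\<close>
  define R where "R = 2 powr ((\<beta> + 1) / (1 - \<beta> * q))"
  have R: "1 < R"
    using L by (auto simp: R_def)
  have R1: "1 \<le> R powr q"
    using R q by (intro ge_one_powr_ge_zero) auto
  define x where "x = (2 * R powr q) powr \<beta> / R"
  have x: "0 < x" "x < 1"
  proof -
    have "(2 * R powr q) powr \<beta> = 2 powr \<beta> * R powr (\<beta> * q)"
      using R by (simp add: powr_mult powr_powr mult.commute)
    then have "x = 2 powr \<beta> * R powr (\<beta> * q - 1)"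
      using R by (simp add: x_def powr_diff)
    also have "R powr (\<beta> * q - 1) = 2 powr (- (\<beta> + 1))"
      using L unfolding R_def powr_powr by (intro arg_cong2[where f = "(powr)"]) (auto simp: field_simps)
    also have "2 powr \<beta> * 2 powr (- (\<beta> + 1)) = (2 powr - 1 :: real)"
      by (simp only: powr_add[symmetric]) simp
    finally show "0 < x" "x < 1" by (auto simp: powr_minus_divide)
  qed
  show thesis
  proof (rule that[OF R])
    fix K :: real assume K: "1 \<le> K"
    define C where "C = (\<Sum>k. L * (2 * K) powr \<beta> * x ^ k)"
    have sm: "summable (\<lambda>k. L * (2 * K) powr \<beta> * x ^ k)"
      using x by (intro summable_mult summable_geometric) auto
    have summand: "1 / R ^ k * dilation_norm \<rho> (K * (R powr q) ^ k / (1 / 2) ^ Suc k) \<le> L * (2 * K) powr \<beta> * x ^ k" for k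
    proof -
      have eq: "K * (R powr q) ^ k / (1 / 2) ^ Suc k = 2 * K * (2 * R powr q) ^ k"
        by (simp add: field_simps power_mult_distrib)
      \<comment> \<open>The bound \<open>h\<close> is valid for arguments from 1 on; this is the use
        of \<open>1 \<le> K\<close>.\<close>
      have "1 * 1 \<le> 2 * K * (2 * R powr q) ^ k"
        using K R1 by (intro mult_mono one_le_power) auto
      then have "dilation_norm \<rho> (2 * K * (2 * R powr q) ^ k) \<le> L * (2 * K * (2 * R powr q) ^ k) powr \<beta>"
        by (intro h) simp
      also have "(2 * K * (2 * R powr q) ^ k) powr \<beta> = (2 * K) powr \<beta> * ((2 * R powr q) powr \<beta>) ^ k"
      proof -
        have "0 \<le> 2 * R powr q" by simp
        then show ?thesis
          using K by (simp only: powr_mult power_powr_swap)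
      qed
      finally show ?thesis
        unfolding eq using R by (simp add: x_def power_divide field_simps)
    qed
    have sum_le: "(\<Sum>k. ennreal (1 / R ^ k * dilation_norm \<rho> (K * (R powr q) ^ k / (1 / 2) ^ Suc k))) \<le> ennreal C"
    proof -
      have "(\<Sum>k. ennreal (1 / R ^ k * dilation_norm \<rho> (K * (R powr q) ^ k / (1 / 2) ^ Suc k)))
          \<le> (\<Sum>k. ennreal (L * (2 * K) powr \<beta> * x ^ k))"
        by (intro suminf_le ennreal_leI summand) auto
      also have "\<dots> = ennreal C"
        unfolding C_def using L x K sm by (intro suminf_ennreal2) auto
      finally show ?thesis .
    qed
    show "\<exists>C::real. \<forall>\<mu>. antimono \<mu> \<longrightarrow> \<rho> (decr_rearr \<mu>) < \<infinity> \<longrightarrow>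
      \<rho> (decr_rearr (\<lambda>r. \<Sum>k. ennreal (K * (R powr q) ^ k) * \<mu> (R ^ k * r))) \<le> ennreal C * \<rho> (decr_rearr \<mu>)"
    proof (intro exI allI impI)
      fix \<mu> :: "real \<Rightarrow> ennreal" assume "antimono \<mu>" "\<rho> (decr_rearr \<mu>) < \<infinity>"
      then have "\<rho> (decr_rearr (\<lambda>r. \<Sum>k. ennreal (K * (R powr q) ^ k) * \<mu> (R ^ k * r)))
        \<le> (\<Sum>k. ennreal (1 / R ^ k * dilation_norm \<rho> (K * (R powr q) ^ k / (1 / 2) ^ Suc k))) * \<rho> (decr_rearr \<mu>)"
        using R K by (intro norm_decr_rearr_suminf) (auto simp only: sum_half_powers zero_less_power zero_less_mult_iff, auto)
      also have "\<dots> \<le> ennreal C * \<rho> (decr_rearr \<mu>)"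
        by (intro mult_right_mono sum_le) auto
      finally show "\<rho> (decr_rearr (\<lambda>r. \<Sum>k. ennreal (K * (R powr q) ^ k) * \<mu> (R ^ k * r))) \<le> ennreal C * \<rho> (decr_rearr \<mu>)" .
    qed
  qed
qed

lemma norm_decr_rearr_geometric_down:
  assumes "upper_boyd_index \<rho> < \<infinity>"
  obtains \<delta> C :: real where "0 < \<delta>" "\<delta> < 1"
    "\<And>\<mu>. antimono \<mu> \<Longrightarrow> \<rho> (decr_rearr \<mu>) < \<infinity> \<Longrightarrow>
      \<rho> (decr_rearr (\<lambda>r. \<Sum>k. ennreal (\<delta> ^ Suc k) * \<mu> ((1 / 2) ^ Suc k * r))) \<le> ennreal C * \<rho> (decr_rearr \<mu>)"
proof -
  obtain L \<gamma> where L: "0 < L" "0 < \<gamma>"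
    and h: "\<And>t. 0 < t \<Longrightarrow> t \<le> 1 \<Longrightarrow> dilation_norm \<rho> t \<le> L * t powr \<gamma>"
    using dilation_norm_upper_index[OF assms] by blast
  \<comment> \<open>Chosen so that \<open>(2 * \<delta>) powr \<gamma> = 1 / 4\<close>. The
    shrinking levels contribute \<open>2 ^ Suc k\<close> to the k-th coefficient; half of the decay
    \<open>(1 / 4) ^ Suc k\<close> cancels it and the other half sums.\<close>
  define \<delta> :: real where "\<delta> = 4 powr (- 1 / \<gamma>) / 2"
  have less: "4 powr (- 1 / \<gamma>) < (1::real)"
    using L powr_less_mono[of "- 1 / \<gamma>" 0 "4::real"] by auto
  have \<delta>: "0 < \<delta>" "\<delta> < 1" "2 * \<delta> \<le> 1"
    using less by (auto simp: \<delta>_def)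
  have \<delta>_powr: "(2 * \<delta>) powr \<gamma> = 1 / 4"
  proof -
    have "(2 * \<delta>) powr \<gamma> = 4 powr (- 1 / \<gamma> * \<gamma>)"
      unfolding \<delta>_def by (simp only: powr_powr[symmetric]) simp
    also have "- 1 / \<gamma> * \<gamma> = - 1"
      using L by simp
    finally show ?thesis
      by (simp add: powr_minus_divide)
  qed
  have summand: "1 / (1 / 2) ^ Suc k * dilation_norm \<rho> (\<delta> ^ Suc k / (1 / 2) ^ Suc k) \<le> L * (1 / 2) ^ Suc k" for k
  proof -
    have eq: "\<delta> ^ Suc k / (1 / 2) ^ Suc k = (2 * \<delta>) ^ Suc k"
      by (simp only: power_divide[symmetric]) simp
    have "dilation_norm \<rho> ((2 * \<delta>) ^ Suc k) \<le> L * ((2 * \<delta>) ^ Suc k) powr \<gamma>"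
      using \<delta> by (intro h power_le_one zero_less_power) auto
    also have "((2 * \<delta>) ^ Suc k) powr \<gamma> = ((2 * \<delta>) powr \<gamma>) ^ Suc k"
      using \<delta> by (intro power_powr_swap) simp
    also have "\<dots> = (1 / 4) ^ Suc k"
      by (simp only: \<delta>_powr)
    also have "(1 / 4 :: real) ^ Suc k = (1 / 2) ^ Suc k * (1 / 2) ^ Suc k"
      by (simp only: power_mult_distrib[symmetric]) simp
    finally show ?thesis
      unfolding eq by (simp add: field_simps)
  qed
  have sum_le: "(\<Sum>k. ennreal (1 / (1 / 2) ^ Suc k * dilation_norm \<rho> (\<delta> ^ Suc k / (1 / 2) ^ Suc k))) \<le> ennreal L"
  proof -
    have "(\<Sum>k. ennreal (1 / (1 / 2) ^ Suc k * dilation_norm \<rho> (\<delta> ^ Suc k / (1 / 2) ^ Suc k)))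
        \<le> (\<Sum>k. ennreal L * ennreal ((1 / 2) ^ Suc k))"
    proof (intro suminf_le)
      fix k
      have "ennreal L * ennreal ((1 / 2) ^ Suc k) = ennreal (L * (1 / 2) ^ Suc k)"
        using L by (intro ennreal_mult[symmetric]) auto
      then show "ennreal (1 / (1 / 2) ^ Suc k * dilation_norm \<rho> (\<delta> ^ Suc k / (1 / 2) ^ Suc k))
          \<le> ennreal L * ennreal ((1 / 2) ^ Suc k)"
        by (simp only: ennreal_leI summand)
    qed auto
    also have "\<dots> = ennreal L"
      using sum_half_powers by (simp del: power_Suc)
    finally show ?thesis .
  qed
  show thesis
  proof (rule that[OF \<delta>(1,2)])
    fix \<mu> :: "real \<Rightarrow> ennreal" assume "antimono \<mu>" "\<rho> (decr_rearr \<mu>) < \<infinity>"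
    then have "\<rho> (decr_rearr (\<lambda>r. \<Sum>k. ennreal (\<delta> ^ Suc k) * \<mu> ((1 / 2) ^ Suc k * r)))
      \<le> (\<Sum>k. ennreal (1 / (1 / 2) ^ Suc k * dilation_norm \<rho> (\<delta> ^ Suc k / (1 / 2) ^ Suc k))) * \<rho> (decr_rearr \<mu>)"
      using \<delta> by (intro norm_decr_rearr_suminf zero_less_power) (auto simp: sum_half_powers simp del: power_Suc)
    also have "\<dots> \<le> ennreal L * \<rho> (decr_rearr \<mu>)"
      by (intro mult_right_mono sum_le) auto
    finally show "\<rho> (decr_rearr (\<lambda>r. \<Sum>k. ennreal (\<delta> ^ Suc k) * \<mu> ((1 / 2) ^ Suc k * r))) \<le> ennreal L * \<rho> (decr_rearr \<mu>)" .
  qed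
qed

end


section \<open>Weighted level sets and weak type estimates\<close>

text \<open>A weight is known to be measurable on \<open>{0<..}\<close>, while
  \<open>half_line\<close> contains 0; the value there is put back by an indicator of
  \<open>{0}\<close>.\<close>

lemma weight_measurable:
  assumes "weight w"
  shows "(\<lambda>t. ennreal (w t)) \<in> borel_measurable half_line"
proof -
  have "w \<in> borel_measurable (lebesgue_on {0<..})"
    using assms by (simp add: weight_def)
  then have "(\<lambda>t. if t \<in> {0<..} then w t else 0) \<in> borel_measurable lebesgue"
    by (intro borel_measurable_if_I) auto
  then have "(\<lambda>t. (if t \<in> {0<..} then w t else 0) + indicator {0} t * w 0) \<in> borel_measurable half_line"
    by (intro borel_measurable_add measurable_restrict_space1 borel_measurable_times borel_measurable_indicator) auto
  then have "w \<in> borel_measurable half_line"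
    by (rule measurable_cong[THEN iffD1, rotated]) (auto simp: indicator_def)
  then show ?thesis by simp
qed

lemma AE_half_line_neq: "AE t in half_line. t \<noteq> a"
proof -
  have "AE t in lebesgue. t \<noteq> a"
    by (rule AE_completion[OF AE_lborel_singleton])
  then show ?thesis
    by (subst AE_restrict_space_iff) auto
qed

lemma weight_of_mono:
  assumes "\<And>t. 0 < t \<Longrightarrow> t \<in> A \<Longrightarrow> t \<in> B"
  shows "weight_of w A \<le> weight_of w B"
  unfolding weight_of_def
proof (rule nn_integral_mono_AE)
  show "AE t in half_line. ennreal (w t) * indicator A t \<le> ennreal (w t) * indicator B t"
    using AE_half_line_neq[of 0] AE_space
  proof eventually_elim
    case (elim t)
    then show ?case using assms[of t] by (auto split: split_indicator)
  qed
qed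

lemma term_le_suminf: "f k \<le> (\<Sum>k. f k)" for f :: "nat \<Rightarrow> ennreal"
  using sum_le_suminf[of f "{k}"] by simp

lemma weight_of_UN_le:
  fixes A :: "nat \<Rightarrow> real set"
  assumes w: "weight w" and A: "\<And>n. A n \<in> sets half_line"
  shows "weight_of w (\<Union>n. A n) \<le> (\<Sum>n. weight_of w (A n))"
proof -
  note [measurable] = weight_measurable[OF w] A
  have "weight_of w (\<Union>n. A n) \<le> (\<integral>\<^sup>+t. (\<Sum>n. ennreal (w t) * indicator (A n) t) \<partial>half_line)"
    unfolding weight_of_def
  proof (rule nn_integral_mono)
    fix t
    show "ennreal (w t) * indicator (\<Union>n. A n) t \<le> (\<Sum>n. ennreal (w t) * indicator (A n) t)"
    proof (cases "t \<in> (\<Union>n. A n)")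
      case True
      then obtain n where "t \<in> A n" by auto
      then show ?thesis
        using term_le_suminf[of "\<lambda>n. ennreal (w t) * indicator (A n) t" n] True by simp
    qed simp
  qed
  also have "\<dots> = (\<Sum>n. weight_of w (A n))"
    unfolding weight_of_def by (intro nn_integral_suminf) measurable
  finally show ?thesis .
qed

lemma weight_of_Un_le:
  assumes w: "weight w" and A: "A \<in> sets half_line" "B \<in> sets half_line"
  shows "weight_of w (A \<union> B) \<le> weight_of w A + weight_of w B"
proof -
  note [measurable] = weight_measurable[OF w] A
  have "weight_of w (A \<union> B) \<le> (\<integral>\<^sup>+t. ennreal (w t) * indicator A t + ennreal (w t) * indicator B t \<partial>half_line)"
    unfolding weight_of_def by (intro nn_integral_mono) (auto split: split_indicator)
  also have "\<dots> = weight_of w A + weight_of w B"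
    unfolding weight_of_def by (intro nn_integral_add) measurable
  finally show ?thesis .
qed

text \<open>Used to rule out that an operator is infinite on an interval, since such an interval
  cannot have weight 0.\<close>

lemma weight_of_interval_pos:
  assumes w: "weight w" and "0 \<le> a" "a < b"
  shows "0 < weight_of w {a<..<b}"
proof (rule ccontr)
  note [measurable] = weight_measurable[OF w]
  have A[measurable]: "{a<..<b} \<in> sets half_line"
    using assms by (subst sets_restrict_space_iff) auto
  assume "\<not> 0 < weight_of w {a<..<b}"
  then have "AE t in half_line. ennreal (w t) * indicator {a<..<b} t = 0"
    unfolding weight_of_def by (subst (asm) zero_less_iff_neq_zero) (simp add: nn_integral_0_iff_AE)
  then have "AE t in half_line. indicator {a<..<b} t = (0 :: ennreal)"
    using AE_space
  proof eventually_elim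
    case (elim t)
    have "0 < w t" if "a < t"
      using w \<open>0 \<le> a\<close> that by (auto simp: weight_def)
    then show ?case
      using elim by (auto simp: ennreal_eq_0_iff split: split_indicator_asm split_indicator)
  qed
  then have "(\<integral>\<^sup>+t. indicator {a<..<b} t \<partial>half_line) = (\<integral>\<^sup>+t. 0 \<partial>half_line)"
    by (intro nn_integral_cong_AE) auto
  then have "emeasure half_line {a<..<b} = 0"
    by simp
  then show False
    using assms by (subst (asm) emeasure_half_line) auto
qed

text \<open>Counterpart of \<open>weighted_distr\<close> for extended nonnegative functions. The
  null point 0 is left out because operators and their counterparts are compared at positive
  arguments only.\<close>

definition weight_above :: "(real \<Rightarrow> real) \<Rightarrow> (real \<Rightarrow> ennreal) \<Rightarrow> real \<Rightarrow> ennreal" where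
  "weight_above w G r = weight_of w {t \<in> {0<..}. ennreal r < G t}"

lemma weight_above_antimono: "antimono (weight_above w G)"
  unfolding weight_above_def
  by (intro antimonoI weight_of_mono) (auto intro: le_less_trans[OF ennreal_leI])

lemma weight_above_mono:
  assumes "\<And>t. 0 < t \<Longrightarrow> ennreal r < G t \<Longrightarrow> ennreal s < H t"
  shows "weight_above w G r \<le> weight_above w H s"
  unfolding weight_above_def using assms by (intro weight_of_mono) auto

lemma weighted_distr_antimono: "antimono (weighted_distr w f)"
  unfolding weighted_distr_def by (intro antimonoI weight_of_mono) auto

lemma weighted_distr_eq:
  assumes "0 \<le> r"
  shows "weighted_distr w f r = weight_above w (\<lambda>t. ennreal (norm (f t))) r"
  unfolding weighted_distr_def weight_above_def using assms
  by (intro antisym weight_of_mono) (auto simp: ennreal_less_iff)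

section \<open>Chebyshev and layer estimates for q-th powers\<close>

lemma ennreal_powr_mono: "0 < q \<Longrightarrow> x \<le> y \<Longrightarrow> ennreal_powr x q \<le> ennreal_powr y q"
  unfolding ennreal_powr_def
  by (cases x; cases y) (auto intro!: ennreal_leI powr_mono2 simp: top_unique)

lemma ennreal_powr_ennreal: "0 \<le> r \<Longrightarrow> ennreal_powr (ennreal r) q = ennreal (r powr q)"
  by (simp add: ennreal_powr_def)

lemma ennreal_powr_inverse: "0 < q \<Longrightarrow> ennreal_powr (ennreal_powr x (1 / q)) q = x"
  by (cases x) (auto simp: ennreal_powr_def powr_powr)

lemma ennreal_powr_cmult:
  "0 < c \<Longrightarrow> ennreal_powr (ennreal c * x) q = ennreal (c powr q) * ennreal_powr x q"
  by (cases x)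
    (auto simp: ennreal_powr_def ennreal_mult[symmetric] powr_mult ennreal_mult_top ennreal_top_mult)

definition initial_segment :: "ennreal \<Rightarrow> real set" where
  "initial_segment x = {t \<in> {0..}. ennreal t < x}"

lemma mem_initial_segment: "t \<in> initial_segment x \<longleftrightarrow> 0 \<le> t \<and> ennreal t < x"
  by (simp add: initial_segment_def)

lemma sets_initial_segment [measurable]: "initial_segment x \<in> sets half_line"
proof -
  have "(\<lambda>t. ennreal t) \<in> borel_measurable half_line"
    by (intro borel_measurable_half_lineI) measurable
  then have "{t \<in> space half_line. ennreal t < x} \<in> sets half_line"
    by measurable
  then show ?thesis by (simp add: initial_segment_def)
qed

lemma nn_integral_initial_segment:
  "(\<integral>\<^sup>+t. c * indicator (initial_segment x) t \<partial>half_line) = c * x"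
  using emeasure_initial_segment[of x] sets_initial_segment[of x]
  by (simp only: nn_integral_cmult_indicator initial_segment_def)

text \<open>The rearrangement is at least \<open>r\<close> on the interval from 0 of length
  \<open>m r\<close>.\<close>

lemma chebyshev_decr_rearr:
  assumes m: "antimono m" and "0 < r" "0 < q"
  shows "ennreal (r powr q) * m r \<le> (\<integral>\<^sup>+t. ennreal_powr (decr_rearr m t) q \<partial>half_line)"
proof -
  have "ennreal (r powr q) * m r = (\<integral>\<^sup>+t. ennreal (r powr q) * indicator (initial_segment (m r)) t \<partial>half_line)"
    by (simp only: nn_integral_initial_segment)
  also have "\<dots> \<le> (\<integral>\<^sup>+t. ennreal_powr (decr_rearr m t) q \<partial>half_line)"
  proof (rule nn_integral_mono)
    fix t
    show "ennreal (r powr q) * indicator (initial_segment (m r)) t \<le> ennreal_powr (decr_rearr m t) q"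
      using ennreal_powr_mono[OF \<open>0 < q\<close> decr_rearr_ge[OF m, of t r]] \<open>0 < r\<close>
      by (auto simp: ennreal_powr_ennreal mem_initial_segment split: split_indicator)
  qed
  finally show ?thesis .
qed

lemma suminf_eq_top:
  fixes f :: "nat \<Rightarrow> ennreal"
  assumes "0 < c" "\<And>k. c \<le> f k"
  shows "(\<Sum>k. f k) = top"
proof (rule ccontr)
  assume "(\<Sum>k. f k) \<noteq> top"
  then obtain v where v: "0 \<le> v" "(\<Sum>k. f k) = ennreal v"
    by (cases "\<Sum>k. f k") auto
  have le: "of_nat n * c \<le> ennreal v" for n
  proof -
    have "of_nat n * c \<le> (\<Sum>k<n. f k)"
      using sum_mono[of "{..<n}" "\<lambda>_. c" f] assms(2) by simp
    also have "\<dots> \<le> ennreal v"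
      using sum_le_suminf[of f "{..<n}"] v by simp
    finally show ?thesis .
  qed
  obtain c' where c': "c = ennreal c'" "0 < c'"
    using le[of 1] assms(1) by (cases c) (auto simp: top_unique)
  obtain n where "v < real n * c'"
    using reals_Archimedean3[OF c'(2)] by blast
  then show False
    using le[of n] v c' by (simp add: ennreal_of_nat_eq_real_of_nat ennreal_mult[symmetric])
qed

lemma decr_rearr_eq_0:
  assumes "\<And>s. 0 < s \<Longrightarrow> m s \<le> ennreal t"
  shows "decr_rearr m t = 0"
proof -
  have "decr_rearr m t \<le> 0"
    by (rule ennreal_le_epsilon) (simp add: decr_rearr_le assms)
  then show ?thesis by simp
qed

text \<open>The assumption on \<open>\<nu>\<close> fits the distribution function of the part of a
  function above \<open>r\<close>. For \<open>t\<close> between \<open>\<mu> (R ^ Suc k * r)\<close>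
  and \<open>\<mu> (R ^ k * r)\<close> the rearrangement is at most \<open>R ^ Suc k * r\<close>,
  and beyond \<open>\<mu> r\<close> it vanishes; the shift by one index produces the factor
  \<open>R\<close> in front.\<close>

lemma nn_integral_decr_rearr_truncated:
  assumes \<mu>: "antimono \<mu>" and \<nu>: "\<And>s. 0 < s \<Longrightarrow> \<nu> s \<le> \<mu> (max s r)" and R: "1 < R" and r: "0 < r" and q: "0 < q"
  shows "(\<integral>\<^sup>+t. ennreal_powr (decr_rearr \<nu> t) q \<partial>half_line)
    \<le> ennreal ((R * r) powr q) * (\<Sum>k. ennreal ((R powr q) ^ k) * \<mu> (R ^ k * r))"
proof -
  let ?A = "\<lambda>k. initial_segment (\<mu> (R ^ k * r))"
  have coeff: "(R ^ Suc k * r) powr q = (R * r) powr q * (R powr q) ^ k" for k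
    using R r q by (simp add: powr_mult power_powr_swap)
  have "(\<integral>\<^sup>+t. ennreal_powr (decr_rearr \<nu> t) q \<partial>half_line)
      \<le> (\<integral>\<^sup>+t. (\<Sum>k. ennreal ((R ^ Suc k * r) powr q) * indicator (?A k) t) \<partial>half_line)"
  proof (rule nn_integral_mono)
    fix t assume "t \<in> space half_line"
    then have t: "0 \<le> t" by simp
    let ?S = "\<Sum>k. ennreal ((R ^ Suc k * r) powr q) * indicator (?A k) t"
    have le_S: "ennreal ((R ^ Suc k * r) powr q) * indicator (?A k) t \<le> ?S" for k
      by (rule term_le_suminf)
    show "ennreal_powr (decr_rearr \<nu> t) q \<le> ?S"
    proof (cases "\<exists>k. \<mu> (R ^ k * r) \<le> ennreal t")
      case True
      define k where "k = (LEAST k. \<mu> (R ^ k * r) \<le> ennreal t)"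
      have k: "\<mu> (R ^ k * r) \<le> ennreal t"
        unfolding k_def using True by (rule LeastI_ex)
      show ?thesis
      proof (cases k)
        case 0
        have "\<nu> s \<le> ennreal t" if "0 < s" for s
        proof -
          have "\<nu> s \<le> \<mu> (max s r)"
            by (rule \<nu>[OF that])
          also have "\<dots> \<le> \<mu> r"
            by (rule antimonoD[OF \<mu>]) simp
          finally show "\<nu> s \<le> ennreal t"
            using k 0 by simp
        qed
        then have "decr_rearr \<nu> t = 0"
          by (rule decr_rearr_eq_0)
        then show ?thesis
          by (simp add: ennreal_powr_def)
      next
        case (Suc j)
        then have "\<not> \<mu> (R ^ j * r) \<le> ennreal t"
          using not_less_Least[of j "\<lambda>k. \<mu> (R ^ k * r) \<le> ennreal t"] by (simp only: k_def[symmetric] lessI simp_thms)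
        then have j: "t \<in> ?A j"
          using t by (auto simp: mem_initial_segment)
        have "r \<le> R ^ k * r"
          using mult_right_mono[OF one_le_power[of R k], of r] R r by simp
        then have "\<nu> (R ^ k * r) \<le> ennreal t"
          using \<nu>[of "R ^ k * r"] k R r q by (simp add: max_absorb1)
        then have "decr_rearr \<nu> t \<le> ennreal (R ^ Suc j * r)"
          using R r Suc by (intro decr_rearr_le) auto
        then have "ennreal_powr (decr_rearr \<nu> t) q \<le> ennreal ((R ^ Suc j * r) powr q)"
          using ennreal_powr_mono[OF q, of _ "ennreal (R ^ Suc j * r)"] R r by (simp only: ennreal_powr_ennreal mult_nonneg_nonneg zero_le_power)
        then show ?thesis
          using le_S[of j] j by simp
      qed
    next
      case False
      \<comment> \<open>Here \<open>t\<close> lies in every interval and the coefficients stay above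
        the first one, so the bound is infinite.\<close>
      have "?S = top"
      proof (rule suminf_eq_top)
        show "0 < ennreal ((R * r) powr q)"
          using R r by simp
        fix k
        have "R * r \<le> R ^ Suc k * r"
          using mult_right_mono[OF power_increasing[of 1 "Suc k" R], of r] R r by simp
        then have "ennreal ((R * r) powr q) \<le> ennreal ((R ^ Suc k * r) powr q)"
          using R r q by (intro ennreal_leI powr_mono2) auto
        moreover have "t \<in> ?A k"
          using False t by (auto simp: not_le mem_initial_segment)
        ultimately show "ennreal ((R * r) powr q) \<le> ennreal ((R ^ Suc k * r) powr q) * indicator (?A k) t"
          by (simp del: power_Suc)
      qed
      then show ?thesis
        by (simp only: top_greatest)
    qed
  qed
  also have "\<dots> = (\<Sum>k. ennreal ((R ^ Suc k * r) powr q) * \<mu> (R ^ k * r))"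
    by (subst nn_integral_suminf) (measurable, simp only: nn_integral_initial_segment)
  also have "\<dots> = (\<Sum>k. ennreal ((R * r) powr q) * (ennreal ((R powr q) ^ k) * \<mu> (R ^ k * r)))"
    unfolding coeff by (simp add: ennreal_mult mult.assoc)
  finally show ?thesis by simp
qed

text \<open>The operators enter the argument only through their counterparts \<open>N\<close> on nonnegative functions,
  which are defined without integrability assumptions.\<close>

locale weighted_Lq_operator =
  fixes w :: "real \<Rightarrow> real" and q :: real and D :: "(real \<Rightarrow> complex) set"
    and T :: "(real \<Rightarrow> complex) \<Rightarrow> real \<Rightarrow> complex" and N :: "(real \<Rightarrow> ennreal) \<Rightarrow> real \<Rightarrow> ennreal"
  assumes w: "weight w" and q: "1 \<le> q"
    and bounded: "bounded_on_weighted (Lp_fnorm q) w D T"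
    and norm_T: "\<And>F t. F \<in> borel_measurable half_line \<Longrightarrow> (\<And>s. 0 \<le> F s) \<Longrightarrow>
      (\<lambda>s. complex_of_real (F s)) \<in> D \<Longrightarrow> 0 < t \<Longrightarrow>
      ennreal (norm (T (\<lambda>s. complex_of_real (F s)) t)) = N (\<lambda>s. ennreal (F s)) t"
begin

text \<open>If the integral on the right is infinite the claim is trivial. Otherwise the function
  belongs to the weighted \<open>L^q\<close> space, hence to \<open>D\<close>, and
  \<open>norm_T\<close> identifies \<open>N\<close> with \<open>T\<close> on it.\<close>

lemma weak_type:
  obtains C where "0 < C" "\<And>F r. F \<in> borel_measurable half_line \<Longrightarrow> (\<And>s. 0 \<le> F s) \<Longrightarrow> 0 < r \<Longrightarrow>
    weight_above w (N (\<lambda>s. ennreal (F s))) r \<le> ennreal (C / r powr q) *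
      (\<integral>\<^sup>+t. ennreal_powr (weighted_rearr w (\<lambda>s. complex_of_real (F s)) t) q \<partial>half_line)"
proof -
  obtain C0 :: real where sub: "weighted_space (Lp_fnorm q) w \<subseteq> D"
    and C0: "\<And>f. f \<in> weighted_space (Lp_fnorm q) w \<Longrightarrow>
      weighted_norm (Lp_fnorm q) w (T f) \<le> ennreal C0 * weighted_norm (Lp_fnorm q) w f"
    using bounded unfolding bounded_on_weighted_def by blast
  \<comment> \<open>Positivity ensures that the right-hand side is infinite whenever
    \<open>J\<close> is.\<close>
  define c where "c = max C0 1"
  have c: "0 < c" "ennreal C0 \<le> ennreal c"
    by (auto simp: c_def intro: ennreal_leI)
  show thesis
  proof (rule that[of "c powr q"])
    fix F :: "real \<Rightarrow> real" and r :: real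
    assume F: "F \<in> borel_measurable half_line" "\<And>s. 0 \<le> F s" and r: "0 < r"
    define f where "f = (\<lambda>s. complex_of_real (F s))"
    define J where "J = (\<integral>\<^sup>+t. ennreal_powr (weighted_rearr w f t) q \<partial>half_line)"
    have "weight_above w (N (\<lambda>s. ennreal (F s))) r \<le> ennreal (c powr q / r powr q) * J"
    proof (cases "J = \<infinity>")
      case True
      then show ?thesis
        using c r by (simp add: ennreal_mult_top)
    next
      case False
      have norm_f: "weighted_norm (Lp_fnorm q) w f = ennreal_powr J (1 / q)"
        by (simp add: weighted_norm_def Lp_fnorm_def J_def)
      moreover have "f \<in> borel_measurable half_line"
        using F unfolding f_def by measurable
      ultimately have f: "f \<in> weighted_space (Lp_fnorm q) w"
        using False by (simp add: weighted_space_def ennreal_powr_def)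
      have "ennreal (r powr q) * weighted_distr w (T f) r
          \<le> (\<integral>\<^sup>+t. ennreal_powr (weighted_rearr w (T f) t) q \<partial>half_line)"
        unfolding weighted_rearr_eq using q r by (intro chebyshev_decr_rearr weighted_distr_antimono) auto
      also have "\<dots> = ennreal_powr (weighted_norm (Lp_fnorm q) w (T f)) q"
        using q by (simp add: weighted_norm_def Lp_fnorm_def ennreal_powr_inverse)
      also have "\<dots> \<le> ennreal_powr (ennreal c * weighted_norm (Lp_fnorm q) w f) q"
        using q c by (intro ennreal_powr_mono order_trans[OF C0[OF f]] mult_right_mono) auto
      also have "\<dots> = ennreal (c powr q) * J"
        using q c by (simp add: ennreal_powr_cmult norm_f ennreal_powr_inverse)
      finally have "ennreal (1 / r powr q) * (ennreal (r powr q) * weighted_distr w (T f) r)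
          \<le> ennreal (1 / r powr q) * (ennreal (c powr q) * J)"
        by (intro mult_left_mono) auto
      then have "weighted_distr w (T f) r \<le> ennreal (c powr q / r powr q) * J"
        using r by (simp add: mult.assoc[symmetric] ennreal_mult[symmetric])
      moreover have "weight_above w (N (\<lambda>s. ennreal (F s))) r = weighted_distr w (T f) r"
        unfolding weighted_distr_eq[OF less_imp_le[OF r]] weight_above_def
        using norm_T[OF F] sub f by (intro arg_cong[where f = "weight_of w"]) (auto simp: f_def)
      ultimately show ?thesis by simp
    qed
    then show "weight_above w (N (\<lambda>s. ennreal (F s))) r \<le> ennreal (c powr q / r powr q) *
      (\<integral>\<^sup>+t. ennreal_powr (weighted_rearr w (\<lambda>s. complex_of_real (F s)) t) q \<partial>half_line)"
      by (simp add: J_def f_def)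
  qed (use c in simp)
qed

lemma weak_type_truncated:
  assumes "1 < R"
  obtains K where "1 \<le> K" "\<And>F r. F \<in> borel_measurable half_line \<Longrightarrow> (\<And>s. 0 \<le> F s) \<Longrightarrow> 0 < r \<Longrightarrow>
    weight_above w (N (\<lambda>s. ennreal (if r < F s then F s else 0))) r
      \<le> (\<Sum>k. ennreal (K * (R powr q) ^ k) * weighted_distr w (\<lambda>s. complex_of_real (F s)) (R ^ k * r))"
proof -
  obtain C where C: "0 < C" "\<And>F r. F \<in> borel_measurable half_line \<Longrightarrow> (\<And>s. 0 \<le> F s) \<Longrightarrow> 0 < r \<Longrightarrow>
    weight_above w (N (\<lambda>s. ennreal (F s))) r \<le> ennreal (C / r powr q) *
      (\<integral>\<^sup>+t. ennreal_powr (weighted_rearr w (\<lambda>s. complex_of_real (F s)) t) q \<partial>half_line)"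
    using weak_type by blast
  \<comment> \<open>The lower bound 1 prepares the application of
    \<open>norm_decr_rearr_geometric_up\<close>.\<close>
  define K where "K = max 1 (C * R powr q)"
  show thesis
  proof (rule that[of K])
    fix F :: "real \<Rightarrow> real" and r :: real
    assume F[measurable]: "F \<in> borel_measurable half_line" and pos: "\<And>s. 0 \<le> F s" and r: "0 < r"
    let ?F = "\<lambda>s. if r < F s then F s else 0" and ?\<mu> = "weighted_distr w (\<lambda>s. complex_of_real (F s))"
    have "weight_above w (N (\<lambda>s. ennreal (?F s))) r \<le> ennreal (C / r powr q) *
      (\<integral>\<^sup>+t. ennreal_powr (weighted_rearr w (\<lambda>s. complex_of_real (?F s)) t) q \<partial>half_line)"
      using pos r by (intro C) auto
    also have "\<dots> \<le> ennreal (C / r powr q) *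
      (ennreal ((R * r) powr q) * (\<Sum>k. ennreal ((R powr q) ^ k) * ?\<mu> (R ^ k * r)))"
      unfolding weighted_rearr_eq using assms r q pos
      by (intro mult_left_mono nn_integral_decr_rearr_truncated weighted_distr_antimono)
        (auto simp: weighted_distr_def intro!: weight_of_mono split: if_splits)
    also have "\<dots> = ennreal (C * R powr q) * (\<Sum>k. ennreal ((R powr q) ^ k) * ?\<mu> (R ^ k * r))"
      using r assms C(1) by (simp add: mult.assoc[symmetric] ennreal_mult[symmetric] powr_mult)
    also have "\<dots> = (\<Sum>k. ennreal (C * R powr q) * (ennreal ((R powr q) ^ k) * ?\<mu> (R ^ k * r)))"
      by simp
    also have "\<dots> \<le> (\<Sum>k. ennreal (K * (R powr q) ^ k) * ?\<mu> (R ^ k * r))"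
    proof (intro suminf_le)
      fix k
      have "ennreal (C * R powr q) * ennreal ((R powr q) ^ k) \<le> ennreal (K * (R powr q) ^ k)"
        using C(1) by (subst ennreal_mult[symmetric]) (auto simp: K_def intro!: ennreal_leI mult_right_mono)
      then show "ennreal (C * R powr q) * (ennreal ((R powr q) ^ k) * ?\<mu> (R ^ k * r))
          \<le> ennreal (K * (R powr q) ^ k) * ?\<mu> (R ^ k * r)"
        unfolding mult.assoc[symmetric] by (intro mult_right_mono) auto
    qed auto
    finally show "weight_above w (N (\<lambda>s. ennreal (?F s))) r
      \<le> (\<Sum>k. ennreal (K * (R powr q) ^ k) * ?\<mu> (R ^ k * r))" .
  qed (simp add: K_def)
qed

text \<open>The rearrangement of an indicator is at most 1 and vanishes from
  \<open>weight_of w E\<close> on, so the integral of its q-th power is at most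
  \<open>weight_of w E\<close>, whatever \<open>q\<close> is.\<close>

lemma weak_type_indicator:
  obtains C where "0 < C" "\<And>E r. E \<in> sets half_line \<Longrightarrow> 0 < r \<Longrightarrow>
    weight_above w (N (indicator E)) r \<le> ennreal (C / r powr q) * weight_of w E"
proof -
  obtain C where C: "0 < C" "\<And>F r. F \<in> borel_measurable half_line \<Longrightarrow> (\<And>s. 0 \<le> F s) \<Longrightarrow> 0 < r \<Longrightarrow>
    weight_above w (N (\<lambda>s. ennreal (F s))) r \<le> ennreal (C / r powr q) *
      (\<integral>\<^sup>+t. ennreal_powr (weighted_rearr w (\<lambda>s. complex_of_real (F s)) t) q \<partial>half_line)"
    using weak_type by blast
  show thesis
  proof (rule that[OF C(1)])
    fix E r assume E: "E \<in> sets half_line" and r: "0 < (r::real)"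
    let ?A = "initial_segment (weight_of w E)"
    let ?\<nu> = "weighted_distr w (\<lambda>s. complex_of_real (indicator E s))"
    have "(\<integral>\<^sup>+t. ennreal_powr (decr_rearr ?\<nu> t) q \<partial>half_line) \<le> (\<integral>\<^sup>+t. indicator ?A t \<partial>half_line)"
    proof (rule nn_integral_mono)
      fix t :: real assume "t \<in> space half_line"
      then have t: "0 \<le> t" by simp
      have \<nu>_le: "?\<nu> s \<le> weight_of w E" if "0 < s" for s
        unfolding weighted_distr_def using that by (intro weight_of_mono) (auto split: split_indicator_asm)
      have "{t \<in> {0..}. 1 < norm (complex_of_real (indicator E t))} = {}"
        by (auto split: split_indicator_asm)
      then have \<nu>_1: "?\<nu> 1 = 0"
        unfolding weighted_distr_def by (simp add: weight_of_def)
      show "ennreal_powr (decr_rearr ?\<nu> t) q \<le> indicator ?A t"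
      proof (cases "t \<in> ?A")
        case True
        have "ennreal_powr (decr_rearr ?\<nu> t) q \<le> ennreal_powr (ennreal 1) q"
          using q \<nu>_1 by (intro ennreal_powr_mono decr_rearr_le) auto
        then show ?thesis
          using True by (simp add: ennreal_powr_def)
      next
        case False
        then have "decr_rearr ?\<nu> t = 0"
          using t by (intro decr_rearr_eq_0 order_trans[OF \<nu>_le]) (auto simp: mem_initial_segment not_less)
        then show ?thesis
          by (simp add: ennreal_powr_def)
      qed
    qed
    also have "\<dots> = weight_of w E"
      using nn_integral_initial_segment[of 1] by simp
    finally have "ennreal (C / r powr q) * (\<integral>\<^sup>+t. ennreal_powr (decr_rearr ?\<nu> t) q \<partial>half_line)
        \<le> ennreal (C / r powr q) * weight_of w E"
      by (rule mult_left_mono) simp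
    with C(2)[of "indicator E" r] E r
    show "weight_above w (N (indicator E)) r \<le> ennreal (C / r powr q) * weight_of w E"
      by (simp add: weighted_rearr_eq ennreal_indicator)
  qed
qed

end


section \<open>The Hardy operators on nonnegative functions\<close>

definition hardy_P_nn :: "(real \<Rightarrow> ennreal) \<Rightarrow> real \<Rightarrow> ennreal" where
  "hardy_P_nn F t = ennreal (1 / t) * (\<integral>\<^sup>+s\<in>{0..t}. F s \<partial>half_line)"

definition hardy_Q_nn :: "(real \<Rightarrow> ennreal) \<Rightarrow> real \<Rightarrow> ennreal" where
  "hardy_Q_nn F t = (\<integral>\<^sup>+s\<in>{t<..}. ennreal (1 / s) * F s \<partial>half_line)"

lemma nn_integral_half_line_subset:
  assumes "A \<subseteq> {0..}"
  shows "(\<integral>\<^sup>+s\<in>A. g s \<partial>half_line) = (\<integral>\<^sup>+s. g s * indicator A s \<partial>lebesgue)"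
  using assms by (subst nn_integral_restrict_space) (auto intro!: nn_integral_cong split: split_indicator)

lemma indicator_half_line_measurable:
  fixes f :: "real \<Rightarrow> complex"
  assumes "f \<in> borel_measurable half_line" "A \<subseteq> {0..}" "A \<in> sets lebesgue"
  shows "(\<lambda>s. indicator A s *\<^sub>R f s) \<in> borel_measurable lebesgue"
proof -
  have "(\<lambda>s. indicator {0..} s *\<^sub>R f s) \<in> borel_measurable lebesgue"
    using assms(1) by (subst (asm) borel_measurable_restrict_space_iff) auto
  then have "(\<lambda>s. indicator A s *\<^sub>R (indicator {0..} s *\<^sub>R f s)) \<in> borel_measurable lebesgue"
    by (rule borel_measurable_scaleR[OF borel_measurable_indicator[OF assms(3)]])
  also have "(\<lambda>s. indicator A s *\<^sub>R (indicator {0..} s *\<^sub>R f s)) = (\<lambda>s. indicator A s *\<^sub>R f s)"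
    using assms(2) by (auto simp: fun_eq_iff split: split_indicator)
  finally show ?thesis .
qed

lemma nn_integral_norm_half_line:
  fixes f :: "real \<Rightarrow> complex"
  assumes "A \<subseteq> {0..}"
  shows "(\<integral>\<^sup>+s\<in>A. ennreal (norm (f s)) \<partial>half_line) = (\<integral>\<^sup>+s. ennreal (norm (indicator A s *\<^sub>R f s)) \<partial>lebesgue)"
  unfolding nn_integral_half_line_subset[OF assms]
  by (intro nn_integral_cong) (auto split: split_indicator)

text \<open>The Bochner integral of a non-integrable function is 0, so the bound covers every
  \<open>f\<close>.\<close>

lemma norm_set_integral_le:
  fixes f :: "real \<Rightarrow> complex"
  assumes "A \<subseteq> {0..}"
  shows "ennreal (norm (LINT s:A|lebesgue. f s)) \<le> (\<integral>\<^sup>+s\<in>A. ennreal (norm (f s)) \<partial>half_line)"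
  unfolding nn_integral_norm_half_line[OF assms] set_lebesgue_integral_def
proof (cases "integrable lebesgue (\<lambda>s. indicator A s *\<^sub>R f s)")
  case True
  then show "ennreal (norm (LINT s|lebesgue. indicator A s *\<^sub>R f s)) \<le> (\<integral>\<^sup>+s. ennreal (norm (indicator A s *\<^sub>R f s)) \<partial>lebesgue)"
    by (rule integral_norm_bound_ennreal)
qed (simp add: not_integrable_integral_eq)

lemma set_integrable_half_lineI:
  fixes f :: "real \<Rightarrow> complex"
  assumes "f \<in> borel_measurable half_line" "A \<subseteq> {0..}" "A \<in> sets lebesgue"
    and "(\<integral>\<^sup>+s\<in>A. ennreal (norm (f s)) \<partial>half_line) < \<infinity>"
  shows "set_integrable lebesgue A f"
  unfolding set_integrable_def using assms
  by (intro integrableI_bounded indicator_half_line_measurable)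
    (auto simp: nn_integral_norm_half_line)

lemma norm_set_integral_nonneg:
  fixes G :: "real \<Rightarrow> real"
  assumes "A \<subseteq> {0..}" and G: "\<And>s. s \<in> A \<Longrightarrow> 0 \<le> G s"
    and int: "set_integrable lebesgue A (\<lambda>s. complex_of_real (G s))"
  shows "ennreal (norm (LINT s:A|lebesgue. complex_of_real (G s))) = (\<integral>\<^sup>+s\<in>A. ennreal (G s) \<partial>half_line)"
proof -
  have "integrable lebesgue (\<lambda>s. complex_of_real (indicator A s * G s))"
    using int unfolding set_integrable_def by (simp add: scaleR_conv_of_real)
  then have "integrable lebesgue (\<lambda>s. indicator A s * G s)"
    using complex_of_real_integrable_eq by blast
  moreover have nonneg: "0 \<le> indicator A s * G s" for s
    using G[of s] by (auto split: split_indicator)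
  ultimately have eq: "(\<integral>\<^sup>+s. ennreal (indicator A s * G s) \<partial>lebesgue) = ennreal (LINT s|lebesgue. indicator A s * G s)"
    by (intro nn_integral_eq_integral) auto
  have "norm (LINT s:A|lebesgue. complex_of_real (G s)) = (LINT s|lebesgue. indicator A s * G s)"
    using nonneg unfolding set_integral_complex_of_real
    by (simp add: set_lebesgue_integral_def integral_nonneg_AE)
  then have "ennreal (norm (LINT s:A|lebesgue. complex_of_real (G s))) = (\<integral>\<^sup>+s. ennreal (indicator A s * G s) \<partial>lebesgue)"
    by (simp only: eq)
  also have "\<dots> = (\<integral>\<^sup>+s\<in>A. ennreal (G s) \<partial>half_line)"
    unfolding nn_integral_half_line_subset[OF assms(1)]
    by (intro nn_integral_cong) (auto split: split_indicator)
  finally show ?thesis .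
qed

lemma norm_hardy_P_le:
  assumes "0 \<le> t"
  shows "ennreal (norm (hardy_P f t)) \<le> hardy_P_nn (\<lambda>s. ennreal (norm (f s))) t"
proof -
  have "ennreal (norm (hardy_P f t)) = ennreal (1 / t) * ennreal (norm (LINT s:{0..t}|lebesgue. f s))"
    using assms by (simp add: hardy_P_def ennreal_mult[symmetric])
  also have "\<dots> \<le> hardy_P_nn (\<lambda>s. ennreal (norm (f s))) t"
    unfolding hardy_P_nn_def by (intro mult_left_mono norm_set_integral_le) auto
  finally show ?thesis .
qed

lemma norm_hardy_Q_le:
  assumes "0 \<le> t"
  shows "ennreal (norm (hardy_Q f t)) \<le> hardy_Q_nn (\<lambda>s. ennreal (norm (f s))) t"
proof -
  have "ennreal (norm (hardy_Q f t)) \<le> (\<integral>\<^sup>+s\<in>{t<..}. ennreal (norm ((1 / s) *\<^sub>R f s)) \<partial>half_line)"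
    unfolding hardy_Q_def using assms by (intro norm_set_integral_le) auto
  also have "\<dots> = hardy_Q_nn (\<lambda>s. ennreal (norm (f s))) t"
    unfolding hardy_Q_nn_def using assms
    by (intro nn_integral_cong) (auto split: split_indicator simp: ennreal_mult[symmetric])
  finally show ?thesis .
qed

lemma norm_hardy_P_of_real:
  assumes "\<And>s. 0 \<le> F s" and D: "(\<lambda>s. complex_of_real (F s)) \<in> dom_P" and t: "0 < t"
  shows "ennreal (norm (hardy_P (\<lambda>s. complex_of_real (F s)) t)) = hardy_P_nn (\<lambda>s. ennreal (F s)) t"
proof -
  have "(\<lambda>s. complex_of_real (F s)) absolutely_integrable_on {0..t}"
    using D by (auto simp: dom_P_def)
  then have "ennreal (norm (LINT s:{0..t}|lebesgue. complex_of_real (F s))) = (\<integral>\<^sup>+s\<in>{0..t}. ennreal (F s) \<partial>half_line)"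
    using assms by (intro norm_set_integral_nonneg) auto
  moreover have "ennreal (norm (hardy_P (\<lambda>s. complex_of_real (F s)) t))
      = ennreal (1 / t) * ennreal (norm (LINT s:{0..t}|lebesgue. complex_of_real (F s)))"
    using t by (simp add: hardy_P_def ennreal_mult[symmetric])
  ultimately show ?thesis
    by (simp only: hardy_P_nn_def)
qed

lemma norm_hardy_Q_of_real:
  assumes F: "\<And>s. 0 \<le> F s" and D: "(\<lambda>s. complex_of_real (F s)) \<in> dom_Q" and t: "0 < t"
  shows "ennreal (norm (hardy_Q (\<lambda>s. complex_of_real (F s)) t)) = hardy_Q_nn (\<lambda>s. ennreal (F s)) t"
proof -
  have eq: "(1 / s) *\<^sub>R complex_of_real (F s) = complex_of_real (F s / s)" for s
    by (simp add: scaleR_conv_of_real)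
  have "(\<lambda>s. complex_of_real (F s / s)) absolutely_integrable_on {t<..}"
    using D t unfolding eq[symmetric] by (auto simp: dom_Q_def)
  then have "ennreal (norm (LINT s:{t<..}|lebesgue. complex_of_real (F s / s))) = (\<integral>\<^sup>+s\<in>{t<..}. ennreal (F s / s) \<partial>half_line)"
    using assms by (intro norm_set_integral_nonneg) auto
  also have "\<dots> = hardy_Q_nn (\<lambda>s. ennreal (F s)) t"
    unfolding hardy_Q_nn_def using t F
    by (intro nn_integral_cong) (auto split: split_indicator simp: ennreal_mult[symmetric])
  finally show ?thesis
    unfolding hardy_Q_def eq .
qed

text \<open>Measurability in the parameter is a product measure argument and needs Borel integrands,
  while \<open>f\<close> is only Lebesgue measurable. Replacing its real and imaginary parts by
  Borel functions equal almost everywhere leaves all the integrals unchanged.\<close>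

lemma borel_measurable_set_integral_parametric:
  fixes f :: "real \<Rightarrow> complex" and A :: "real \<Rightarrow> real set"
  assumes f: "f \<in> borel_measurable lebesgue" and A[measurable]: "Measurable.pred (borel \<Otimes>\<^sub>M borel) (\<lambda>(t, s). s \<in> A t)"
  shows "(\<lambda>t. LINT s:A t|lebesgue. f s) \<in> borel_measurable borel"
proof -
  obtain u where u[measurable]: "u \<in> borel_measurable lborel" "AE s in lborel. Re (f s) = u s"
    using completion_ex_borel_measurable_real[of "\<lambda>s. Re (f s)" lborel] f by auto
  obtain v where v[measurable]: "v \<in> borel_measurable lborel" "AE s in lborel. Im (f s) = v s"
    using completion_ex_borel_measurable_real[of "\<lambda>s. Im (f s)" lborel] f by auto
  define g where "g s = Complex (u s) (v s)" for s
  have g_eq: "g = (\<lambda>s. complex_of_real (u s) + \<i> * complex_of_real (v s))"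
    by (auto simp: g_def fun_eq_iff complex_eq_iff)
  have g[measurable]: "g \<in> borel_measurable borel"
    unfolding g_eq using u(1) v(1) by measurable
  have "AE s in lborel. f s = g s"
    using u(2) v(2) by eventually_elim (auto simp: g_def complex_eq_iff)
  then have fg: "AE s in lebesgue. f s = g s"
    by (rule AE_completion)
  have sA: "A t \<in> sets borel" for t
  proof -
    have "Measurable.pred borel (\<lambda>s. case (t, s) of (t, s) \<Rightarrow> s \<in> A t)"
      by (rule measurable_compose[OF _ A]) measurable
    then show ?thesis
      by (simp add: pred_def)
  qed
  have "(LINT s:A t|lebesgue. f s) = (LINT s|lborel. indicator (A t) s *\<^sub>R g s)" for t
  proof -
    have [measurable]: "A t \<in> sets borel" by (rule sA)
    have "(LINT s:A t|lebesgue. f s) = (LINT s|lebesgue. indicator (A t) s *\<^sub>R g s)"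
      unfolding set_lebesgue_integral_def
    proof (rule integral_cong_AE)
      show "(\<lambda>s. indicator (A t) s *\<^sub>R f s) \<in> borel_measurable lebesgue"
        using sA[of t] by (intro borel_measurable_scaleR[OF borel_measurable_indicator f]) auto
      show "(\<lambda>s. indicator (A t) s *\<^sub>R g s) \<in> borel_measurable lebesgue"
        by (intro measurable_completion) measurable
      show "AE s in lebesgue. indicator (A t) s *\<^sub>R f s = indicator (A t) s *\<^sub>R g s"
        using fg by eventually_elim simp
    qed
    also have "\<dots> = (LINT s|lborel. indicator (A t) s *\<^sub>R g s)"
      by (intro integral_completion) measurable
    finally show ?thesis .
  qed
  moreover have "(\<lambda>t. LINT s|lborel. indicator (A t) s *\<^sub>R g s) \<in> borel_measurable borel"
  proof (rule lborel.borel_measurable_lebesgue_integral)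
    have "(\<lambda>(t, s). (if s \<in> A t then g s else 0)) \<in> borel_measurable (borel \<Otimes>\<^sub>M lborel)"
      using A by (simp add: case_prod_beta' cong: measurable_cong_sets) measurable
    also have "(\<lambda>(t, s). (if s \<in> A t then g s else 0)) = (\<lambda>(t, s). indicator (A t) s *\<^sub>R g s)"
      by (auto simp: fun_eq_iff indicator_def)
    finally show "(\<lambda>(t, s). indicator (A t) s *\<^sub>R g s) \<in> borel_measurable (borel \<Otimes>\<^sub>M lborel)" .
  qed
  ultimately show ?thesis by simp
qed

lemma hardy_P_measurable:
  assumes "f \<in> borel_measurable half_line"
  shows "hardy_P f \<in> borel_measurable half_line"
proof -
  let ?g = "\<lambda>s. indicator {0..} s *\<^sub>R f s"
  have "(\<lambda>t. LINT s:{0..t}|lebesgue. ?g s) \<in> borel_measurable borel"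
    using assms by (intro borel_measurable_set_integral_parametric indicator_half_line_measurable) auto
  then have "(\<lambda>t. (1 / t) *\<^sub>R (LINT s:{0..t}|lebesgue. ?g s)) \<in> borel_measurable half_line"
    by (intro borel_measurable_half_lineI borel_measurable_scaleR) auto
  also have "(\<lambda>t. (1 / t) *\<^sub>R (LINT s:{0..t}|lebesgue. ?g s)) = hardy_P f"
    unfolding hardy_P_def
    by (intro ext arg_cong2[where f = "(*\<^sub>R)"] refl set_lebesgue_integral_cong) auto
  finally show ?thesis .
qed

lemma hardy_Q_measurable:
  assumes "f \<in> borel_measurable half_line"
  shows "hardy_Q f \<in> borel_measurable half_line"
proof -
  let ?g = "\<lambda>s. (1 / s) *\<^sub>R (indicator {0..} s *\<^sub>R f s)"
  have "?g \<in> borel_measurable lebesgue"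
    using assms by (intro borel_measurable_scaleR indicator_half_line_measurable measurable_completion) auto
  then have "(\<lambda>t. LINT s:{t<..}|lebesgue. ?g s) \<in> borel_measurable borel"
    by (intro borel_measurable_set_integral_parametric) auto
  then have "(\<lambda>t. LINT s:{t<..}|lebesgue. ?g s) \<in> borel_measurable half_line"
    by (rule borel_measurable_half_lineI)
  then show ?thesis
    by (rule measurable_cong[THEN iffD1, rotated])
      (auto simp: hardy_Q_def intro!: set_lebesgue_integral_cong)
qed

section \<open>Monotonicity and level sets of \<open>hardy_Q_nn\<close>\<close>

lemma hardy_Q_nn_antimono: "s \<le> t \<Longrightarrow> hardy_Q_nn F t \<le> hardy_Q_nn F s"
  unfolding hardy_Q_nn_def by (intro nn_integral_mono) (auto split: split_indicator)

lemma sets_level_hardy_Q_nn: "{t \<in> {0<..}. c < hardy_Q_nn F t} \<in> sets half_line"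
proof -
  have "{t. c < hardy_Q_nn F t} \<in> sets borel"
    by (rule down_closed_borel) (auto intro: less_le_trans hardy_Q_nn_antimono)
  then have "{0<..} \<inter> {t. c < hardy_Q_nn F t} \<in> sets borel"
    by auto
  then show ?thesis
    by (subst sets_restrict_space_iff) (auto simp: Int_def)
qed

lemma inverse_measurable_half_line [measurable]: "(\<lambda>s. ennreal (1 / s)) \<in> borel_measurable half_line"
  by (intro borel_measurable_half_lineI) measurable

lemma sets_greaterThan_half_line: "0 \<le> a \<Longrightarrow> {a<..} \<in> sets half_line"
  by (subst sets_restrict_space_iff) auto

text \<open>Monotone convergence along \<open>a + 1 / Suc i\<close>. The case \<open>a = 0\<close>
  is included because the end point of a level set may be 0.\<close>

lemma hardy_Q_nn_right_continuous:
  assumes F[measurable]: "F \<in> borel_measurable half_line" and "0 \<le> a"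
    and le: "\<And>s. a < s \<Longrightarrow> hardy_Q_nn F s \<le> c"
  shows "hardy_Q_nn F a \<le> c"
proof -
  let ?g = "\<lambda>i s. ennreal (1 / s) * F s * indicator {a + 1 / real (Suc i)<..} s"
  have [measurable]: "{a + 1 / real (Suc i)<..} \<in> sets half_line" for i
    using \<open>0 \<le> a\<close> by (intro sets_greaterThan_half_line) auto
  have "incseq ?g"
  proof (intro monoI le_funI mult_left_mono)
    fix i j :: nat and s assume "i \<le> j"
    then have "a + 1 / real (Suc j) \<le> a + 1 / real (Suc i)"
      by (intro add_left_mono divide_left_mono) auto
    then show "indicator {a + 1 / real (Suc i)<..} s \<le> (indicator {a + 1 / real (Suc j)<..} s :: ennreal)"
      by (auto split: split_indicator)
  qed simp
  have "hardy_Q_nn F a \<le> (\<integral>\<^sup>+s. (SUP i. ?g i s) \<partial>half_line)"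
    unfolding hardy_Q_nn_def
  proof (rule nn_integral_mono)
    fix s
    show "ennreal (1 / s) * F s * indicator {a<..} s \<le> (SUP i. ?g i s)"
    proof (cases "a < s")
      case True
      then obtain i where "1 / real (Suc i) < s - a"
        using nat_approx_posE[of "s - a"] by auto
      then have "ennreal (1 / s) * F s * indicator {a<..} s = ?g i s"
        using True by (auto split: split_indicator)
      also have "\<dots> \<le> (SUP i. ?g i s)"
        by (rule SUP_upper) simp
      finally show ?thesis .
    qed simp
  qed
  also have "\<dots> = (SUP i. hardy_Q_nn F (a + 1 / real (Suc i)))"
    unfolding hardy_Q_nn_def by (intro nn_integral_monotone_convergence_SUP \<open>incseq ?g\<close>) measurable
  also have "\<dots> \<le> c"
    by (intro SUP_least le) auto
  finally show ?thesis .
qed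

text \<open>The part of \<open>F\<close> outside the level set contributes at most the level: \<open>hardy_Q_nn F\<close> is
  nonincreasing and right continuous, so it does not exceed \<open>c\<close> at the end point of its level set.\<close>

lemma hardy_Q_nn_outside_level_set:
  assumes F[measurable]: "F \<in> borel_measurable half_line" and t: "0 < t"
  shows "hardy_Q_nn F t \<le> hardy_Q_nn (\<lambda>s. F s * indicator {u \<in> {0<..}. c < hardy_Q_nn F u} s) t + c"
proof -
  define S where "S = {u \<in> {0<..}. c < hardy_Q_nn F u}"
  have mem_S: "u \<in> S \<longleftrightarrow> 0 < u \<and> c < hardy_Q_nn F u" for u
    by (simp add: S_def)
  have [measurable]: "S \<in> sets half_line"
    unfolding S_def by (rule sets_level_hardy_Q_nn)
  have "hardy_Q_nn F t = (\<integral>\<^sup>+s. ennreal (1 / s) * (F s * indicator S s) * indicator {t<..} s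
      + ennreal (1 / s) * (F s * indicator (- S) s) * indicator {t<..} s \<partial>half_line)"
    unfolding hardy_Q_nn_def by (intro nn_integral_cong) (auto split: split_indicator)
  also have "\<dots> = hardy_Q_nn (\<lambda>s. F s * indicator S s) t + (\<integral>\<^sup>+s\<in>{t<..}. ennreal (1 / s) * (F s * indicator (- S) s) \<partial>half_line)"
  proof -
    have [measurable]: "{t<..} \<in> sets half_line"
      using t by (intro sets_greaterThan_half_line) simp
    have "(\<lambda>s. indicator (- S) s :: ennreal) \<in> borel_measurable half_line"
    proof -
      have "(\<lambda>s. 1 - indicator S s :: ennreal) \<in> borel_measurable half_line"
        by measurable
      also have "(\<lambda>s. 1 - indicator S s :: ennreal) = (\<lambda>s. indicator (- S) s)"
        by (auto simp: fun_eq_iff split: split_indicator)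
      finally show ?thesis .
    qed
    then show ?thesis
      unfolding hardy_Q_nn_def by (intro nn_integral_add) measurable
  qed
  also have "(\<integral>\<^sup>+s\<in>{t<..}. ennreal (1 / s) * (F s * indicator (- S) s) \<partial>half_line) \<le> c"
  proof (cases "{u. 0 < u \<and> hardy_Q_nn F u \<le> c} = {}")
    case True
    \<comment> \<open>The level set is all of \<open>{0<..}\<close>, so nothing is left outside
      it.\<close>
    then have "(\<integral>\<^sup>+s\<in>{t<..}. ennreal (1 / s) * (F s * indicator (- S) s) \<partial>half_line) = (\<integral>\<^sup>+s. 0 \<partial>half_line)"
      using t by (intro nn_integral_cong) (auto split: split_indicator simp: not_le mem_S)
    then show ?thesis by simp
  next
    case False
    define a where "a = Inf {u. 0 < u \<and> hardy_Q_nn F u \<le> c}"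
    have bdd: "bdd_below {u. 0 < u \<and> hardy_Q_nn F u \<le> c}"
      by (intro bdd_belowI[of _ 0]) auto
    have "0 \<le> a"
      unfolding a_def using False by (intro cInf_greatest) auto
    have "hardy_Q_nn F s \<le> c" if s: "a < s" for s
    proof -
      obtain u where "u < s" "hardy_Q_nn F u \<le> c"
        using cInf_lessD[OF False s[unfolded a_def]] by blast
      then show ?thesis
        using hardy_Q_nn_antimono[of u s F] by simp
    qed
    then have a_le: "hardy_Q_nn F a \<le> c"
      using hardy_Q_nn_right_continuous[OF F \<open>0 \<le> a\<close>] by blast
    have "(\<integral>\<^sup>+s\<in>{t<..}. ennreal (1 / s) * (F s * indicator (- S) s) \<partial>half_line) \<le> hardy_Q_nn F a"
      unfolding hardy_Q_nn_def
    proof (rule nn_integral_mono_AE)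
      show "AE s in half_line. ennreal (1 / s) * (F s * indicator (- S) s) * indicator {t<..} s
          \<le> ennreal (1 / s) * F s * indicator {a<..} s"
        using AE_half_line_neq[of a]
      proof eventually_elim
        case (elim s)
        \<comment> \<open>Positive points outside the level set lie at or beyond \<open>a\<close>,
          and the point \<open>a\<close> itself was discarded as a null set.\<close>
        have "a \<le> s" if "0 < s" "hardy_Q_nn F s \<le> c"
          unfolding a_def using that bdd by (intro cInf_lower) auto
        then show ?case
          using elim t by (auto split: split_indicator simp: not_less mem_S)
      qed
    qed
    also note a_le
    finally show ?thesis .
  qed
  finally show ?thesis by (simp add: add_left_mono S_def)
qed


section \<open>Distributional estimates for the Hardy operators\<close>

lemma hardy_P_operator:
  "1 \<le> q \<Longrightarrow> w \<in> Mq_lower q \<Longrightarrow> weighted_Lq_operator w q dom_P hardy_P hardy_P_nn"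
  by unfold_locales (auto simp: Mq_lower_def P_weights_def norm_hardy_P_of_real)

lemma hardy_Q_operator:
  "1 \<le> q \<Longrightarrow> w \<in> Mq_upper q \<Longrightarrow> weighted_Lq_operator w q dom_Q hardy_Q hardy_Q_nn"
  by unfold_locales (auto simp: Mq_upper_def Q_weights_def norm_hardy_Q_of_real)

text \<open>The part of \<open>F\<close> up to height \<open>r\<close> has averages at most
  \<open>r\<close>, so an average above \<open>2 * r\<close> owes more than \<open>r\<close> to the
  rest.\<close>

lemma weight_above_hardy_P_le:
  assumes F[measurable]: "F \<in> borel_measurable half_line" and nonneg: "\<And>s. 0 \<le> F s" and r: "0 < r"
  shows "weight_above w (hardy_P_nn (\<lambda>s. ennreal (F s))) (2 * r)
    \<le> weight_above w (hardy_P_nn (\<lambda>s. ennreal (if r < F s then F s else 0))) r"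
proof (rule weight_above_mono)
  fix t :: real assume t: "0 < t" and less: "ennreal (2 * r) < hardy_P_nn (\<lambda>s. ennreal (F s)) t"
  let ?G = "\<lambda>s. ennreal (if r < F s then F s else 0)"
  have [measurable]: "{0..t} \<in> sets half_line"
    by (subst sets_restrict_space_iff) auto
  have "(\<integral>\<^sup>+s\<in>{0..t}. ennreal (F s) \<partial>half_line)
      \<le> (\<integral>\<^sup>+s. ?G s * indicator {0..t} s + ennreal r * indicator {0..t} s \<partial>half_line)"
    using r by (intro nn_integral_mono) (auto split: split_indicator intro: ennreal_leI)
  also have "\<dots> = (\<integral>\<^sup>+s\<in>{0..t}. ?G s \<partial>half_line) + ennreal r * emeasure half_line {0..t}"
    by (subst nn_integral_add) (measurable, simp add: nn_integral_cmult_indicator)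
  also have "emeasure half_line {0..t} = ennreal t"
    using t by (subst emeasure_half_line) auto
  finally have "hardy_P_nn (\<lambda>s. ennreal (F s)) t \<le> ennreal (1 / t) * ((\<integral>\<^sup>+s\<in>{0..t}. ?G s \<partial>half_line) + ennreal r * ennreal t)"
    unfolding hardy_P_nn_def by (intro mult_left_mono) auto
  also have "\<dots> = hardy_P_nn ?G t + ennreal (1 / t) * (ennreal r * ennreal t)"
    by (simp add: hardy_P_nn_def distrib_left)
  also have "ennreal (1 / t) * (ennreal r * ennreal t) = ennreal r"
    using t r by (simp add: ennreal_mult[symmetric])
  finally have le: "hardy_P_nn (\<lambda>s. ennreal (F s)) t \<le> hardy_P_nn ?G t + ennreal r" .
  show "ennreal r < hardy_P_nn ?G t"
  proof (rule ccontr)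
    assume "\<not> ennreal r < hardy_P_nn ?G t"
    then have "hardy_P_nn (\<lambda>s. ennreal (F s)) t \<le> ennreal r + ennreal r"
      by (intro order_trans[OF le] add_right_mono) simp
    also have "\<dots> = ennreal (2 * r)"
      using r by (simp add: ennreal_plus[symmetric] del: ennreal_plus)
    finally show False
      using less by simp
  qed
qed

text \<open>Above the level \<open>n \<sigma>\<close>, only the part of \<open>E\<close> inside the level set matters, so every further
  step of height \<open>\<sigma>\<close> costs a factor \<open>\<delta>\<close> by the weak type estimate.\<close>

lemma hardy_Q_decay:
  assumes op: "weighted_Lq_operator w q D T hardy_Q_nn" and \<delta>: "0 < \<delta>"
  obtains \<sigma> where "0 < \<sigma>" "\<And>E n. E \<in> sets half_line \<Longrightarrow>
    weight_above w (hardy_Q_nn (indicator E)) (real (Suc n) * \<sigma>) \<le> ennreal (\<delta> ^ Suc n) * weight_of w E"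
proof -
  interpret weighted_Lq_operator w q D T hardy_Q_nn by (rule op)
  obtain C where C: "0 < C" "\<And>E r. E \<in> sets half_line \<Longrightarrow> 0 < r \<Longrightarrow>
    weight_above w (hardy_Q_nn (indicator E)) r \<le> ennreal (C / r powr q) * weight_of w E"
    using weak_type_indicator by blast
  \<comment> \<open>The solution of \<open>C / \<sigma> powr q = \<delta>\<close>.\<close>
  define \<sigma> where "\<sigma> = (C / \<delta>) powr (1 / q)"
  have \<sigma>: "0 < \<sigma>" "C / \<sigma> powr q = \<delta>"
    using C(1) \<delta> q by (auto simp: \<sigma>_def powr_powr)
  have base: "weight_above w (hardy_Q_nn (indicator E)) \<sigma> \<le> ennreal \<delta> * weight_of w E"
    if "E \<in> sets half_line" for E
    using C(2)[OF that \<sigma>(1)] by (simp add: \<sigma>(2))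
  show thesis
  proof (rule that[OF \<sigma>(1)])
    fix E n assume E: "E \<in> sets half_line"
    then have [measurable]: "(indicator E :: real \<Rightarrow> ennreal) \<in> borel_measurable half_line"
      by auto
    show "weight_above w (hardy_Q_nn (indicator E)) (real (Suc n) * \<sigma>) \<le> ennreal (\<delta> ^ Suc n) * weight_of w E"
    \<comment> \<open>The induction starts at height \<open>\<sigma>\<close>. At height 0 with
      factor 1 the estimate fails in general, as \<open>hardy_Q_nn (indicator E)\<close> is positive
      wherever a part of \<open>E\<close> of positive measure lies to the right.\<close>
    proof (induction n)
      case 0
      then show ?case using base[OF E] by simp
    next
      case (Suc n)
      define c where "c = real (Suc n) * \<sigma>"
      define S where "S = {u \<in> {0<..}. ennreal c < hardy_Q_nn (indicator E) u}"
      have S: "S \<in> sets half_line"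
        unfolding S_def by (rule sets_level_hardy_Q_nn)
      have c: "0 \<le> c" "real (Suc (Suc n)) * \<sigma> = \<sigma> + c"
        using \<sigma> by (auto simp: c_def algebra_simps)
      have "weight_above w (hardy_Q_nn (indicator E)) (real (Suc (Suc n)) * \<sigma>)
          \<le> weight_above w (hardy_Q_nn (indicator (E \<inter> S))) \<sigma>"
      proof (rule weight_above_mono)
        fix t :: real assume t: "0 < t"
          and less: "ennreal (real (Suc (Suc n)) * \<sigma>) < hardy_Q_nn (indicator E) t"
        have le: "hardy_Q_nn (indicator E) t \<le> hardy_Q_nn (indicator (E \<inter> S)) t + ennreal c"
          using hardy_Q_nn_outside_level_set[of "indicator E" t "ennreal c"] t
          by (simp add: S_def indicator_inter_arith[abs_def])
        show "ennreal \<sigma> < hardy_Q_nn (indicator (E \<inter> S)) t"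
        proof (rule ccontr)
          assume "\<not> ennreal \<sigma> < hardy_Q_nn (indicator (E \<inter> S)) t"
          then have "hardy_Q_nn (indicator E) t \<le> ennreal \<sigma> + ennreal c"
            by (intro order_trans[OF le] add_right_mono) simp
          also have "\<dots> = ennreal (real (Suc (Suc n)) * \<sigma>)"
            unfolding c(2) using \<sigma> c(1) by (intro ennreal_plus[symmetric]) auto
          finally show False
            using less by simp
        qed
      qed
      \<comment> \<open>The weak type estimate acts on \<open>E \<inter> S\<close>; this set is then
        enlarged to \<open>S\<close>, whose weight the induction hypothesis controls.\<close>
      also have "\<dots> \<le> ennreal \<delta> * weight_of w (E \<inter> S)"
        using E S by (intro base) auto
      also have "\<dots> \<le> ennreal \<delta> * weight_of w S"
        by (intro mult_left_mono weight_of_mono) auto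
      also have "\<dots> \<le> ennreal \<delta> * (ennreal (\<delta> ^ Suc n) * weight_of w E)"
        using Suc unfolding S_def c_def weight_above_def by (intro mult_left_mono) auto
      also have "\<dots> = ennreal (\<delta> ^ Suc (Suc n)) * weight_of w E"
        using \<delta> by (simp add: ennreal_mult mult.assoc)
      finally show ?case .
    qed
  qed
qed

text \<open>For \<open>x\<close> in \<open>{0<..r}\<close> one term suffices: the \<open>j\<close>
  with \<open>x\<close> between \<open>(1 / 2) ^ Suc j * r\<close> and
  \<open>(1 / 2) ^ j * r\<close>. Full superlevel sets are used instead of disjoint layers, since
  their weights are values of the distribution function.\<close>

lemma dyadic_decomposition:
  fixes x r :: real
  assumes "0 \<le> x" "0 < r"
  shows "ennreal x \<le> ennreal (if r < x then x else 0)
    + (\<Sum>j. ennreal ((1 / 2) ^ j * r) * (if (1 / 2) ^ Suc j * r < x then 1 else 0))" (is "_ \<le> _ + (\<Sum>j. ?f j)")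
proof (cases "0 < x \<and> x \<le> r")
  case True
  obtain n where "(1 / 2) ^ n < x / r"
    using real_arch_pow_inv[of "x / r" "1 / 2"] True assms by auto
  then have ex: "\<exists>n. (1 / 2) ^ n * r < x"
    using assms by (auto simp: field_simps)
  define n where "n = (LEAST n. (1 / 2) ^ n * r < x)"
  have n: "(1 / 2) ^ n * r < x"
    unfolding n_def by (rule LeastI_ex[OF ex])
  then obtain j where j: "n = Suc j"
    using True by (cases n) auto
  have "\<not> (1 / 2) ^ j * r < x"
    using not_less_Least[of j "\<lambda>n. (1 / 2) ^ n * r < x"] j by (simp add: n_def)
  then have "ennreal x \<le> ?f j"
    using n unfolding j by (simp add: ennreal_leI)
  also have "\<dots> \<le> (\<Sum>j. ?f j)"
    by (rule term_le_suminf)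
  finally show ?thesis
    by (simp add: add_increasing)
next
  case False
  then have "ennreal x \<le> ennreal (if r < x then x else 0)"
    using assms by auto
  then show ?thesis
    by (rule add_increasing2[rotated]) simp
qed

lemma hardy_Q_nn_dyadic:
  assumes F[measurable]: "F \<in> borel_measurable half_line" and nonneg: "\<And>s. 0 \<le> F s" and r: "0 < r" and t: "0 < t"
  shows "hardy_Q_nn (\<lambda>s. ennreal (F s)) t \<le> hardy_Q_nn (\<lambda>s. ennreal (if r < F s then F s else 0)) t
    + (\<Sum>j. ennreal ((1 / 2) ^ j * r) * hardy_Q_nn (indicator {s \<in> {0..}. (1 / 2) ^ Suc j * r < F s}) t)"
proof -
  let ?G = "\<lambda>s. ennreal (if r < F s then F s else 0)"
  define E where "E j = {s \<in> {0..}. (1 / 2) ^ Suc j * r < F s}" for j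
  have E[measurable]: "E j \<in> sets half_line" for j
  proof -
    have "{s \<in> space half_line. (1 / 2) ^ Suc j * r < F s} \<in> sets half_line"
      by measurable
    then show ?thesis by (simp add: E_def)
  qed
  have [measurable]: "{t<..} \<in> sets half_line"
    using t by (intro sets_greaterThan_half_line) simp
  have "hardy_Q_nn (\<lambda>s. ennreal (F s)) t \<le> (\<integral>\<^sup>+s. ennreal (1 / s) * ?G s * indicator {t<..} s
      + (\<Sum>j. ennreal ((1 / 2) ^ j * r) * (ennreal (1 / s) * indicator (E j) s * indicator {t<..} s)) \<partial>half_line)"
    unfolding hardy_Q_nn_def
  proof (rule nn_integral_mono)
    fix s assume "s \<in> space half_line"
    then have "(if (1 / 2) ^ Suc j * r < F s then 1 else 0) = (indicator (E j) s :: ennreal)" for j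
      by (simp add: E_def split: split_indicator)
    then have "ennreal (F s) \<le> ?G s + (\<Sum>j. ennreal ((1 / 2) ^ j * r) * indicator (E j) s)"
      using dyadic_decomposition[OF nonneg[of s] r] by (simp only:)
    then have "ennreal (1 / s) * indicator {t<..} s * ennreal (F s)
        \<le> ennreal (1 / s) * indicator {t<..} s * (?G s + (\<Sum>j. ennreal ((1 / 2) ^ j * r) * indicator (E j) s))"
      by (rule mult_left_mono) simp
    also have "\<dots> = ennreal (1 / s) * ?G s * indicator {t<..} s
        + (\<Sum>j. ennreal (1 / s) * indicator {t<..} s * (ennreal ((1 / 2) ^ j * r) * indicator (E j) s))"
      unfolding ennreal_suminf_cmult distrib_left by (simp only: mult_ac)
    also have "\<dots> = ennreal (1 / s) * ?G s * indicator {t<..} s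
        + (\<Sum>j. ennreal ((1 / 2) ^ j * r) * (ennreal (1 / s) * indicator (E j) s * indicator {t<..} s))"
      by (intro arg_cong2[where f = "(+)"] refl suminf_cong) (simp only: mult_ac)
    finally show "ennreal (1 / s) * ennreal (F s) * indicator {t<..} s \<le> ennreal (1 / s) * ?G s * indicator {t<..} s
        + (\<Sum>j. ennreal ((1 / 2) ^ j * r) * (ennreal (1 / s) * indicator (E j) s * indicator {t<..} s))"
      by (simp add: mult.commute mult.left_commute)
  qed
  also have "\<dots> = hardy_Q_nn ?G t + (\<integral>\<^sup>+s. (\<Sum>j. ennreal ((1 / 2) ^ j * r) * (ennreal (1 / s) * indicator (E j) s * indicator {t<..} s)) \<partial>half_line)"
    unfolding hardy_Q_nn_def by (intro nn_integral_add) measurable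
  also have "(\<integral>\<^sup>+s. (\<Sum>j. ennreal ((1 / 2) ^ j * r) * (ennreal (1 / s) * indicator (E j) s * indicator {t<..} s)) \<partial>half_line)
      = (\<Sum>j. ennreal ((1 / 2) ^ j * r) * hardy_Q_nn (indicator (E j)) t)"
    unfolding hardy_Q_nn_def
    by (subst nn_integral_suminf) (measurable, intro suminf_cong nn_integral_cmult, measurable)
  finally show ?thesis
    by (simp only: E_def)
qed

text \<open>On the set belonging to index \<open>j\<close> the height
  \<open>Suc j * \<sigma>\<close> is tolerated. Linear growth keeps the total height finite against
  the factors \<open>(1 / 2) ^ j\<close>, while the exceptional sets shrink like
  \<open>\<delta> ^ Suc j\<close>, as fast as the dilation estimate demands.\<close>

lemma weight_above_hardy_Q_le:
  assumes op: "weighted_Lq_operator w q D T hardy_Q_nn" and \<delta>: "0 < \<delta>"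
  obtains c where "0 < c" "\<And>F r. F \<in> borel_measurable half_line \<Longrightarrow> (\<And>s. 0 \<le> F s) \<Longrightarrow> 0 < r \<Longrightarrow>
    weight_above w (hardy_Q_nn (\<lambda>s. ennreal (F s))) (c * r)
      \<le> weight_above w (hardy_Q_nn (\<lambda>s. ennreal (if r < F s then F s else 0))) r
        + (\<Sum>k. ennreal (\<delta> ^ Suc k) * weighted_distr w (\<lambda>s. complex_of_real (F s)) ((1 / 2) ^ Suc k * r))"
proof -
  interpret weighted_Lq_operator w q D T hardy_Q_nn by (rule op)
  obtain \<sigma> where \<sigma>: "0 < \<sigma>" "\<And>E n. E \<in> sets half_line \<Longrightarrow>
    weight_above w (hardy_Q_nn (indicator E)) (real (Suc n) * \<sigma>) \<le> ennreal (\<delta> ^ Suc n) * weight_of w E"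
    using hardy_Q_decay[OF op \<delta>] by blast
  \<comment> \<open>The sum of \<open>Suc j / 2 ^ j\<close> is 4. Together with the level
    \<open>r\<close> tolerated for the part of \<open>F\<close> above \<open>r\<close> this gives
    the factor \<open>1 + 4 * \<sigma>\<close>.\<close>
  have sums: "(\<lambda>j. \<sigma> * (real (Suc j) * (1 / 2) ^ j)) sums (\<sigma> * 4)"
    using sums_mult[OF geometric_deriv_sums[of "1 / 2 :: real"], of \<sigma>] by (simp add: power2_eq_square)
  show thesis
  proof (rule that[of "1 + 4 * \<sigma>"])
    fix F :: "real \<Rightarrow> real" and r :: real
    assume F[measurable]: "F \<in> borel_measurable half_line" and nonneg: "\<And>s. 0 \<le> F s" and r: "0 < r"
    let ?G = "\<lambda>s. ennreal (if r < F s then F s else 0)"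
    define E where "E j = {s \<in> {0..}. (1 / 2) ^ Suc j * r < F s}" for j
    have E: "E j \<in> sets half_line" for j
    proof -
      have "{s \<in> space half_line. (1 / 2) ^ Suc j * r < F s} \<in> sets half_line"
        by measurable
      then show ?thesis by (simp add: E_def)
    qed
    define A where "A j = {t \<in> {0<..}. ennreal (real (Suc j) * \<sigma>) < hardy_Q_nn (indicator (E j)) t}" for j
    define A0 where "A0 = {t \<in> {0<..}. ennreal r < hardy_Q_nn ?G t}"
    have A: "A j \<in> sets half_line" "A0 \<in> sets half_line" for j
      unfolding A_def A0_def by (rule sets_level_hardy_Q_nn)+
    have sub: "{t \<in> {0<..}. ennreal ((1 + 4 * \<sigma>) * r) < hardy_Q_nn (\<lambda>s. ennreal (F s)) t} \<subseteq> A0 \<union> (\<Union>j. A j)"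
    proof (rule subsetI, rule ccontr)
      fix t assume t: "t \<in> {t \<in> {0<..}. ennreal ((1 + 4 * \<sigma>) * r) < hardy_Q_nn (\<lambda>s. ennreal (F s)) t}"
        and "t \<notin> A0 \<union> (\<Union>j. A j)"
      then have le: "hardy_Q_nn ?G t \<le> ennreal r"
        "\<And>j. hardy_Q_nn (indicator (E j)) t \<le> ennreal (real (Suc j) * \<sigma>)"
        by (auto simp: A_def A0_def not_less)
      have "hardy_Q_nn (\<lambda>s. ennreal (F s)) t
          \<le> hardy_Q_nn ?G t + (\<Sum>j. ennreal ((1 / 2) ^ j * r) * hardy_Q_nn (indicator (E j)) t)"
        using t unfolding E_def by (intro hardy_Q_nn_dyadic F nonneg r) auto
      also have "\<dots> \<le> ennreal r + (\<Sum>j. ennreal ((1 / 2) ^ j * r) * ennreal (real (Suc j) * \<sigma>))"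
        by (intro add_mono le suminf_le mult_left_mono) auto
      also have "(\<Sum>j. ennreal ((1 / 2) ^ j * r) * ennreal (real (Suc j) * \<sigma>))
          = (\<Sum>j. ennreal r * ennreal (\<sigma> * (real (Suc j) * (1 / 2) ^ j)))"
        using r \<sigma>(1) by (intro suminf_cong) (simp add: ennreal_mult[symmetric] mult_ac del: of_nat_Suc)
      also have "\<dots> = ennreal r * ennreal (\<sigma> * 4)"
        using \<sigma>(1) sums by (simp del: of_nat_Suc add: suminf_ennreal_eq sums_unique[OF sums, symmetric])
      also have "ennreal r + \<dots> = ennreal ((1 + 4 * \<sigma>) * r)"
        using r \<sigma>(1) by (simp add: ennreal_mult[symmetric] ennreal_plus[symmetric] algebra_simps del: ennreal_plus)
      finally show False
        using t leD by blast
    qed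
    have "weight_above w (hardy_Q_nn (\<lambda>s. ennreal (F s))) ((1 + 4 * \<sigma>) * r) \<le> weight_of w (A0 \<union> (\<Union>j. A j))"
      unfolding weight_above_def using sub by (intro weight_of_mono) auto
    also have "\<dots> \<le> weight_of w A0 + weight_of w (\<Union>j. A j)"
      using A by (intro weight_of_Un_le w) auto
    also have "\<dots> \<le> weight_of w A0 + (\<Sum>j. weight_of w (A j))"
      using A by (intro add_left_mono weight_of_UN_le w) auto
    also have "\<dots> \<le> weight_of w A0 + (\<Sum>j. ennreal (\<delta> ^ Suc j) * weighted_distr w (\<lambda>s. complex_of_real (F s)) ((1 / 2) ^ Suc j * r))"
    proof (intro add_left_mono suminf_le)
      fix j
      have "weight_of w (A j) \<le> ennreal (\<delta> ^ Suc j) * weight_of w (E j)"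
        using \<sigma>(2)[OF E[of j], of j] by (simp add: weight_above_def A_def)
      also have "weight_of w (E j) = weighted_distr w (\<lambda>s. complex_of_real (F s)) ((1 / 2) ^ Suc j * r)"
        using nonneg by (simp add: E_def weighted_distr_def)
      finally show "weight_of w (A j) \<le> ennreal (\<delta> ^ Suc j) * weighted_distr w (\<lambda>s. complex_of_real (F s)) ((1 / 2) ^ Suc j * r)" .
    qed auto
    finally show "weight_above w (hardy_Q_nn (\<lambda>s. ennreal (F s))) ((1 + 4 * \<sigma>) * r)
      \<le> weight_above w (hardy_Q_nn ?G) r
        + (\<Sum>k. ennreal (\<delta> ^ Suc k) * weighted_distr w (\<lambda>s. complex_of_real (F s)) ((1 / 2) ^ Suc k * r))"
      by (simp add: A0_def weight_above_def)
  qed (use \<sigma> in simp)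
qed


section \<open>Boundedness on weighted rearrangement invariant spaces\<close>

lemma ennreal_mult_add:
  "0 \<le> c \<Longrightarrow> 0 \<le> a \<Longrightarrow> 0 \<le> b \<Longrightarrow> ennreal c * (ennreal a + ennreal b) = ennreal (c * (a + b))"
  by (simp add: ennreal_plus[symmetric] ennreal_mult[symmetric] del: ennreal_plus)

lemma antimono_suminf:
  fixes \<mu> :: "real \<Rightarrow> ennreal"
  assumes \<mu>: "antimono \<mu>" and a: "\<And>k::nat. 0 \<le> a k"
  shows "antimono (\<lambda>r. \<Sum>k. ennreal (b k) * \<mu> (a k * r))"
  using a by (intro antimonoI suminf_le mult_left_mono antimonoD[OF \<mu>]) auto

text \<open>An infinite integral over \<open>{0..a}\<close> makes the averages infinite at every
  \<open>t > a\<close>, hence on an interval of positive weight.\<close>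

lemma dom_PI:
  assumes w: "weight w" and f: "f \<in> borel_measurable half_line"
    and null: "weight_of w {t \<in> {0<..}. hardy_P_nn (\<lambda>s. ennreal (norm (f s))) t = \<infinity>} = 0"
  shows "f \<in> dom_P"
proof -
  let ?F = "\<lambda>s. ennreal (norm (f s))"
  have int: "set_integrable lebesgue {0..a} f" if "0 \<le> a" for a
  proof (rule set_integrable_half_lineI[OF f])
    show "(\<integral>\<^sup>+s\<in>{0..a}. ?F s \<partial>half_line) < \<infinity>"
    proof (rule ccontr)
      assume "\<not> (\<integral>\<^sup>+s\<in>{0..a}. ?F s \<partial>half_line) < \<infinity>"
      then have inf: "(\<integral>\<^sup>+s\<in>{0..a}. ?F s \<partial>half_line) = \<infinity>"
        by (simp add: less_top[symmetric])
      have "hardy_P_nn ?F t = \<infinity>" if "a < t" for t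
      proof -
        have "(\<integral>\<^sup>+s\<in>{0..a}. ?F s \<partial>half_line) \<le> (\<integral>\<^sup>+s\<in>{0..t}. ?F s \<partial>half_line)"
          using that by (intro nn_integral_mono) (auto split: split_indicator)
        then show ?thesis
          using inf that \<open>0 \<le> a\<close> by (simp add: hardy_P_nn_def top_unique ennreal_mult_top)
      qed
      then have "weight_of w {a<..<a + 1} \<le> weight_of w {t \<in> {0<..}. hardy_P_nn ?F t = \<infinity>}"
        by (intro weight_of_mono) auto
      then show False
        using weight_of_interval_pos[OF w \<open>0 \<le> a\<close>, of "a + 1"] null by simp
    qed
  qed auto
  have "f absolutely_integrable_on K" if K: "compact K" "K \<subseteq> {0..}" for K
  proof -
    obtain a where "0 < a" "\<forall>x\<in>K. norm x \<le> a"
      using compact_imp_bounded[OF K(1)] unfolding bounded_pos by blast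
    then have "K \<subseteq> {0..a}"
      using K(2) by force
    then show ?thesis
      using set_integrable_subset[OF int[of a]] \<open>0 < a\<close> lmeasurable_compact[OF K(1)] by auto
  qed
  then show ?thesis
    using f by (auto simp: dom_P_def)
qed

text \<open>Here infinity at \<open>\<tau>\<close> spreads to the left, by monotonicity, and fills
  \<open>{0<..<\<tau>}\<close>.\<close>

lemma dom_QI:
  assumes w: "weight w" and f: "f \<in> borel_measurable half_line"
    and null: "weight_of w {t \<in> {0<..}. hardy_Q_nn (\<lambda>s. ennreal (norm (f s))) t = \<infinity>} = 0"
  shows "f \<in> dom_Q"
proof -
  let ?F = "\<lambda>s. ennreal (norm (f s))"
  have "set_integrable lebesgue {\<tau><..} (\<lambda>s. (1 / s) *\<^sub>R f s)" if \<tau>: "0 < \<tau>" for \<tau>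
  proof (rule set_integrable_half_lineI)
    have "(\<lambda>s. 1 / s) \<in> borel_measurable half_line"
      by (intro borel_measurable_half_lineI) measurable
    then show "(\<lambda>s. (1 / s) *\<^sub>R f s) \<in> borel_measurable half_line"
      using f by (rule borel_measurable_scaleR)
    have eq: "(\<integral>\<^sup>+s\<in>{\<tau><..}. ennreal (norm ((1 / s) *\<^sub>R f s)) \<partial>half_line) = hardy_Q_nn ?F \<tau>"
      unfolding hardy_Q_nn_def using \<tau>
      by (intro nn_integral_cong) (auto split: split_indicator simp: ennreal_mult[symmetric])
    show "(\<integral>\<^sup>+s\<in>{\<tau><..}. ennreal (norm ((1 / s) *\<^sub>R f s)) \<partial>half_line) < \<infinity>"
    proof (rule ccontr)
      assume "\<not> (\<integral>\<^sup>+s\<in>{\<tau><..}. ennreal (norm ((1 / s) *\<^sub>R f s)) \<partial>half_line) < \<infinity>"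
      then have "hardy_Q_nn ?F \<tau> = \<infinity>"
        unfolding eq by (simp add: less_top[symmetric])
      then have "hardy_Q_nn ?F t = \<infinity>" if "t < \<tau>" for t
        using hardy_Q_nn_antimono[of t \<tau> ?F] that by (simp add: top_unique)
      then have "weight_of w {0<..<\<tau>} \<le> weight_of w {t \<in> {0<..}. hardy_Q_nn ?F t = \<infinity>}"
        by (intro weight_of_mono) auto
      then show False
        using weight_of_interval_pos[OF w order_refl \<tau>] null by simp
    qed
  qed (use \<tau> in auto)
  then show ?thesis
    using f by (auto simp: dom_Q_def)
qed

context half_line_ri_norm
begin

text \<open>An infinite value at \<open>\<epsilon>\<close> would persist on
  \<open>{0..\<epsilon>}\<close>, which is not a null set.\<close>

lemma decr_rearr_finite:
  assumes fin: "\<rho> (decr_rearr m) < \<infinity>" and "0 < \<epsilon>"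
  shows "decr_rearr m \<epsilon> < \<infinity>"
proof (rule ccontr)
  assume "\<not> decr_rearr m \<epsilon> < \<infinity>"
  then have top: "decr_rearr m t = \<infinity>" if "t \<le> \<epsilon>" for t
    using decr_rearr_antimono[OF that, of m] by (simp add: less_top[symmetric] top_unique)
  have "AE t in half_line. decr_rearr m t < \<infinity>"
    using fin by (intro finite_AE_of_norm_finite borel_measurable_half_lineI) auto
  then have "AE t in half_line. t \<notin> {0..\<epsilon>}"
    by eventually_elim (use top in auto)
  then have "{0..\<epsilon>} \<in> null_sets half_line"
    by (subst AE_iff_null_sets) (auto simp: sets_restrict_space_iff)
  then have "emeasure half_line {0..\<epsilon>} = 0"
    by auto
  then show False
    using \<open>0 < \<epsilon>\<close> by (subst (asm) emeasure_half_line) auto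
qed

text \<open>A finite value of the rearrangement at \<open>\<epsilon>\<close> supplies a level above
  which \<open>G\<close> lives on a set of weight at most \<open>\<epsilon>\<close>.\<close>

lemma weight_of_infinite_eq_0:
  assumes fin: "\<rho> (decr_rearr (weight_above w G)) < \<infinity>"
  shows "weight_of w {t \<in> {0<..}. G t = \<infinity>} = 0"
proof -
  have "weight_of w {t \<in> {0<..}. G t = \<infinity>} \<le> 0 + ennreal \<epsilon>" if \<epsilon>: "0 < \<epsilon>" for \<epsilon>
  proof -
    obtain r where "decr_rearr (weight_above w G) \<epsilon> < ennreal r"
      using decr_rearr_finite[OF fin \<epsilon>] by (metis ennreal_Ex_less_of_nat ennreal_of_nat_eq_real_of_nat infinity_ennreal_def)
    then have "weight_above w G r \<le> ennreal \<epsilon>"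
      by (rule decr_rearr_lessD[OF weight_above_antimono])
    moreover have "weight_of w {t \<in> {0<..}. G t = \<infinity>} \<le> weight_above w G r"
      unfolding weight_above_def by (intro weight_of_mono) auto
    ultimately show ?thesis by simp
  qed
  then have "weight_of w {t \<in> {0<..}. G t = \<infinity>} \<le> 0"
    using ennreal_le_epsilon[of 0] by blast
  then show ?thesis by simp
qed

text \<open>The estimate for \<open>N\<close> at the modulus of \<open>f\<close> does double duty:
  its finiteness puts \<open>f\<close> into the domain, and its value bounds the norm of
  \<open>T f\<close>.\<close>

lemma bounded_on_weightedI:
  assumes meas: "\<And>f. f \<in> borel_measurable half_line \<Longrightarrow> T f \<in> borel_measurable half_line"
    and norm_le: "\<And>f t. 0 < t \<Longrightarrow> ennreal (norm (T f t)) \<le> N (\<lambda>s. ennreal (norm (f s))) t"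
    and dom: "\<And>f. f \<in> borel_measurable half_line \<Longrightarrow>
      weight_of w {t \<in> {0<..}. N (\<lambda>s. ennreal (norm (f s))) t = \<infinity>} = 0 \<Longrightarrow> f \<in> D"
    and bd: "\<And>F. F \<in> borel_measurable half_line \<Longrightarrow> (\<And>s. 0 \<le> F s) \<Longrightarrow>
      \<rho> (decr_rearr (weighted_distr w (\<lambda>s. complex_of_real (F s)))) < \<infinity> \<Longrightarrow>
      \<rho> (decr_rearr (weight_above w (N (\<lambda>s. ennreal (F s)))))
        \<le> ennreal C * \<rho> (decr_rearr (weighted_distr w (\<lambda>s. complex_of_real (F s))))"
  shows "bounded_on_weighted \<rho> w D T"
proof -
  have main: "\<rho> (decr_rearr (weight_above w (N (\<lambda>s. ennreal (norm (f s)))))) \<le> ennreal C * weighted_norm \<rho> w f"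
    if f: "f \<in> weighted_space \<rho> w" for f
  proof -
    have "weighted_distr w (\<lambda>s. complex_of_real (norm (f s))) = weighted_distr w f"
      by (simp add: weighted_distr_def fun_eq_iff)
    then show ?thesis
      using bd[of "\<lambda>s. norm (f s)"] f
      by (auto simp: weighted_space_def weighted_norm_def weighted_rearr_eq)
  qed
  have fin: "\<rho> (decr_rearr (weight_above w (N (\<lambda>s. ennreal (norm (f s)))))) < \<infinity>"
    if f: "f \<in> weighted_space \<rho> w" for f
    using le_less_trans[OF main[OF f]] f by (simp add: weighted_space_def ennreal_mult_less_top)
  have "f \<in> D" if f: "f \<in> weighted_space \<rho> w" for f
    using f weight_of_infinite_eq_0[OF fin[OF f]] by (intro dom) (auto simp: weighted_space_def)
  moreover have "T f \<in> weighted_space \<rho> w \<and> weighted_norm \<rho> w (T f) \<le> ennreal C * weighted_norm \<rho> w f"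
    if f: "f \<in> weighted_space \<rho> w" for f
  proof -
    have f_meas: "f \<in> borel_measurable half_line"
      using f by (simp add: weighted_space_def)
    have "weighted_norm \<rho> w (T f) \<le> \<rho> (decr_rearr (weight_above w (N (\<lambda>s. ennreal (norm (f s))))))"
      unfolding weighted_norm_def weighted_rearr_eq
    proof (intro lattice AE_I2 decr_rearr_mono borel_measurable_half_lineI borel_measurable_decr_rearr)
      fix r :: real assume "0 < r"
      show "weighted_distr w (T f) r \<le> weight_above w (N (\<lambda>s. ennreal (norm (f s)))) r"
        unfolding weighted_distr_eq[OF less_imp_le[OF \<open>0 < r\<close>]]
        by (rule weight_above_mono) (rule less_le_trans[OF _ norm_le])
    qed
    then show ?thesis
      using order_trans[OF _ main[OF f]] le_less_trans[OF _ fin[OF f]] meas[OF f_meas]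
      by (simp add: weighted_space_def)
  qed
  ultimately show ?thesis
    unfolding bounded_on_weighted_def by blast
qed

lemma hardy_P_bounded:
  assumes q1: "1 \<le> q" and q2: "ereal q < lower_boyd_index \<rho>" and w\<^sub>q: "w \<in> Mq_lower q"
  shows "bounded_on_weighted \<rho> w dom_P hardy_P"
proof -
  interpret weighted_Lq_operator w q dom_P hardy_P hardy_P_nn
    by (rule hardy_P_operator[OF q1 w\<^sub>q])
  obtain R where R: "1 < R" and geometric: "\<And>K. 1 \<le> K \<Longrightarrow> \<exists>C::real. \<forall>\<mu>. antimono \<mu> \<longrightarrow> \<rho> (decr_rearr \<mu>) < \<infinity> \<longrightarrow>
      \<rho> (decr_rearr (\<lambda>r. \<Sum>k. ennreal (K * (R powr q) ^ k) * \<mu> (R ^ k * r))) \<le> ennreal C * \<rho> (decr_rearr \<mu>)"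
    using norm_decr_rearr_geometric_up[OF less_le_trans[OF zero_less_one q1] q2] by blast
  obtain K where K: "1 \<le> K" and weak: "\<And>F r. F \<in> borel_measurable half_line \<Longrightarrow> (\<And>s. 0 \<le> F s) \<Longrightarrow> 0 < r \<Longrightarrow>
    weight_above w (hardy_P_nn (\<lambda>s. ennreal (if r < F s then F s else 0))) r
      \<le> (\<Sum>k. ennreal (K * (R powr q) ^ k) * weighted_distr w (\<lambda>s. complex_of_real (F s)) (R ^ k * r))"
    using weak_type_truncated[OF R] by blast
  obtain C :: real where C: "\<And>\<mu>. antimono \<mu> \<Longrightarrow> \<rho> (decr_rearr \<mu>) < \<infinity> \<Longrightarrow>
      \<rho> (decr_rearr (\<lambda>r. \<Sum>k. ennreal (K * (R powr q) ^ k) * \<mu> (R ^ k * r))) \<le> ennreal C * \<rho> (decr_rearr \<mu>)"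
    using geometric[OF K] by blast
  show ?thesis
  proof (rule bounded_on_weightedI[where N = hardy_P_nn and C = "2 * 2 * (max 0 C + max 0 C)"])
    fix F :: "real \<Rightarrow> real"
    let ?\<mu> = "weighted_distr w (\<lambda>s. complex_of_real (F s))"
    let ?m = "\<lambda>r. \<Sum>k. ennreal (K * (R powr q) ^ k) * ?\<mu> (R ^ k * r)"
    assume F: "F \<in> borel_measurable half_line" "\<And>s. 0 \<le> F s" and fin: "\<rho> (decr_rearr ?\<mu>) < \<infinity>"
    have m: "antimono ?m"
      using R by (intro antimono_suminf weighted_distr_antimono) auto
    \<comment> \<open>The majorant \<open>?m\<close> is taken twice to fit the two-summand lemma;
      one factor 2 is the level shift from the truncation, the other the cost of splitting
      \<open>t\<close>.\<close>
    have "\<rho> (decr_rearr (weight_above w (hardy_P_nn (\<lambda>s. ennreal (F s)))))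
        \<le> ennreal (2 * 2) * (\<rho> (decr_rearr ?m) + \<rho> (decr_rearr ?m))"
    proof (rule norm_decr_rearr_add[OF m m])
      fix r :: real assume "0 < r"
      then have "weight_above w (hardy_P_nn (\<lambda>s. ennreal (F s))) (2 * r) \<le> ?m r"
        using order_trans[OF weight_above_hardy_P_le[OF F] weak[OF F]] by blast
      then show "weight_above w (hardy_P_nn (\<lambda>s. ennreal (F s))) (2 * r) \<le> ?m r + ?m r"
        by (rule order_trans) simp
    qed simp
    also have "\<dots> \<le> ennreal (2 * 2) * (ennreal C * \<rho> (decr_rearr ?\<mu>) + ennreal C * \<rho> (decr_rearr ?\<mu>))"
      using fin by (intro mult_left_mono add_mono C weighted_distr_antimono) auto
    also have "\<dots> = ennreal (2 * 2) * (ennreal (max 0 C) + ennreal (max 0 C)) * \<rho> (decr_rearr ?\<mu>)"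
      by (simp add: max_def ennreal_neg distrib_right mult.assoc)
    also have "ennreal (2 * 2) * (ennreal (max 0 C) + ennreal (max 0 C)) = ennreal (2 * 2 * (max 0 C + max 0 C))"
      by (rule ennreal_mult_add) auto
    finally show "\<rho> (decr_rearr (weight_above w (hardy_P_nn (\<lambda>s. ennreal (F s)))))
        \<le> ennreal (2 * 2 * (max 0 C + max 0 C)) * \<rho> (decr_rearr ?\<mu>)" .
  qed (use hardy_P_measurable norm_hardy_P_le dom_PI[OF w] in auto)
qed

lemma hardy_Q_bounded:
  assumes q1: "1 \<le> q" and q2: "ereal q < lower_boyd_index \<rho>" and w\<^sub>q: "w \<in> Mq_upper q"
    and upper: "upper_boyd_index \<rho> < \<infinity>"
  shows "bounded_on_weighted \<rho> w dom_Q hardy_Q"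
proof -
  note op = hardy_Q_operator[OF q1 w\<^sub>q]
  interpret weighted_Lq_operator w q dom_Q hardy_Q hardy_Q_nn
    by (rule op)
  obtain R where R: "1 < R" and geometric: "\<And>K. 1 \<le> K \<Longrightarrow> \<exists>C::real. \<forall>\<mu>. antimono \<mu> \<longrightarrow> \<rho> (decr_rearr \<mu>) < \<infinity> \<longrightarrow>
      \<rho> (decr_rearr (\<lambda>r. \<Sum>k. ennreal (K * (R powr q) ^ k) * \<mu> (R ^ k * r))) \<le> ennreal C * \<rho> (decr_rearr \<mu>)"
    using norm_decr_rearr_geometric_up[OF less_le_trans[OF zero_less_one q1] q2] by blast
  obtain K where K: "1 \<le> K" and weak: "\<And>F r. F \<in> borel_measurable half_line \<Longrightarrow> (\<And>s. 0 \<le> F s) \<Longrightarrow> 0 < r \<Longrightarrow>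
    weight_above w (hardy_Q_nn (\<lambda>s. ennreal (if r < F s then F s else 0))) r
      \<le> (\<Sum>k. ennreal (K * (R powr q) ^ k) * weighted_distr w (\<lambda>s. complex_of_real (F s)) (R ^ k * r))"
    using weak_type_truncated[OF R] by blast
  obtain C1 :: real where C1: "\<And>\<mu>. antimono \<mu> \<Longrightarrow> \<rho> (decr_rearr \<mu>) < \<infinity> \<Longrightarrow>
      \<rho> (decr_rearr (\<lambda>r. \<Sum>k. ennreal (K * (R powr q) ^ k) * \<mu> (R ^ k * r))) \<le> ennreal C1 * \<rho> (decr_rearr \<mu>)"
    using geometric[OF K] by blast
  obtain \<delta> C2 :: real where \<delta>: "0 < \<delta>" and C2: "\<And>\<mu>. antimono \<mu> \<Longrightarrow> \<rho> (decr_rearr \<mu>) < \<infinity> \<Longrightarrow>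
      \<rho> (decr_rearr (\<lambda>r. \<Sum>k. ennreal (\<delta> ^ Suc k) * \<mu> ((1 / 2) ^ Suc k * r))) \<le> ennreal C2 * \<rho> (decr_rearr \<mu>)"
    using norm_decr_rearr_geometric_down[OF upper] by blast
  obtain c where c: "0 < c" and level: "\<And>F r. F \<in> borel_measurable half_line \<Longrightarrow> (\<And>s. 0 \<le> F s) \<Longrightarrow> 0 < r \<Longrightarrow>
    weight_above w (hardy_Q_nn (\<lambda>s. ennreal (F s))) (c * r)
      \<le> weight_above w (hardy_Q_nn (\<lambda>s. ennreal (if r < F s then F s else 0))) r
        + (\<Sum>k. ennreal (\<delta> ^ Suc k) * weighted_distr w (\<lambda>s. complex_of_real (F s)) ((1 / 2) ^ Suc k * r))"
    using weight_above_hardy_Q_le[OF op \<delta>] by blast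
  \<comment> \<open>\<open>C1\<close> and \<open>C2\<close> might be negative;
    \<open>ennreal\<close> is additive on their nonnegative parts.\<close>
  define C where "C = 2 * c * (max 0 C1 + max 0 C2)"
  show ?thesis
  proof (rule bounded_on_weightedI[where N = hardy_Q_nn and C = C])
    fix F :: "real \<Rightarrow> real"
    let ?\<mu> = "weighted_distr w (\<lambda>s. complex_of_real (F s))"
    let ?m1 = "\<lambda>r. \<Sum>k. ennreal (K * (R powr q) ^ k) * ?\<mu> (R ^ k * r)"
    let ?m2 = "\<lambda>r. \<Sum>k. ennreal (\<delta> ^ Suc k) * ?\<mu> ((1 / 2) ^ Suc k * r)"
    assume F: "F \<in> borel_measurable half_line" "\<And>s. 0 \<le> F s" and fin: "\<rho> (decr_rearr ?\<mu>) < \<infinity>"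
    have m1: "antimono ?m1"
      using R by (intro antimono_suminf weighted_distr_antimono) auto
    have m2: "antimono ?m2"
      by (intro antimono_suminf weighted_distr_antimono) auto
    have "\<rho> (decr_rearr (weight_above w (hardy_Q_nn (\<lambda>s. ennreal (F s)))))
        \<le> ennreal (2 * c) * (\<rho> (decr_rearr ?m1) + \<rho> (decr_rearr ?m2))"
    proof (rule norm_decr_rearr_add[OF m1 m2 c])
      fix r :: real assume "0 < r"
      then show "weight_above w (hardy_Q_nn (\<lambda>s. ennreal (F s))) (c * r) \<le> ?m1 r + ?m2 r"
        using order_trans[OF level[OF F] add_right_mono[OF weak[OF F]]] by blast
    qed
    also have "\<dots> \<le> ennreal (2 * c) * (ennreal C1 * \<rho> (decr_rearr ?\<mu>) + ennreal C2 * \<rho> (decr_rearr ?\<mu>))"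
      using fin by (intro mult_left_mono add_mono C1 C2 weighted_distr_antimono) auto
    also have "\<dots> = ennreal (2 * c) * (ennreal (max 0 C1) + ennreal (max 0 C2)) * \<rho> (decr_rearr ?\<mu>)"
      by (simp add: max_def ennreal_neg distrib_right mult.assoc)
    also have "ennreal (2 * c) * (ennreal (max 0 C1) + ennreal (max 0 C2)) = ennreal C"
      unfolding C_def using c by (intro ennreal_mult_add) auto
    finally show "\<rho> (decr_rearr (weight_above w (hardy_Q_nn (\<lambda>s. ennreal (F s)))))
        \<le> ennreal C * \<rho> (decr_rearr ?\<mu>)" .
  qed (use hardy_Q_measurable norm_hardy_Q_le dom_QI[OF w] in auto)
qed

text \<open>A sum above \<open>2 * r\<close> has a summand above \<open>r\<close>. Subadditivity is
  thus used at the level of distribution functions, at the price of a constant.\<close>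

lemma calderon_bounded:
  assumes w: "weight w" and P: "bounded_on_weighted \<rho> w dom_P hardy_P"
    and Q: "bounded_on_weighted \<rho> w dom_Q hardy_Q"
  shows "bounded_on_weighted \<rho> w (dom_P \<inter> dom_Q) calderon"
proof -
  obtain C1 :: real where C1: "\<And>f. f \<in> weighted_space \<rho> w \<Longrightarrow> hardy_P f \<in> weighted_space \<rho> w"
    "\<And>f. f \<in> weighted_space \<rho> w \<Longrightarrow> weighted_norm \<rho> w (hardy_P f) \<le> ennreal C1 * weighted_norm \<rho> w f"
    using P unfolding bounded_on_weighted_def by blast
  obtain C2 :: real where C2: "\<And>f. f \<in> weighted_space \<rho> w \<Longrightarrow> hardy_Q f \<in> weighted_space \<rho> w"
    "\<And>f. f \<in> weighted_space \<rho> w \<Longrightarrow> weighted_norm \<rho> w (hardy_Q f) \<le> ennreal C2 * weighted_norm \<rho> w f"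
    using Q unfolding bounded_on_weighted_def by blast
  define C where "C = 2 * 2 * (max 0 C1 + max 0 C2)"
  have "calderon f \<in> weighted_space \<rho> w \<and> weighted_norm \<rho> w (calderon f) \<le> ennreal C * weighted_norm \<rho> w f"
    if f: "f \<in> weighted_space \<rho> w" for f
  proof -
    have meas[measurable]: "hardy_P f \<in> borel_measurable half_line" "hardy_Q f \<in> borel_measurable half_line"
      using C1(1)[OF f] C2(1)[OF f] by (auto simp: weighted_space_def)
    have level: "{t \<in> {0..}. r < norm (g t)} \<in> sets half_line"
      if "g \<in> borel_measurable half_line" for g :: "real \<Rightarrow> complex" and r
    proof -
      have "{t \<in> space half_line. r < norm (g t)} \<in> sets half_line"
        using that by measurable
      then show ?thesis by simp
    qed
    have "weighted_norm \<rho> w (calderon f) \<le> ennreal (2 * 2) * (weighted_norm \<rho> w (hardy_P f) + weighted_norm \<rho> w (hardy_Q f))"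
      unfolding weighted_norm_def weighted_rearr_eq
    proof (rule norm_decr_rearr_add[OF weighted_distr_antimono weighted_distr_antimono])
      fix r :: real
      have "{t \<in> {0..}. 2 * r < norm (calderon f t)} \<subseteq> {t \<in> {0..}. r < norm (hardy_P f t)} \<union> {t \<in> {0..}. r < norm (hardy_Q f t)}"
      proof
        fix t assume t: "t \<in> {t \<in> {0..}. 2 * r < norm (calderon f t)}"
        have "norm (calderon f t) \<le> norm (hardy_P f t) + norm (hardy_Q f t)"
          unfolding calderon_def by (rule norm_triangle_ineq)
        then show "t \<in> {t \<in> {0..}. r < norm (hardy_P f t)} \<union> {t \<in> {0..}. r < norm (hardy_Q f t)}"
          using t by auto
      qed
      then have "weighted_distr w (calderon f) (2 * r)
          \<le> weight_of w ({t \<in> {0..}. r < norm (hardy_P f t)} \<union> {t \<in> {0..}. r < norm (hardy_Q f t)})"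
        unfolding weighted_distr_def by (intro weight_of_mono) blast
      also have "\<dots> \<le> weighted_distr w (hardy_P f) r + weighted_distr w (hardy_Q f) r"
        unfolding weighted_distr_def by (intro weight_of_Un_le w level meas)
      finally show "weighted_distr w (calderon f) (2 * r) \<le> weighted_distr w (hardy_P f) r + weighted_distr w (hardy_Q f) r" .
    qed simp
    also have "\<dots> \<le> ennreal (2 * 2) * (ennreal C1 * weighted_norm \<rho> w f + ennreal C2 * weighted_norm \<rho> w f)"
      by (intro mult_left_mono add_mono C1(2) C2(2) f) simp
    also have "\<dots> = ennreal (2 * 2) * (ennreal (max 0 C1) + ennreal (max 0 C2)) * weighted_norm \<rho> w f"
      by (simp add: max_def ennreal_neg distrib_right mult.assoc)
    also have "ennreal (2 * 2) * (ennreal (max 0 C1) + ennreal (max 0 C2)) = ennreal C"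
      unfolding C_def by (intro ennreal_mult_add) auto
    finally have le: "weighted_norm \<rho> w (calderon f) \<le> ennreal C * weighted_norm \<rho> w f" .
    moreover have "ennreal C * weighted_norm \<rho> w f < \<infinity>"
      using f by (simp add: weighted_space_def ennreal_mult_less_top)
    moreover have "calderon f \<in> borel_measurable half_line"
      unfolding calderon_def by measurable
    ultimately show ?thesis
      using le_less_trans[OF le] by (simp add: weighted_space_def)
  qed
  then show ?thesis
    using P Q unfolding bounded_on_weighted_def by blast
qed

end

theorem theorem4p2:
  fixes \<rho> :: "(real \<Rightarrow> ennreal) \<Rightarrow> ennreal"
  assumes "ri_banach_function_norm half_line \<rho>"
    and "1 < lower_boyd_index \<rho>" and "lower_boyd_index \<rho> < \<infinity>"
    and "1 < upper_boyd_index \<rho>" and "upper_boyd_index \<rho> < \<infinity>"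
  shows "(\<Union>q\<in>{q::real. 1 \<le> q \<and> ereal q < lower_boyd_index \<rho>}. Mq_lower q) \<subseteq> P_weights \<rho>
    \<and> (\<Union>q\<in>{q::real. 1 \<le> q \<and> ereal q < lower_boyd_index \<rho>}. Mq_upper q) \<subseteq> Q_weights \<rho>
    \<and> (\<forall>w \<in> (\<Union>q\<in>{q::real. 1 \<le> q \<and> ereal q < lower_boyd_index \<rho>}. Mq_lower q \<inter> Mq_upper q).
          bounded_on_weighted \<rho> w (dom_P \<inter> dom_Q) calderon)
    \<and> (\<Union>q\<in>{q::real. 1 \<le> q \<and> ereal q < lower_boyd_index \<rho>}. Mq_lower q \<inter> Mq_upper q)
        \<subseteq> C_weights \<rho>"
proof -
  interpret half_line_ri_norm \<rho>
    unfolding half_line_ri_norm_def by (rule assms(1))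
  have weight: "w \<in> Mq_lower q \<Longrightarrow> weight w" "w \<in> Mq_upper q \<Longrightarrow> weight w" for w q
    by (simp_all add: Mq_lower_def Mq_upper_def P_weights_def Q_weights_def)
  have P: "bounded_on_weighted \<rho> w dom_P hardy_P"
    if "1 \<le> q" "ereal q < lower_boyd_index \<rho>" "w \<in> Mq_lower q" for q w
    using hardy_P_bounded that .
  have Q: "bounded_on_weighted \<rho> w dom_Q hardy_Q"
    if "1 \<le> q" "ereal q < lower_boyd_index \<rho>" "w \<in> Mq_upper q" for q w
    using hardy_Q_bounded[OF that assms(5)] .
  have PQ: "bounded_on_weighted \<rho> w (dom_P \<inter> dom_Q) calderon"
    if "1 \<le> q" "ereal q < lower_boyd_index \<rho>" "w \<in> Mq_lower q" "w \<in> Mq_upper q" for q w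
    using calderon_bounded weight(1)[OF that(3)] P[OF that(1,2,3)] Q[OF that(1,2,4)] .
  show ?thesis
    using P Q PQ weight by (auto simp: C_weights_def P_weights_def Q_weights_def)
qed

end
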